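(* Let $M$ be a segment Halin graph with $m(M)$ segments, $p(M)$ intersection points and $c(M)$ circuits. Then \[p(M)\leq 3m(M)-11,\qquad c(M)\leq 2m(M)-6,\] and these bounds are tight.
   Context: $M$ is a finite set of line segments of nonzero length in the plane; collinear intersecting segments are treated as a single segment. $P(M)$ is the set of points lying on at least two segments of $M$ (intersection points), $J(M)$ the set of segment endpoints. $G_M$ is the graph with vertex set $P(M)\cup J(M)$, where $u,v$ are adjacent iff some segment $s\in M$ contains both and no point of $P(M)\cup J(M)$ lies on $s$ strictly between them; $G_M$ is embedded in the plane as drawn by $M$. Circuits of $M$ are the bounded faces of $G_M$. $m(M)=|M|$, $p(M)=|P(M)|$, $c(M)$ is the number of circuits. A Halin graph is a graph obtained from a plane tree with no vertices of degree two by joining its leaves in a cycle in their clockwise order given by the embedding. $M$ is a segment Halin graph if $G_M$ is a Halin graph and, in the embedding of $G_M$ induced by $M$, the edges of the outer face are exactly the edges of the cycle used in this construction. "Tight" means there exist segment Halin graphs (for infinitely many values of $m$) for which each bound holds with equality. *)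

theory Defs
  imports "HOL-Analysis.Analysis" "HOL-Combinatorics.Orbits"
begin

section \<open>Segment systems\<close>

text \<open>The plane is \<^typ>\<open>complex\<close>, the type used by the library for the topology of plane curves.\<close>

text \<open>The last condition expresses that collinear intersecting segments have been merged.\<close>

definition segment_system :: "complex set set \<Rightarrow> bool" where
  "segment_system M \<longleftrightarrow>
     finite M \<and>
     (\<forall>s\<in>M. \<exists>a b. a \<noteq> b \<and> s = closed_segment a b) \<and>
     (\<forall>s\<in>M. \<forall>t\<in>M. s \<noteq> t \<and> collinear (s \<union> t) \<longrightarrow> s \<inter> t = {})"

definition intersection_points :: "complex set set \<Rightarrow> complex set" where
  "intersection_points M = {x. \<exists>s\<in>M. \<exists>t\<in>M. s \<noteq> t \<and> x \<in> s \<and> x \<in> t}"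

definition segment_endpoints :: "complex set set \<Rightarrow> complex set" where
  "segment_endpoints M = {a. \<exists>b. closed_segment a b \<in> M}"

definition seg_verts :: "complex set set \<Rightarrow> complex set" where
  "seg_verts M = intersection_points M \<union> segment_endpoints M"

definition seg_edges :: "complex set set \<Rightarrow> complex set set" where
  "seg_edges M = {{u, v} | u v. u \<in> seg_verts M \<and> v \<in> seg_verts M \<and> u \<noteq> v \<and>
     (\<exists>s\<in>M. u \<in> s \<and> v \<in> s \<and> seg_verts M \<inter> open_segment u v = {})}"

text \<open>The drawing of the graph is \<open>\<Union>M\<close>, so its faces are the components of \<open>- \<Union>M\<close>. As \<open>\<Union>M\<close> is
  bounded, \<open>outside (\<Union>M)\<close> is the unique unbounded face. The edge \<open>e = {u, v}\<close> is drawn as the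
  segment \<open>convex hull e\<close>.\<close>

definition circuits :: "complex set set \<Rightarrow> complex set set" where
  "circuits M = {F \<in> components (- \<Union>M). bounded F}"

definition outer_edges :: "complex set set \<Rightarrow> complex set set" where
  "outer_edges M = {e \<in> seg_edges M. convex hull e \<subseteq> frontier (outside (\<Union>M))}"

section \<open>Plane trees and Halin graphs\<close>

text \<open>A simple graph is given by its vertex set and its set of edges, which are two-element sets
  of vertices.\<close>

definition simple_graph :: "'a set \<Rightarrow> 'a set set \<Rightarrow> bool" where
  "simple_graph V E \<longleftrightarrow> finite V \<and> (\<forall>e\<in>E. e \<subseteq> V \<and> card e = 2)"

definition vdegree :: "'a set set \<Rightarrow> 'a \<Rightarrow> nat" where
  "vdegree E v = card {e \<in> E. v \<in> e}"

definition nbrs :: "'a set set \<Rightarrow> 'a \<Rightarrow> 'a set" where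
  "nbrs E v = {u. {v, u} \<in> E}"

definition darts :: "'a set set \<Rightarrow> ('a \<times> 'a) set" where
  "darts E = {(u, v). {u, v} \<in> E}"

definition cycle_edges :: "'a list \<Rightarrow> 'a set set" where
  "cycle_edges xs = {{xs ! i, xs ! (Suc i mod length xs)} | i. i < length xs}"

definition is_tree :: "'a set \<Rightarrow> 'a set set \<Rightarrow> bool" where
  "is_tree V E \<longleftrightarrow>
     simple_graph V E \<and> V \<noteq> {} \<and>
     (\<forall>u\<in>V. \<forall>v\<in>V. (u, v) \<in> (darts E)\<^sup>*) \<and>
     \<not> (\<exists>xs. 3 \<le> length xs \<and> distinct xs \<and> cycle_edges xs \<subseteq> E)"

text \<open>The embedding of a plane tree is given by its rotation system: \<open>\<rho> v u\<close> is the neighbour of \<open>v\<close>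
  that follows the neighbour \<open>u\<close> in clockwise order around \<open>v\<close>. Every rotation system of a tree
  arises from an embedding in the plane.\<close>

definition rotation_system :: "'a set \<Rightarrow> 'a set set \<Rightarrow> ('a \<Rightarrow> 'a \<Rightarrow> 'a) \<Rightarrow> bool" where
  "rotation_system V E \<rho> \<longleftrightarrow> (\<forall>v\<in>V. cyclic_on (\<rho> v) (nbrs E v))"

text \<open>The closed walk once around the only face of a plane tree: it traverses every edge once in
  each direction, and the dart \<open>(u, v)\<close> is followed by \<open>(v, \<rho> v u)\<close>. As \<open>\<rho>\<close> is clockwise, the walk
  has the face on its left, so it goes round the tree clockwise. It is unique up to the choice
  of the first dart.\<close>

definition boundary_walk :: "'a set set \<Rightarrow> ('a \<Rightarrow> 'a \<Rightarrow> 'a) \<Rightarrow> ('a \<times> 'a) list \<Rightarrow> bool" where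
  "boundary_walk E \<rho> ds \<longleftrightarrow>
     distinct ds \<and> set ds = darts E \<and>
     (\<forall>i < length ds. case ds ! i of (u, v) \<Rightarrow> ds ! (Suc i mod length ds) = (v, \<rho> v u))"

text \<open>The leaves in clockwise order, starting from some leaf. A leaf is the tail of exactly one
  dart, so it is listed once.\<close>

definition clockwise_leaves :: "'a set set \<Rightarrow> ('a \<Rightarrow> 'a \<Rightarrow> 'a) \<Rightarrow> 'a list \<Rightarrow> bool" where
  "clockwise_leaves E \<rho> ls \<longleftrightarrow>
     (\<exists>ds. boundary_walk E \<rho> ds \<and> ls = filter (\<lambda>v. vdegree E v = 1) (map fst ds))"

text \<open>The graph \<open>(V, E)\<close> is obtained from a plane tree with edge set \<open>T\<close> by joining its leaves in the
  cycle with edge set \<open>C\<close>. A cycle has at least three vertices, which excludes the trees with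
  one or two vertices.\<close>

definition halin_construction :: "'a set \<Rightarrow> 'a set set \<Rightarrow> 'a set set \<Rightarrow> 'a set set \<Rightarrow> bool" where
  "halin_construction V E T C \<longleftrightarrow>
     is_tree V T \<and> (\<forall>v\<in>V. vdegree T v \<noteq> 2) \<and>
     (\<exists>\<rho> ls. rotation_system V T \<rho> \<and> clockwise_leaves T \<rho> ls \<and>
        3 \<le> length ls \<and> C = cycle_edges ls) \<and>
     E = T \<union> C"

definition segment_halin_graph :: "complex set set \<Rightarrow> bool" where
  "segment_halin_graph M \<longleftrightarrow>
     segment_system M \<and>
     (\<exists>T C. halin_construction (seg_verts M) (seg_edges M) T C \<and> outer_edges M = C)"

end

theory Submission
  imports Defs
begin

text \<open>Let the tree have \<open>k\<close> leaves. Deleting the cycle edges leaves a tree, whose complement is connected, and each of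
  the \<open>k\<close> cycle edges adds at most one face, so there are at most \<open>k\<close> circuits. A vertex of odd degree is the end of
  some segment, and at an extreme point of the convex hull all segments end. As there are at least three
  such points and every leaf has degree 3, the \<open>2m\<close> segment ends give \<open>k + o + 6 \<le> 2m\<close>, where \<open>o\<close> is the number of inner
  vertices of odd degree. Counting degrees in the tree bounds the number of inner vertices in terms of \<open>k\<close>, and
  together this yields \<open>p \<le> 3m - 10 - o\<close>.

  If \<open>p = 3m - 10\<close>, then the hull is a triangle whose corners are leaves, every other leaf is the end of one segment, and
  every inner vertex is a crossing of two segments. The outer polygon is then a pseudotriangle: a closed curve
  made of a chain of outer edges and a chord has its convex corners only at the ends of the chord and at hull
  corners. So the segment that enters the interior at a hull corner reaches the outer cycle between the other two
  corners. Hence the three segments from the corners cross pairwise, and by acyclicity of the tree in a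
  single point, which would have degree 6.

  Equality in both bounds is attained by a triangle with its three medians and chords near one corner.\<close>

text \<open>The degree count is this: let \<open>e\<close> inner vertices have even degree. Tree
  degrees are at least 1 at leaves, 3 and 4 at inner vertices of odd and even degree, and add up to
  2|V| - 2, so o + 2e + 2 \<le> k. With k + o + 6 \<le> 2m this leaves |V| = k + o + e \<le> 3m - 10
  - o. Gaining one more, which matters only for o = 0, is where the geometry of segments enters. In
  the case of equality a leaf \<open>w\<close> other than a hull corner has degree 3 and a single
  segment end, so one segment runs straight through it. If that segment contains the tree edge at
  \<open>w\<close> and a cycle edge, the outer face is left with the sector between the two cycle
  edges, which is smaller than a half plane. Hence the outer polygon never turns convexly at
  \<open>w\<close>. A chain of outer edges closed by a chord from a hull corner therefore lies in
  the convex hull of the ends of the chord and of the hull corners on the chain. Without a further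
  hull corner this hull would be a segment, too thin for a Jordan curve; with exactly one it is a
  triangle, which tells on which side of the chord the chain lies.\<close>

section \<open>Components of the complement of plane sets\<close>

text \<open>Two points of one component of \<open>- X\<close> stay connected after adding
  \<open>Y\<close>, by Janiszewski's theorem, since \<open>Y\<close> separates nothing and meets
  \<open>X\<close> in a connected set. Hence sending a new component to the old one around it is
  injective.\<close>

lemma card_components_Un_le:
  fixes X Y :: "complex set"
  assumes X: "compact X" and Y: "compact Y" and XY: "connected (X \<inter> Y)" and coY: "connected (- Y)"
    and fin: "finite (components (- X))"
  shows "finite (components (- (X \<union> Y)))" and "card (components (- (X \<union> Y))) \<le> card (components (- X))"
proof -
  have "\<exists>g. \<forall>F \<in> components (- (X \<union> Y)). g F \<in> components (- X) \<and> F \<subseteq> g F"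
  proof -
    have "\<exists>G. G \<in> components (- X) \<and> F \<subseteq> G" if "F \<in> components (- (X \<union> Y))" for F
      using that exists_component_superset[of F "- X"]
      by (metis Compl_Un bot.extremum_uniqueI in_components_connected in_components_nonempty
          in_components_subset le_inf_iff)
    then show ?thesis by metis
  qed
  then obtain g where g: "\<And>F. F \<in> components (- (X \<union> Y)) \<Longrightarrow> g F \<in> components (- X) \<and> F \<subseteq> g F"
    by blast
  have inj: "inj_on g (components (- (X \<union> Y)))"
  proof (rule inj_onI)
    fix F F' assume F: "F \<in> components (- (X \<union> Y))" and F': "F' \<in> components (- (X \<union> Y))" and eq: "g F = g F'"
    obtain a b where a: "a \<in> F" and b: "b \<in> F'" using F F' in_components_nonempty by blast
    have "connected_component (- X) a b"
      unfolding connected_component_def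
      using g[OF F] g[OF F'] eq a b by (metis in_components_connected in_components_subset subsetD)
    moreover have "connected_component (- Y) a b"
    proof -
      have "a \<in> - Y" "b \<in> - Y" using F F' a b in_components_subset by blast+
      then show ?thesis using coY by (simp add: connected_iff_connected_component)
    qed
    ultimately have "connected_component (- (X \<union> Y)) a b"
      using Janiszewski[OF X _ XY] Y compact_imp_closed by blast
    then show "F = F'" using F F' a b
      by (smt (verit, best) connected_component_eq componentsE connected_component_eq_eq mem_Collect_eq)
  qed
  show "finite (components (- (X \<union> Y)))"
    by (rule inj_on_finite[OF inj _ fin]) (use g in blast)
  show "card (components (- (X \<union> Y))) \<le> card (components (- X))"
    by (rule card_inj_on_le[OF inj _ fin]) (use g in blast)
qed

text \<open>A component that avoided the ball, and with it the removed set \<open>G\<close>, would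
  be open and closed in the connected set \<open>D\<close>.\<close>

lemma component_Diff_meets_ball:
  fixes F D :: "complex set"
  assumes "connected D" "open (D - G)" "F \<in> components (D - G)" "G \<subseteq> ball c r" "ball c r \<subseteq> D" "F \<noteq> D"
  shows "F \<inter> ball c r \<noteq> {}"
proof
  assume dis: "F \<inter> ball c r = {}"
  have oF: "open F" using assms by (meson open_components)
  have "closedin (top_of_set (D - G)) F" using assms(3) closedin_component by blast
  then obtain K where K: "closed K" "F = (D - G) \<inter> K" by (auto simp: closedin_closed)
  have "F = D \<inter> (K \<inter> - ball c r)"
    using K dis assms(4) by blast
  then have "closedin (top_of_set D) F"
    using K(1) by (metis closedin_closed_Int closed_Compl closed_Int open_ball)
  moreover have "openin (top_of_set D) F"
    using oF in_components_subset[OF assms(3)] by (metis Diff_subset order_trans open_subset)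
  ultimately show False
    using assms(1,3,6) by (metis connected_clopen in_components_nonempty)
qed

section \<open>The plane determinant as a test for the sides of a line\<close>

definition cross :: "complex \<Rightarrow> complex \<Rightarrow> real" where
  "cross u v = Re u * Im v - Im u * Re v"

lemma cross_inner: "cross u v = (\<i> * u) \<bullet> v"
  by (simp add: cross_def inner_complex_def)

lemma cross_linear:
  "cross u (v + w) = cross u v + cross u w" "cross u (v - w) = cross u v - cross u w"
  "cross (u + v) w = cross u w + cross v w" "cross (u - v) w = cross u w - cross v w"
  by (auto simp: cross_def algebra_simps)

lemma cross_simps [simp]:
  "cross (t *\<^sub>R u) v = t * cross u v" "cross u (t *\<^sub>R v) = t * cross u v"
  "cross u u = 0" "cross 0 u = 0" "cross u 0 = 0" "cross (- u) v = - cross u v" "cross u (- v) = - cross u v"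
  by (auto simp: cross_def algebra_simps)

lemma cross_commute: "cross u v = - cross v u"
  by (simp add: cross_def)

lemma cross_eq_0_imp_scaleR:
  assumes "cross d v = 0" "d \<noteq> 0" shows "\<exists>t. v = t *\<^sub>R d"
proof -
  have n: "(Re d)\<^sup>2 + (Im d)\<^sup>2 \<noteq> 0" using assms(2) by (simp add: complex_eq_iff sum_power2_eq_zero_iff)
  define t where "t = (Re d * Re v + Im d * Im v) / ((Re d)\<^sup>2 + (Im d)\<^sup>2)"
  have "Re v * ((Re d)\<^sup>2 + (Im d)\<^sup>2) = (Re d * Re v + Im d * Im v) * Re d"
    "Im v * ((Re d)\<^sup>2 + (Im d)\<^sup>2) = (Re d * Re v + Im d * Im v) * Im d"
    using assms(1) unfolding cross_def by algebra+
  then have "v = t *\<^sub>R d" using n by (simp add: t_def complex_eq_iff field_simps)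
  then show ?thesis ..
qed

lemma convex_cross_gt: "convex {x. cross d (x - a) > t}" and convex_cross_lt: "convex {x. cross d (x - a) < t}"
proof -
  have "{x. cross d (x - a) > t} = {x. (\<i> * d) \<bullet> x > t + (\<i> * d) \<bullet> a}"
    "{x. cross d (x - a) < t} = {x. (\<i> * d) \<bullet> x < t + (\<i> * d) \<bullet> a}"
    by (auto simp: cross_inner inner_diff_right)
  then show "convex {x. cross d (x - a) > t}" "convex {x. cross d (x - a) < t}"
    by (simp_all add: convex_halfspace_gt convex_halfspace_lt)
qed

text \<open>Two pendant pieces of the segment are attached first, which separates nothing by Janiszewski's
  theorem; the remaining gap lies in a small ball, which it cuts into two halves.\<close>

lemma card_components_Un_segment_le:
  fixes X :: "complex set"
  assumes X: "compact X" and fin: "finite (components (- X))" and ab: "a \<in> X" "b \<in> X" "a \<noteq> b"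
    and int: "X \<inter> closed_segment a b = {a, b}"
  shows "finite (components (- (X \<union> closed_segment a b)))"
    "card (components (- (X \<union> closed_segment a b))) \<le> card (components (- X)) + 1"
proof -
  define c where "c = midpoint a b"
  let ?P = "\<lambda>t. a + t *\<^sub>R (b - a)"
  have seg: "closed_segment a b = ?P ` {0..1}"
    unfolding closed_segment_image_interval by (intro image_cong) (auto simp: algebra_simps)
  have cP: "c = ?P (1/2)" by (simp add: c_def midpoint_def complex_eq_iff field_simps)
  have Pd: "dist (?P s) (?P t) = \<bar>s - t\<bar> * norm (b - a)" for s t
    by (simp add: dist_norm scaleR_diff_left[symmetric])
  have "c \<notin> X" 
  proof
    assume "c \<in> X"
    then have "c \<in> {a, b}" using int midpoint_in_closed_segment[of a b] unfolding c_def by blast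
    then show False using ab(3) midpoint_eq_endpoint c_def by (metis insert_iff empty_iff)
  qed
  then obtain r where r: "r > 0" "ball c r \<inter> X = {}"
    using X by (metis compact_imp_closed Compl_iff open_Compl open_contains_ball disjoint_eq_subset_Compl)
  \<comment> \<open>The gap consists of the parameters within \<open>\<delta>\<close> of 1/2. The
    bound \<open>r / norm (b - a)\<close> keeps its ball \<open>?B\<close> inside the ball around
    \<open>c\<close> that misses \<open>X\<close>; the bound 1/4 leaves room for the pendant pieces
    on both sides.\<close>
  define \<delta> where "\<delta> = min (1/4) (r / norm (b - a))"
  define \<rho> where "\<rho> = \<delta> * norm (b - a)"
  have nz: "norm (b - a) > 0" using ab by simp
  have \<delta>: "0 < \<delta>" "\<delta> \<le> 1/4" using r nz by (auto simp: \<delta>_def min_def)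
  have \<rho>: "0 < \<rho>" "\<rho> \<le> r" using \<delta> nz by (auto simp: \<rho>_def \<delta>_def min_def field_simps)
  let ?e1 = "closed_segment a (?P (1/2 - \<delta>))" and ?e2 = "closed_segment (?P (1/2 + \<delta>)) b"
  let ?B = "ball c \<rho>" and ?e = "closed_segment a b"
  have e1: "?e1 = ?P ` {0..1/2 - \<delta>}"
  proof -
    have "?e1 = ?P ` closed_segment 0 (1/2 - \<delta>)"
      using closed_segment_linear_image[of "\<lambda>t. t *\<^sub>R (b - a)" 0 "1/2 - \<delta>"]
      by (simp add: closed_segment_translation[of a 0, simplified] image_image bounded_linear.linear bounded_linear_scaleR_left)
    then show ?thesis using \<delta> by (simp add: closed_segment_eq_real_ivl)
  qed
  have e2: "?e2 = ?P ` {1/2 + \<delta>..1}"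
  proof -
    have "?e2 = ?P ` closed_segment (1/2 + \<delta>) 1"
      using closed_segment_linear_image[of "\<lambda>t. t *\<^sub>R (b - a)" "1/2 + \<delta>" 1]
       closed_segment_translation[of a "(1/2 + \<delta>) *\<^sub>R (b - a)" "b - a"]
      by (simp add: image_image bounded_linear.linear bounded_linear_scaleR_left)
    then show ?thesis using \<delta> by (simp add: closed_segment_eq_real_ivl)
  qed
  define Y where "Y = X \<union> ?e1 \<union> ?e2"
  have inj: "inj ?P" using ab by (auto simp: inj_on_def)
  have X1: "X \<inter> ?e1 = {a}"
  proof -
    have "?e1 \<subseteq> ?e" using \<delta> unfolding e1 seg by (intro image_mono) auto
    moreover have "b \<notin> ?e1" 
    proof
      assume "b \<in> ?e1"
      then obtain t where t: "b = ?P t" "t \<le> 1/2 - \<delta>" unfolding e1 by auto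
      then have "?P 1 = ?P t" by simp
      then have "t = 1" using injD[OF inj] by metis
      then show False using t \<delta> by simp
    qed
    ultimately show ?thesis using int ab by auto
  qed
  have X2: "(X \<union> ?e1) \<inter> ?e2 = {b}"
  proof -
    have "?e2 \<subseteq> ?e" using \<delta> unfolding e2 seg by (intro image_mono) auto
    moreover have "a \<notin> ?e2" using \<delta> ab(3) unfolding e2 by auto
    moreover have "?e1 \<inter> ?e2 = {}" unfolding e1 e2 using \<delta> ab(3) by auto
    ultimately show ?thesis using int ab by auto
  qed
  have seg_compl: "connected (- closed_segment x y)" for x y :: complex
    using connected_complement_bounded_convex[of "closed_segment x y"] by (simp add: bounded_closed_segment)
  note c1 = card_components_Un_le[OF X, of ?e1, unfolded X1, simplified, OF seg_compl fin]
  have c2: "finite (components (- Y))" "card (components (- Y)) \<le> card (components (- X))"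
    using card_components_Un_le[of "X \<union> ?e1" ?e2, unfolded X2, simplified, OF _ seg_compl c1(1)] X c1(2)
    unfolding Y_def by (auto simp: compact_Un)
  have BY: "?B \<inter> Y = {}"
  proof -
    have "?B \<inter> X = {}" using r \<rho> by (metis disjoint_iff mem_ball order_less_le_trans)
    moreover have "?B \<inter> ?P ` {0..1/2 - \<delta>} = {}" "?B \<inter> ?P ` {1/2+\<delta>..1} = {}"
      using nz by (auto simp: cP Pd \<rho>_def simp del: scaleR_right_diff_distrib)
    ultimately show ?thesis by (auto simp: Y_def e1 e2)
  qed
  have ZY: "X \<union> ?e = Y \<union> (?B \<inter> ?e)"
  proof -
    have "?P t \<in> ?P ` {0..1/2 - \<delta>} \<union> ?P ` {1/2 + \<delta>..1} \<union> ?B" if "t \<in> {0..1}" for t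
    proof (cases "\<bar>1/2 - t\<bar> < \<delta>")
      case True then show ?thesis using nz by (simp add: cP Pd \<rho>_def del: scaleR_right_diff_distrib)
    next
      case False then show ?thesis using that by (auto simp: abs_if split: if_splits)
    qed
    moreover have "?P ` {0..1/2 - \<delta>} \<subseteq> ?P ` {0..1}" "?P ` {1/2 + \<delta>..1} \<subseteq> ?P ` {0..1}" using \<delta> by auto
    ultimately show ?thesis unfolding Y_def e1 e2 seg by blast
  qed
  define Z where "Z = X \<union> ?e"
  have cl: "closed Y" "closed Z" using X by (auto simp: Y_def Z_def intro!: closed_Un compact_imp_closed[of X] closed_segment)
  obtain D where D: "D \<in> components (- Y)" "?B \<subseteq> D"
    using exists_component_superset[of ?B "- Y"] BY \<rho>
    by (metis Int_commute centre_in_ball connected_ball disjoint_eq_subset_Compl empty_iff subset_empty)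
  let ?f = "\<lambda>x. cross (b - a) (x - a)"
  have half: "?B - Z = (?B \<inter> {x. ?f x > 0}) \<union> (?B \<inter> {x. ?f x < 0})"
  proof -
    have "x \<in> ?e \<longleftrightarrow> ?f x = 0" if "x \<in> ?B" for x
    proof
      assume "?f x = 0"
      then obtain t where "x - a = t *\<^sub>R (b - a)" using cross_eq_0_imp_scaleR[of "b - a"] ab(3) by auto
      then have t: "x = ?P t" by (simp add: algebra_simps)
      with that have "\<bar>1/2 - t\<bar> < \<delta>" using nz by (simp add: cP Pd \<rho>_def del: scaleR_right_diff_distrib)
      then show "x \<in> ?e" using \<delta> unfolding seg t by (intro imageI) auto
    next
      assume "x \<in> ?e" then show "?f x = 0" by (auto simp: seg)
    qed
    then show ?thesis using ZY BY unfolding Z_def by fastforce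
  qed
  \<comment> \<open>A new face either meets \<open>?B\<close>, and then contains one of its two open
    halves, or is an old face other than the face \<open>D\<close> around \<open>?B\<close>. This
    gives 2 + (old count - 1).\<close>
  define N where "N = {F \<in> components (- Z). F \<inter> ?B \<noteq> {}}"
  have N: "finite N \<and> card N \<le> 2"
  proof -
    have "\<exists>K. \<forall>F\<in>N. F \<inter> (?B \<inter> S) \<noteq> {} \<longrightarrow> F = K" if "convex S" "?B \<inter> S \<subseteq> - Z" for S
    proof -
      have "connected (?B \<inter> S)" using that by (simp add: convex_Int convex_connected)
      then have sub: "?B \<inter> S \<subseteq> F" if "F \<in> N" "F \<inter> (?B \<inter> S) \<noteq> {}" for F
        using that components_maximal[of F "- Z" "?B \<inter> S"] \<open>?B \<inter> S \<subseteq> - Z\<close> unfolding N_def by blast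
      have "F = F'" if F: "F \<in> N" "F' \<in> N" "F \<inter> (?B \<inter> S) \<noteq> {}" "F' \<inter> (?B \<inter> S) \<noteq> {}" for F F'
      proof -
        have "F \<inter> F' \<noteq> {}" using sub[OF F(1,3)] sub[OF F(2,4)] F(3) by blast
        then show ?thesis using F(1,2) components_nonoverlap unfolding N_def by blast
      qed
      then show ?thesis by metis
    qed
    note * = this
    have sub: "?B \<inter> {x. ?f x > 0} \<subseteq> - Z" "?B \<inter> {x. ?f x < 0} \<subseteq> - Z" using half by blast+
    obtain K1 where K1: "\<forall>F\<in>N. F \<inter> (?B \<inter> {x. ?f x > 0}) \<noteq> {} \<longrightarrow> F = K1"
      using *[OF convex_cross_gt sub(1)] by meson
    obtain K2 where K2: "\<forall>F\<in>N. F \<inter> (?B \<inter> {x. ?f x < 0}) \<noteq> {} \<longrightarrow> F = K2"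
      using *[OF convex_cross_lt sub(2)] by meson
    note K = K1 K2
    have "N \<subseteq> {K1, K2}"
    proof
      fix F assume F: "F \<in> N"
      then obtain x where "x \<in> F" "x \<in> ?B" "x \<notin> Z" using in_components_subset unfolding N_def by blast
      then have "x \<in> (?B \<inter> {x. ?f x > 0}) \<union> (?B \<inter> {x. ?f x < 0})" using half by blast
      then show "F \<in> {K1, K2}" using K F \<open>x \<in> F\<close> by blast
    qed
    moreover have "card {K1, K2} \<le> 2" by (simp add: card_insert_if)
    ultimately show ?thesis
      by (meson card_mono finite.emptyI finite.insertI finite_subset order_trans)
  qed
  have far: "F \<in> components (- Y) - {D}" if F: "F \<in> components (- Z)" "F \<inter> ?B = {}" for F
  proof -
    have FY: "F \<subseteq> - Y" using in_components_subset[OF F(1)] ZY by (auto simp: Z_def)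
    obtain F' where F': "F' \<in> components (- Y)" "F \<subseteq> F'"
      using exists_component_superset[OF FY] F(1) in_components_connected in_components_nonempty FY by (metis bot.extremum_uniqueI)
    show ?thesis
    proof (cases "F' = D")
      case True
      have DG: "D - ?B \<inter> ?e = D - Z" using in_components_subset[OF D(1)] ZY by (auto simp: Z_def)
      have "F \<in> components (D - ?B \<inter> ?e)"
        unfolding DG
        by (rule components_intermediate_subset[OF F(1)]) (use F F' True in_components_subset in fastforce)+
      moreover have "open (D - ?B \<inter> ?e)" unfolding DG using cl D(1) by (meson open_Compl open_Diff open_components)
      ultimately have "F \<inter> ?B \<noteq> {}"
        using component_Diff_meets_ball[of D "?B \<inter> ?e" F c \<rho>] D F(2) \<rho>(1) in_components_connected[OF D(1)]
        by (metis Int_absorb1 ball_eq_empty inf_commute inf_le1 linorder_not_le)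
      then show ?thesis using F by blast
    next
      case False
      then have "F' \<inter> D = {}" using D F' components_nonoverlap by blast
      then have "F' \<subseteq> - Z" using in_components_subset[OF F'(1)] ZY D(2) by (auto simp: Z_def)
      then have "F' \<subseteq> F"
        using components_maximal[OF F(1) in_components_connected[OF F'(1)]] F'(2) in_components_nonempty[OF F(1)] by blast
      then have "F = F'" using F' by blast
      then show ?thesis using F' False by blast
    qed
  qed
  have sub: "components (- Z) \<subseteq> N \<union> (components (- Y) - {D})" using far unfolding N_def by blast
  have finU: "finite (N \<union> (components (- Y) - {D}))" using N c2 by simp
  show "finite (components (- (X \<union> ?e)))" using finite_subset[OF sub finU] by (simp add: Z_def)
  have "card (components (- Z)) \<le> card (N \<union> (components (- Y) - {D}))" by (rule card_mono[OF finU sub])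
  also have "\<dots> \<le> card N + card (components (- Y) - {D})" by (rule card_Un_le)
  also have "\<dots> \<le> 2 + (card (components (- Y)) - 1)" using N D(1) c2 by simp
  also have "\<dots> \<le> card (components (- X)) + 1" 
  proof -
    have "card (components (- Y)) > 0" using c2 D(1) by (auto simp: card_gt_0_iff)
    then show ?thesis using c2(2) by linarith
  qed
  finally show "card (components (- (X \<union> ?e))) \<le> card (components (- X)) + 1" by (simp add: Z_def)
qed

section \<open>The plane graph of a segment system\<close>

lemma line_segment_iff:
  fixes a d :: complex
  assumes "d \<noteq> 0"
  shows "a + t *\<^sub>R d \<in> closed_segment (a + p *\<^sub>R d) (a + q *\<^sub>R d) \<longleftrightarrow> p \<le> t \<and> t \<le> q \<or> q \<le> t \<and> t \<le> p"
    and "a + t *\<^sub>R d \<in> open_segment (a + p *\<^sub>R d) (a + q *\<^sub>R d) \<longleftrightarrow> p < t \<and> t < q \<or> q < t \<and> t < p"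
proof -
  have inj: "inj (\<lambda>t. a + t *\<^sub>R d)" using assms by (auto simp: inj_on_def)
  have img: "closed_segment (a + p *\<^sub>R d) (a + q *\<^sub>R d) = (\<lambda>t. a + t *\<^sub>R d) ` closed_segment p q"
  proof -
    have "linear (\<lambda>t. t *\<^sub>R d)" by (simp add: bounded_linear.linear bounded_linear_scaleR_left)
    from closed_segment_linear_image[OF this, of p q] show ?thesis
      by (simp add: closed_segment_translation[of a] image_image)
  qed
  show c: "a + t *\<^sub>R d \<in> closed_segment (a + p *\<^sub>R d) (a + q *\<^sub>R d) \<longleftrightarrow> p \<le> t \<and> t \<le> q \<or> q \<le> t \<and> t \<le> p"
    unfolding img inj_image_mem_iff[OF inj] closed_segment_eq_real_ivl by auto
  have "a + t *\<^sub>R d = a + s *\<^sub>R d \<longleftrightarrow> t = s" for s using assms by simp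
  then show "a + t *\<^sub>R d \<in> open_segment (a + p *\<^sub>R d) (a + q *\<^sub>R d) \<longleftrightarrow> p < t \<and> t < q \<or> q < t \<and> t < p"
    unfolding open_segment_def Diff_iff c insert_iff empty_iff by (smt (verit))
qed

text \<open>Naming the parametrisation lets points be folded into \<open>f t\<close>, after which
  incidences on the line are decided by real arithmetic.\<close>

definition line_coord :: "complex \<Rightarrow> complex \<Rightarrow> real \<Rightarrow> complex" where
  "line_coord u v t = u + t *\<^sub>R (v - u)"

lemma line_coord:
  assumes "u \<noteq> v"
  shows "line_coord u v s = line_coord u v t \<longleftrightarrow> s = t"
    "line_coord u v t \<in> closed_segment (line_coord u v p) (line_coord u v q) \<longleftrightarrow> p \<le> t \<and> t \<le> q \<or> q \<le> t \<and> t \<le> p"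
    "line_coord u v t \<in> open_segment (line_coord u v p) (line_coord u v q) \<longleftrightarrow> p < t \<and> t < q \<or> q < t \<and> t < p"
  using assms line_segment_iff[of "v - u" u] by (simp_all add: line_coord_def)

lemma line_coord_01: "line_coord u v 0 = u" "line_coord u v 1 = v"
  by (simp_all add: line_coord_def)

lemma ex_min_on_finite:
  fixes f :: "'a \<Rightarrow> real"
  assumes "finite S" "S \<noteq> {}"
  obtains x where "x \<in> S" "\<And>y. y \<in> S \<Longrightarrow> f x \<le> f y"
proof -
  have "Min (f ` S) \<in> f ` S" using assms by simp
  then obtain x where "x \<in> S" "f x = Min (f ` S)" by auto
  then show ?thesis using that[of x] assms by simp
qed

lemma closed_segment_param:
  fixes a b :: complex
  assumes "x \<in> closed_segment a b"
  obtains t where "x = a + t *\<^sub>R (b - a)"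
proof -
  obtain t where "x = (1 - t) *\<^sub>R a + t *\<^sub>R b" using assms by (auto simp: closed_segment_def)
  then show ?thesis using that[of t] by (simp add: algebra_simps)
qed

lemma line_through_points:
  fixes a d :: complex
  assumes "s \<noteq> t"
  shows "a + r *\<^sub>R d = (a + s *\<^sub>R d) + ((r - s) / (t - s)) *\<^sub>R ((a + t *\<^sub>R d) - (a + s *\<^sub>R d))"
proof -
  have "((r - s) / (t - s)) *\<^sub>R ((a + t *\<^sub>R d) - (a + s *\<^sub>R d)) = ((r - s) / (t - s)) *\<^sub>R ((t - s) *\<^sub>R d)"
    by (simp add: scaleR_diff_left)
  also have "\<dots> = (r - s) *\<^sub>R d" using assms by simp
  finally show ?thesis by (simp add: scaleR_diff_left)
qed

text \<open>A segment is given as a bare point set; its extreme points recover the two ends without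
  choosing an orientation.\<close>

definition seg_ends :: "complex set \<Rightarrow> complex set" where
  "seg_ends s = {x. x extreme_point_of s}"

lemma seg_ends_closed_segment [simp]: "seg_ends (closed_segment a b) = {a, b}"
  by (auto simp: seg_ends_def extreme_point_of_segment)

definition end_count :: "complex set set \<Rightarrow> complex \<Rightarrow> nat" where
  "end_count M v = card {s \<in> M. v \<in> seg_ends s}"

definition seg_count :: "complex set set \<Rightarrow> complex \<Rightarrow> nat" where
  "seg_count M v = card {s \<in> M. v \<in> s}"

text \<open>Finiteness of the vertex set comes from the tree in a segment Halin graph, and from an
  explicit list of vertices in the construction for tightness.\<close>

locale segments =
  fixes M :: "complex set set"
  assumes sys: "segment_system M" and finite_verts: "finite (seg_verts M)"
begin

abbreviation "V \<equiv> seg_verts M"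
abbreviation "E \<equiv> seg_edges M"

lemma finite_M: "finite M" using sys by (simp add: segment_system_def)

lemma segE:
  assumes "s \<in> M"
  obtains a b where "a \<noteq> b" "s = closed_segment a b" "a \<in> V" "b \<in> V"
proof -
  obtain a b where ab: "a \<noteq> b" "s = closed_segment a b" using sys assms by (auto simp: segment_system_def)
  then have "a \<in> V" "b \<in> V" using assms
    by (auto simp: seg_verts_def segment_endpoints_def) (metis closed_segment_commute)
  then show ?thesis using ab that by blast
qed

lemma convex_seg: "s \<in> M \<Longrightarrow> convex s" using segE by (metis convex_closed_segment)

lemma common_point_vert: "s \<in> M \<Longrightarrow> t \<in> M \<Longrightarrow> s \<noteq> t \<Longrightarrow> x \<in> s \<Longrightarrow> x \<in> t \<Longrightarrow> x \<in> V"
  by (auto simp: seg_verts_def intersection_points_def)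

lemma seg_param:
  assumes "s \<in> M" "u \<in> s" "v \<in> s" "u \<noteq> v" "x \<in> s"
  obtains t where "x = u + t *\<^sub>R (v - u)"
proof -
  obtain a b where s: "s = closed_segment a b" using segE[OF assms(1)] by blast
  obtain p q r where pqr: "u = a + p *\<^sub>R (b - a)" "v = a + q *\<^sub>R (b - a)" "x = a + r *\<^sub>R (b - a)"
    using assms(2,3,5) closed_segment_param unfolding s by metis
  with assms(4) have "p \<noteq> q" by auto
  then show ?thesis using line_through_points[of p q a r "b - a"] that pqr by metis
qed

text \<open>Two segments through the same two points are collinear and meet, which the merging
  condition forbids for distinct segments.\<close>

lemma seg_unique:
  assumes "s \<in> M" "t \<in> M" "u \<in> s" "v \<in> s" "u \<in> t" "v \<in> t" "u \<noteq> v"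
  shows "s = t"
proof (rule ccontr)
  assume "s \<noteq> t"
  have "\<exists>c. x = u + c *\<^sub>R (v - u)" if "x \<in> s \<union> t" for x
    using that seg_param[OF assms(1,3,4,7)] seg_param[OF assms(2,5,6,7)] by (metis UnE)
  then have "collinear (s \<union> t)" unfolding collinear_alt by blast
  with \<open>s \<noteq> t\<close> assms(1,2) sys have "s \<inter> t = {}" by (auto simp: segment_system_def)
  with assms show False by blast
qed

lemma edgeE:
  assumes "e \<in> E"
  obtains u v s where "e = {u, v}" "u \<noteq> v" "u \<in> V" "v \<in> V" "s \<in> M" "u \<in> s" "v \<in> s" "V \<inter> open_segment u v = {}"
  using assms by (auto simp: seg_edges_def)

lemma edgeI: "u \<in> V \<Longrightarrow> v \<in> V \<Longrightarrow> u \<noteq> v \<Longrightarrow> s \<in> M \<Longrightarrow> u \<in> s \<Longrightarrow> v \<in> s \<Longrightarrow> V \<inter> open_segment u v = {} \<Longrightarrow> {u, v} \<in> E"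
  by (auto simp: seg_edges_def)

lemma edgeD:
  assumes "{u, v} \<in> E" 
  shows "u \<noteq> v" "u \<in> V" "v \<in> V" "V \<inter> open_segment u v = {}" "\<exists>s\<in>M. u \<in> s \<and> v \<in> s"
proof -
  obtain x y s where xy: "{u, v} = {x, y}" "x \<noteq> y" "x \<in> V" "y \<in> V" "s \<in> M" "x \<in> s" "y \<in> s" "V \<inter> open_segment x y = {}"
    using edgeE[OF assms] .
  then have "u = x \<and> v = y \<or> u = y \<and> v = x" by (auto simp: doubleton_eq_iff)
  then show "u \<noteq> v" "u \<in> V" "v \<in> V" "V \<inter> open_segment u v = {}" "\<exists>s\<in>M. u \<in> s \<and> v \<in> s"
    using xy by (auto simp: open_segment_commute)
qed

lemma finite_E: "finite E"
proof -
  have "E \<subseteq> Pow V" by (auto simp: seg_edges_def)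
  then show ?thesis using finite_verts by (meson finite_Pow_iff finite_subset)
qed

lemma card_edge: "e \<in> E \<Longrightarrow> card e = 2" by (auto simp: seg_edges_def)

lemma edge_subset_Union: "e \<in> E \<Longrightarrow> convex hull e \<subseteq> \<Union>M"
proof -
  assume "e \<in> E"
  then obtain u v s where "e = {u, v}" "s \<in> M" "u \<in> s" "v \<in> s" by (rule edgeE)
  then have "convex hull e \<subseteq> s" using convex_seg by (simp add: hull_minimal)
  then show ?thesis using \<open>s \<in> M\<close> by blast
qed

lemma nearest_vert:
  assumes "u \<in> V" "w \<in> V" "u \<noteq> w" "s \<in> M" "u \<in> s" "w \<in> s"
  obtains v where "{u, v} \<in> E" "v \<in> closed_segment u w" "v \<in> s"
proof -
  let ?S = "V \<inter> closed_segment u w - {u}"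
  have "finite ?S" "?S \<noteq> {}" using finite_verts assms by auto
  then obtain v where v: "v \<in> ?S" "\<And>x. x \<in> ?S \<Longrightarrow> dist u v \<le> dist u x"
    using ex_min_on_finite[of ?S "dist u"] by metis
  have ss: "closed_segment u w \<subseteq> s" using convex_seg[OF assms(4)] assms(5,6) by (simp add: closed_segment_subset)
  have "V \<inter> open_segment u v = {}"
  proof (rule ccontr)
    assume "V \<inter> open_segment u v \<noteq> {}"
    then obtain y where y: "y \<in> V" "y \<in> open_segment u v" by blast
    then have "dist u y < dist u v" using dist_in_open_segment by (metis dist_commute)
    moreover have "y \<in> closed_segment u w"
      using y(2) v(1) by (metis DiffD1 Int_iff ends_in_segment(1) open_segment_def subset_closed_segment subsetD)
    moreover have "y \<noteq> u" using y(2) by (auto simp: open_segment_def)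
    ultimately show False using v(2)[of y] y(1) by simp
  qed
  then have "{u, v} \<in> E" using edgeI[of u v s] assms v ss by blast
  then show ?thesis using v that ss by blast
qed

text \<open>A point that is not a vertex lies on the edge between the nearest vertices
  \<open>p\<close> and \<open>q\<close> on its two sides; a vertex between these would be
  nearer.\<close>

lemma segment_covered:
  assumes "u \<in> V" "w \<in> V" "u \<noteq> w" "s \<in> M" "u \<in> s" "w \<in> s" "x \<in> closed_segment u w"
  obtains e where "e \<in> E" "x \<in> convex hull e" "e \<subseteq> closed_segment u w"
proof (cases "x \<in> V")
  case True
  have ss: "closed_segment u w \<subseteq> s" using convex_seg[OF assms(4)] assms(5,6) by (simp add: closed_segment_subset)
  obtain y where y: "y \<in> {u, w}" "y \<noteq> x" using assms(3) by auto
  then obtain v where "{x, v} \<in> E" "v \<in> closed_segment x y"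
    using nearest_vert[OF True, of y s] assms ss by blast
  moreover have "closed_segment x y \<subseteq> closed_segment u w" using y(1) assms(7) by (auto simp: subset_closed_segment)
  ultimately show ?thesis using that[of "{x, v}"] assms(7) by (auto intro: hull_inc)
next
  case False
  have ss: "closed_segment u w \<subseteq> s" using convex_seg[OF assms(4)] assms(5,6) by (simp add: closed_segment_subset)
  have near: "\<exists>p \<in> V \<inter> closed_segment x z. \<forall>y \<in> V \<inter> closed_segment x z. dist x p \<le> dist x y" if "z \<in> V" for z
  proof -
    have "finite (V \<inter> closed_segment x z)" "V \<inter> closed_segment x z \<noteq> {}" using finite_verts that by auto
    then show ?thesis using ex_min_on_finite[of "V \<inter> closed_segment x z" "dist x"] by metis
  qed
  obtain p where p: "p \<in> V" "p \<in> closed_segment x u" "\<And>y. y \<in> V \<Longrightarrow> y \<in> closed_segment x u \<Longrightarrow> dist x p \<le> dist x y"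
    using near[OF assms(1)] by blast
  obtain q where q: "q \<in> V" "q \<in> closed_segment x w" "\<And>y. y \<in> V \<Longrightarrow> y \<in> closed_segment x w \<Longrightarrow> dist x q \<le> dist x y"
    using near[OF assms(2)] by blast
  obtain t where t: "x = u + t *\<^sub>R (w - u)" using closed_segment_param[OF assms(7)] .
  let ?d = "w - u"
  have d: "?d \<noteq> 0" using assms(3) by simp
  have sub: "closed_segment x u \<subseteq> closed_segment u w" "closed_segment x w \<subseteq> closed_segment u w"
    using assms(7) by (auto simp: subset_closed_segment)
  obtain tp where tp: "p = u + tp *\<^sub>R ?d" using p(2) sub closed_segment_param by blast
  obtain tq where tq: "q = u + tq *\<^sub>R ?d" using q(2) sub closed_segment_param by blast
  note iff = line_segment_iff[OF d, of u]
  have uw: "u = u + 0 *\<^sub>R ?d" "w = u + 1 *\<^sub>R ?d" by auto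
  have t01: "0 \<le> t" "t \<le> 1" using assms(7) iff(1)[of t 0 1] t by auto
  have "p \<noteq> x" "q \<noteq> x" using False p q by auto
  then have tpt: "0 \<le> tp" "tp < t" and tqt: "t < tq" "tq \<le> 1"
    using p(2) q(2) iff(1)[of tp t 0] iff(1)[of tq t 1] t01 tp tq t by (auto simp: less_le)
  have dst: "dist (u + r *\<^sub>R ?d) (u + r' *\<^sub>R ?d) = \<bar>r - r'\<bar> * norm ?d" for r r'
    by (simp add: dist_norm scaleR_diff_left[symmetric] del: scaleR_right_diff_distrib)
  have "V \<inter> open_segment p q = {}"
  proof (rule ccontr)
    assume "V \<inter> open_segment p q \<noteq> {}"
    then obtain y where y: "y \<in> V" "y \<in> open_segment p q" by blast
    have "closed_segment p q \<subseteq> closed_segment u w" using p(2) q(2) sub by (meson closed_segment_subset convex_closed_segment subsetD)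
    then obtain r where r: "y = u + r *\<^sub>R ?d" 
      using y(2) open_closed_segment closed_segment_param by (metis subsetD)
    have r2: "tp < r" "r < tq" using y(2) iff(2)[of r tp tq] tpt tqt r tp tq by auto
    show False
    proof (cases "r \<le> t")
      case True
      then have "y \<in> closed_segment x u" using iff(1)[of r t 0] r t r2 tpt by auto
      then have "dist x p \<le> dist x y" using p(3) y by blast
      then show False using r2 True tpt d by (simp add: r t tp dst del: scaleR_right_diff_distrib)
    next
      case False
      then have "y \<in> closed_segment x w" using iff(1)[of r t 1] r t r2 tqt by auto
      then have "dist x q \<le> dist x y" using q(3) y by blast
      then show False using r2 False tqt d by (simp add: r t tq dst del: scaleR_right_diff_distrib)
    qed
  qed
  moreover have "p \<noteq> q" using tpt tqt tp tq d by auto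
  ultimately have "{p, q} \<in> E" using edgeI[of p q s] p q sub ss assms(4) by blast
  moreover have "x \<in> closed_segment p q" using iff(1)[of t tp tq] t tp tq tpt tqt by auto
  ultimately show ?thesis using that[of "{p, q}"] p q sub by (auto simp: segment_convex_hull)
qed

lemma Union_edges: "(\<Union>e\<in>E. convex hull e) = \<Union>M"
proof
  show "(\<Union>e\<in>E. convex hull e) \<subseteq> \<Union>M" using edge_subset_Union by blast
  show "\<Union>M \<subseteq> (\<Union>e\<in>E. convex hull e)"
  proof
    fix x assume "x \<in> \<Union>M"
    then obtain s where s: "s \<in> M" "x \<in> s" by blast
    obtain a b where "a \<noteq> b" "s = closed_segment a b" "a \<in> V" "b \<in> V" using segE[OF s(1)] .
    then obtain e where "e \<in> E" "x \<in> convex hull e" using segment_covered[of a b s x] s by blast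
    then show "x \<in> (\<Union>e\<in>E. convex hull e)" by blast
  qed
qed

text \<open>Planarity of the drawing. A common point that is not a vertex puts both edges on one
  segment; there, edges with no vertex between their ends can share such a point only if they
  coincide.\<close>

lemma edges_meet_in_verts:
  assumes "e \<in> E" "e' \<in> E" "e \<noteq> e'" "z \<in> convex hull e" "z \<in> convex hull e'"
  shows "z \<in> e \<inter> e'"
proof -
  have vert: "z \<in> f" if zV: "z \<in> V" and fE: "f \<in> E" and zf: "z \<in> convex hull f" for f
  proof -
    obtain u v where f: "f = {u, v}" "V \<inter> open_segment u v = {}" using edgeE[OF fE] by metis
    then have "z \<in> closed_segment u v" using zf by (simp add: segment_convex_hull)
    then show ?thesis using f zV by (auto simp: open_segment_def)
  qed
  have "z \<in> V"
  proof (rule ccontr)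
    assume z: "z \<notin> V"
    obtain u v s where e: "e = {u, v}" "u \<noteq> v" "u \<in> V" "v \<in> V" "s \<in> M" "u \<in> s" "v \<in> s" "V \<inter> open_segment u v = {}"
      using edgeE[OF assms(1)] .
    obtain x y s' where e': "e' = {x, y}" "x \<noteq> y" "x \<in> V" "y \<in> V" "s' \<in> M" "x \<in> s'" "y \<in> s'" "V \<inter> open_segment x y = {}"
      using edgeE[OF assms(2)] .
    have zuv: "z \<in> closed_segment u v" and zxy: "z \<in> closed_segment x y"
      using assms(4,5) e(1) e'(1) by (simp_all add: segment_convex_hull)
    have "z \<in> s" "z \<in> s'" using zuv zxy e e' convex_seg by (meson closed_segment_subset subsetD)+
    then have "s = s'" using common_point_vert z e(5) e'(5) by blast
    define f where "f = line_coord u v"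
    have f': "\<And>t. f t = u + t *\<^sub>R (v - u)" by (simp add: f_def line_coord_def)
    note f = line_coord_01[of u v, folded f_def] line_coord[OF e(2), folded f_def]
    obtain a b c where abc: "x = f a" "y = f b" "z = f c"
      using seg_param[OF e(5,6,7,2)] e' \<open>s = s'\<close> \<open>z \<in> s\<close> f' by metis
    have "f a \<notin> open_segment (f 0) (f 1)" "f b \<notin> open_segment (f 0) (f 1)"
       "f 0 \<notin> open_segment (f a) (f b)" "f 1 \<notin> open_segment (f a) (f b)" 
      using e(3,4,8) e'(3,4,8) unfolding f(1,2) abc by blast+
    moreover have "f c \<in> closed_segment (f 0) (f 1)" "f c \<in> closed_segment (f a) (f b)"
      using zuv zxy unfolding f(1,2) abc by blast+
    moreover have "f c \<noteq> f 0" "f c \<noteq> f 1" "f c \<noteq> f a" "f c \<noteq> f b"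
      using z e(3,4) e'(3,4) unfolding f(1,2) abc by metis+
    ultimately have "a = 0 \<and> b = 1 \<or> a = 1 \<and> b = 0" unfolding f(3-5) by argo
    then have "{x, y} = {u, v}" using abc f(1,2) by auto
    then show False using assms(3) e(1) e'(1) by simp
  qed
  then show ?thesis using vert assms by blast
qed

lemma seg_ends_card: assumes "s \<in> M" shows "card (seg_ends s) = 2" "finite (seg_ends s)" "seg_ends s \<subseteq> V" "seg_ends s \<subseteq> s"
proof -
  obtain a b where "a \<noteq> b" "s = closed_segment a b" "a \<in> V" "b \<in> V" using segE[OF assms] .
  then show "card (seg_ends s) = 2" "finite (seg_ends s)" "seg_ends s \<subseteq> V" "seg_ends s \<subseteq> s" by auto
qed

text \<open>An edge at \<open>v\<close> amounts to leaving \<open>v\<close> along a segment towards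
  one of its ends, with the nearest vertex \<open>nb s b\<close> as the other end of the
  edge.\<close>

lemma vdegree_eq_card_directions:
  assumes "v \<in> V"
  shows "vdegree E v = card {(s, b). s \<in> M \<and> v \<in> s \<and> b \<in> seg_ends s \<and> b \<noteq> v}" (is "_ = card ?D")
proof -
  define P where "P s b n \<longleftrightarrow> {v, n} \<in> E \<and> n \<in> closed_segment v b \<and> n \<in> s" for s b n
  have ex: "\<exists>n. P s b n" if D: "(s, b) \<in> ?D" for s b
  proof -
    have "b \<in> V" "b \<in> s" "v \<noteq> b" "s \<in> M" "v \<in> s" using D seg_ends_card[of s] by auto
    then show ?thesis using nearest_vert[OF assms, of b s] unfolding P_def by metis
  qed
  define nb where "nb s b = (SOME n. P s b n)" for s b
  have nb: "{v, nb s b} \<in> E \<and> nb s b \<in> closed_segment v b \<and> nb s b \<in> s" if "(s, b) \<in> ?D" for s b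
    using someI_ex[OF ex[OF that]] unfolding nb_def P_def .
  have "bij_betw (\<lambda>(s, b). {v, nb s b}) ?D {e \<in> E. v \<in> e}"
  proof (rule bij_betwI')
    fix p p' assume p: "p \<in> ?D" "p' \<in> ?D"
    obtain s b s' b' where sb: "p = (s, b)" "p' = (s', b')" by fastforce
    have n: "nb s b \<noteq> v" "nb s' b' \<noteq> v" using nb[of s b] nb[of s' b'] edgeD(1)[of v "nb s b"] edgeD(1)[of v "nb s' b'"] p sb by auto
    have "s = s' \<and> b = b'" if "{v, nb s b} = {v, nb s' b'}"
    proof -
      have eq: "nb s b = nb s' b'" using that by (auto simp: doubleton_eq_iff)
      have s: "s \<in> M" "s' \<in> M" "v \<in> s" "v \<in> s'" using p sb by auto
      then have ss: "s = s'" using seg_unique[of s s' v "nb s b"] nb[of s b] nb[of s' b'] p sb n eq by auto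
      obtain a c where ac: "a \<noteq> c" "s = closed_segment a c" using segE[OF s(1)] .
      have "b = b'"
      proof (rule ccontr)
        \<comment> \<open>Here \<open>v\<close> lies between the two ends, so a point on both sides
          of \<open>v\<close> must be \<open>v\<close> itself.\<close>
        assume ne: "b \<noteq> b'"
        have "b \<in> {a, c}" "b' \<in> {a, c}" using p sb ss ac by auto
        with ne ac have "v \<in> closed_segment b b'" using s by (auto simp: closed_segment_commute)
        then obtain t where t: "v = b + t *\<^sub>R (b' - b)" using closed_segment_param by blast
        note iff = line_segment_iff[of "b' - b" b]
        obtain r where r: "nb s b = b + r *\<^sub>R (b' - b)"
          using seg_param[OF s(1), of b b' "nb s b"] ne nb[of s b] p sb ss seg_ends_card(4)[OF s(1)] by auto
        have "b + r *\<^sub>R (b' - b) \<in> closed_segment (b + t *\<^sub>R (b' - b)) (b + 0 *\<^sub>R (b' - b))"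
          "b + r *\<^sub>R (b' - b) \<in> closed_segment (b + t *\<^sub>R (b' - b)) (b + 1 *\<^sub>R (b' - b))"
          using nb[of s b] nb[of s' b'] p sb ss eq by (auto simp flip: t r)
        moreover have "0 \<le> t" "t \<le> 1" using \<open>v \<in> closed_segment b b'\<close> iff(1)[of t 0 1] ne t by auto
        ultimately have "r = t" using iff(1)[of r t 0] iff(1)[of r t 1] ne by auto
        then show False using r t n by simp
      qed
      with ss show ?thesis by blast
    qed
    then show "((case p of (s, b) \<Rightarrow> {v, nb s b}) = (case p' of (s, b) \<Rightarrow> {v, nb s b})) = (p = p')"
      using sb by auto
  next
    fix p assume p: "p \<in> ?D"
    then show "(case p of (s, b) \<Rightarrow> {v, nb s b}) \<in> {e \<in> E. v \<in> e}" using nb[of "fst p" "snd p"] by (simp add: case_prod_beta)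
  next
    fix e assume "e \<in> {e \<in> E. v \<in> e}"
    then have e: "e \<in> E" "v \<in> e" by auto
    obtain x y s where xy: "e = {x, y}" "x \<noteq> y" "s \<in> M" "x \<in> s" "y \<in> s" using edgeE[OF e(1)] by metis
    then obtain u where u: "e = {v, u}" "u \<noteq> v" "u \<in> s" "v \<in> s" using e(2) by (metis insert_commute insertE singletonD)
    obtain a c where ac: "a \<noteq> c" "s = closed_segment a c" "a \<in> V" "c \<in> V" using segE[OF xy(3)] .
    have "closed_segment a c = closed_segment a v \<union> closed_segment v c"
      using u ac by (simp add: Un_closed_segment)
    then obtain b where b: "b \<in> {a, c}" "u \<in> closed_segment v b" using u ac closed_segment_commute by blast
    then have "b \<noteq> v" using u by auto
    then have D: "(s, b) \<in> ?D" using b ac xy u by auto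
    have "nb s b = u"
    proof -
      have d: "b - v \<noteq> 0" using \<open>b \<noteq> v\<close> by simp
      note iff = line_segment_iff[OF d, of v]
      obtain r where r: "u = v + r *\<^sub>R (b - v)" using b closed_segment_param by blast
      obtain t where t: "nb s b = v + t *\<^sub>R (b - v)" using nb[OF D] closed_segment_param by blast
      have "0 \<le> r" "r \<le> 1" "0 \<le> t" "t \<le> 1" using iff(1)[of r 0 1] iff(1)[of t 0 1] b nb[OF D] r t by auto
      moreover have "r \<noteq> 0" "t \<noteq> 0" using u(2) nb[OF D] edgeD(1)[of v "nb s b"] r t by auto
      moreover have "\<not> (0 < r \<and> r < t)"
        using edgeD(4)[of v "nb s b"] nb[OF D] edgeD(3)[of v u] e(1) u(1) iff(2)[of r 0 t] r t by auto
      moreover have "\<not> (0 < t \<and> t < r)"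
        using edgeD(4)[of v u] nb[OF D] edgeD(3)[of v "nb s b"] e(1) u(1) iff(2)[of t 0 r] r t by auto
      ultimately show ?thesis using r t by (metis less_le linorder_neqE_linordered_idom)
    qed
    then show "\<exists>p\<in>?D. e = (case p of (s, b) \<Rightarrow> {v, nb s b})" using D u by (intro bexI[of _ "(s, b)"]) auto
  qed
  then show ?thesis unfolding vdegree_def by (simp add: bij_betw_same_card)
qed

text \<open>Each segment through \<open>v\<close> has two ends, and an end at \<open>v\<close>
  itself offers no direction. So the degree has the parity of the number of segment ends, which is
  how odd vertices force ends.\<close>

lemma vdegree_plus_end_count:
  assumes "v \<in> V"
  shows "vdegree E v + end_count M v = 2 * seg_count M v"
proof -
  let ?S = "{s \<in> M. v \<in> s}"
  let ?D = "{(s, b). s \<in> M \<and> v \<in> s \<and> b \<in> seg_ends s \<and> b \<noteq> v}"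
  let ?D' = "(\<lambda>s. (s, v)) ` {s \<in> M. v \<in> seg_ends s}"
  have fin: "finite ?S" using finite_M by simp
  have un: "Sigma ?S seg_ends = ?D \<union> ?D'" using seg_ends_card(4) by fast
  have finS: "finite (Sigma ?S seg_ends)" using fin seg_ends_card by auto
  have "card (Sigma ?S seg_ends) = (\<Sum>s\<in>?S. 2)" using seg_ends_card fin by (subst card_SigmaI) auto
  then have "2 * seg_count M v = card (?D \<union> ?D')" using un by (simp add: seg_count_def)
  also have "\<dots> = card ?D + card ?D'" using finS un by (intro card_Un_disjoint) (auto simp: un)
  also have "card ?D' = end_count M v" unfolding end_count_def by (intro card_image) (auto simp: inj_on_def)
  finally show ?thesis using vdegree_eq_card_directions[OF assms] by simp
qed

lemma sum_end_count: "(\<Sum>v\<in>V. end_count M v) = 2 * card M"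
proof -
  have "(\<Sum>v\<in>V. end_count M v) = (\<Sum>v\<in>V. \<Sum>s\<in>M. if v \<in> seg_ends s then 1 else 0)"
    unfolding end_count_def using finite_M by (simp add: sum.If_cases Int_def)
  also have "\<dots> = (\<Sum>s\<in>M. \<Sum>v\<in>V. if v \<in> seg_ends s then 1 else 0)" by (rule sum.swap)
  also have "\<dots> = (\<Sum>s\<in>M. 2)"
  proof (rule sum.cong)
    fix s assume "s \<in> M"
    then have "V \<inter> {v. v \<in> seg_ends s} = seg_ends s" using seg_ends_card by auto
    then show "(\<Sum>v\<in>V. if v \<in> seg_ends s then 1 else 0) = (2::nat)"
      using finite_verts seg_ends_card[OF \<open>s \<in> M\<close>] by (simp add: sum.If_cases)
  qed simp
  finally show ?thesis by simp
qed

end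

section \<open>Trees and Halin graphs\<close>

fun path_edges :: "'a list \<Rightarrow> 'a set set" where
  "path_edges (a # b # xs) = insert {a, b} (path_edges (b # xs))"
| "path_edges _ = {}"

lemma path_edges_Cons: "path_edges (a # xs) = (if xs = [] then {} else insert {a, hd xs} (path_edges xs))"
  by (cases xs) auto

lemma path_edges_append:
  "path_edges (xs @ ys) = path_edges xs \<union> path_edges ys \<union> (if xs \<noteq> [] \<and> ys \<noteq> [] then {{last xs, hd ys}} else {})"
  by (induction xs) (auto simp: path_edges_Cons)

lemma path_edges_rev: "path_edges (rev xs) = path_edges xs"
  by (induction xs) (auto simp: path_edges_Cons path_edges_append hd_rev last_rev insert_commute)

lemma path_edges_nth: "path_edges xs = {{xs ! i, xs ! Suc i} | i. Suc i < length xs}"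
proof (induction xs rule: path_edges.induct)
  case (1 a b xs)
  have "{{(a # b # xs) ! i, (a # b # xs) ! Suc i} | i. Suc i < length (a # b # xs)}
      = insert {a, b} {{(b # xs) ! i, (b # xs) ! Suc i} | i. Suc i < length (b # xs)}" (is "?L = ?R")
  proof
    show "?L \<subseteq> ?R"
    proof
      fix e assume "e \<in> ?L"
      then obtain i where i: "e = {(a # b # xs) ! i, (a # b # xs) ! Suc i}" "Suc i < length (a # b # xs)" by blast
      show "e \<in> ?R" using i by (cases i) auto
    qed
    show "?R \<subseteq> ?L"
    proof
      fix e assume "e \<in> ?R"
      then consider "e = {a, b}" | i where "e = {(b # xs) ! i, (b # xs) ! Suc i}" "Suc i < length (b # xs)" by blast
      then show "e \<in> ?L"
      proof cases
        case 1 then show ?thesis by (auto intro!: exI[of _ 0])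
      next
        case 2 then show ?thesis by (auto intro!: exI[of _ "Suc i"])
      qed
    qed
  qed
  then show ?case using 1 by simp
qed auto

lemma path_edges_subset: "e \<in> path_edges xs \<Longrightarrow> e \<subseteq> set xs"
  by (induction xs rule: path_edges.induct) auto

lemma cycle_edges_eq: 
  assumes "xs \<noteq> []" shows "cycle_edges xs = insert {last xs, hd xs} (path_edges xs)"
proof -
  let ?n = "length xs"
  have n: "?n > 0" using assms by simp
  have "e \<in> cycle_edges xs \<longleftrightarrow> e = {last xs, hd xs} \<or> (\<exists>i. Suc i < ?n \<and> e = {xs ! i, xs ! Suc i})" for e
  proof -
    have "e \<in> cycle_edges xs \<longleftrightarrow> (\<exists>i<?n. e = {xs ! i, xs ! (Suc i mod ?n)})" by (auto simp: cycle_edges_def)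
    also have "\<dots> \<longleftrightarrow> e = {xs ! (?n - 1), xs ! (Suc (?n - 1) mod ?n)} \<or> (\<exists>i<?n - 1. e = {xs ! i, xs ! (Suc i mod ?n)})"
      using n by (metis (no_types, lifting) Suc_pred' less_Suc_eq)
    also have "{xs ! (?n - 1), xs ! (Suc (?n - 1) mod ?n)} = {last xs, hd xs}"
      using assms n by (simp add: last_conv_nth hd_conv_nth)
    also have "(\<exists>i<?n - 1. e = {xs ! i, xs ! (Suc i mod ?n)}) \<longleftrightarrow> (\<exists>i. Suc i < ?n \<and> e = {xs ! i, xs ! Suc i})"
      by (auto simp: less_diff_conv)
    finally show ?thesis .
  qed
  then show ?thesis unfolding path_edges_nth by blast
qed

lemma cycle_edges_swap: "cycle_edges (ys @ xs) = cycle_edges (xs @ ys)"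
  by (cases "xs = []"; cases "ys = []") (auto simp: cycle_edges_eq path_edges_append)

text \<open>After rotating \<open>v\<close> to the front, its neighbours are the first and the last
  entry of the rest, distinct because at least two entries remain.\<close>

lemma cycle_edges_nbrs:
  assumes "distinct xs" "3 \<le> length xs" "v \<in> set xs"
  obtains u w where "u \<in> set xs" "w \<in> set xs" "u \<noteq> v" "w \<noteq> v" "u \<noteq> w" "{e \<in> cycle_edges xs. v \<in> e} = {{v, u}, {v, w}}"
proof -
  obtain ys zs where xs: "xs = ys @ v # zs" using assms(3) by (meson split_list)
  let ?r = "zs @ ys"
  have r: "2 \<le> length ?r" "distinct ?r" "v \<notin> set ?r" using assms xs by auto
  then have ne: "?r \<noteq> []" by auto
  have c: "cycle_edges xs = insert {last ?r, v} (insert {v, hd ?r} (path_edges ?r))"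
  proof -
    have "cycle_edges (v # r) = insert {last r, v} (insert {v, hd r} (path_edges r))" if "r \<noteq> []" for r
      using that by (simp add: cycle_edges_eq path_edges_Cons)
    from this[OF ne] show ?thesis using cycle_edges_swap[of ys "v # zs"] unfolding xs by simp
  qed
  have hl: "hd ?r \<noteq> last ?r" 
  proof -
    have "?r ! 0 \<noteq> ?r ! (length ?r - 1)" using r by (subst nth_eq_iff_index_eq) auto
    then show ?thesis using ne by (simp add: hd_conv_nth last_conv_nth)
  qed
  have mem: "hd ?r \<in> set ?r" "last ?r \<in> set ?r" using ne hd_in_set last_in_set by blast+
  have "v \<notin> e" if "e \<in> path_edges ?r" for e using path_edges_subset[OF that] r(3) by blast
  then have "{e \<in> cycle_edges xs. v \<in> e} = {{v, hd ?r}, {v, last ?r}}" unfolding c by (auto simp: insert_commute)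
  moreover have "set ?r \<subseteq> set xs" using xs by auto
  ultimately show ?thesis using that[of "hd ?r" "last ?r"] hl mem r(3) by blast
qed

lemma cycle_edges_subset: "e \<in> cycle_edges xs \<Longrightarrow> e \<subseteq> set xs"
  unfolding cycle_edges_def by (auto intro!: nth_mem) (metis mod_less_divisor nth_mem length_pos_if_in_set less_nat_zero_code not_gr_zero)

lemma card_cycle_edges_le: "card (cycle_edges xs) \<le> length xs" "finite (cycle_edges xs)"
proof -
  have "cycle_edges xs = (\<lambda>i. {xs ! i, xs ! (Suc i mod length xs)}) ` {..<length xs}"
    by (auto simp: cycle_edges_def)
  then show "card (cycle_edges xs) \<le> length xs" "finite (cycle_edges xs)"
    using card_image_le[of "{..<length xs}"] by auto
qed

section \<open>Trees grown leaf by leaf\<close>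

inductive grown :: "'a set \<Rightarrow> 'a set set \<Rightarrow> bool" where
  base: "grown {r} {}"
| step: "grown S F \<Longrightarrow> u \<in> S \<Longrightarrow> v \<notin> S \<Longrightarrow> grown (insert v S) (insert {u, v} F)"

lemma grown_basic: "grown S F \<Longrightarrow> finite S \<and> finite F \<and> (\<forall>e\<in>F. e \<subseteq> S) \<and> card S = card F + 1 \<and> S \<noteq> {}"
proof (induction rule: grown.induct)
  case (step S F u v)
  then have "{u, v} \<notin> F" by (meson insertCI subsetD)
  then show ?case using step by auto
qed auto

lemma grown_path:
  "grown S F \<Longrightarrow> x \<in> S \<Longrightarrow> y \<in> S \<Longrightarrow> \<exists>xs. xs \<noteq> [] \<and> distinct xs \<and> hd xs = x \<and> last xs = y \<and> set xs \<subseteq> S \<and> path_edges xs \<subseteq> F"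
proof (induction arbitrary: x y rule: grown.induct)
  case (base r)
  then show ?case by (intro exI[of _ "[r]"]) auto
next
  case (step S F u v)
  have new: "\<exists>xs. xs \<noteq> [] \<and> distinct xs \<and> hd xs = z \<and> last xs = v \<and> set xs \<subseteq> insert v S \<and> path_edges xs \<subseteq> insert {u, v} F"
    if z: "z \<in> insert v S" for z
  proof (cases "z = v")
    case True then show ?thesis by (intro exI[of _ "[v]"]) auto
  next
    case False
    then obtain xs where xs: "xs \<noteq> []" "distinct xs" "hd xs = z" "last xs = u" "set xs \<subseteq> S" "path_edges xs \<subseteq> F"
      using step.IH[of z u] z step.hyps by blast
    then show ?thesis using step.hyps by (intro exI[of _ "xs @ [v]"]) (auto simp: path_edges_append)
  qed
  consider "y = v" | "x = v" | "x \<in> S" "y \<in> S" using step.prems by blast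
  then show ?case
  proof cases
    case 1 then show ?thesis using new step.prems by blast
  next
    case 2
    obtain xs where "xs \<noteq> []" "distinct xs" "hd xs = y" "last xs = v" "set xs \<subseteq> insert v S" "path_edges xs \<subseteq> insert {u, v} F"
      using new[OF step.prems(2)] by blast
    then show ?thesis using 2 by (intro exI[of _ "rev xs"]) (auto simp: path_edges_rev hd_rev last_rev)
  next
    case 3
    then show ?thesis using step.IH[of x y] by blast
  qed
qed

lemma rtrancl_leaves_set:
  assumes "(a, b) \<in> R\<^sup>*" "a \<in> S" "b \<notin> S"
  shows "\<exists>x y. (x, y) \<in> R \<and> x \<in> S \<and> y \<notin> S"
  using assms by (induction rule: rtrancl_induct) auto

text \<open>This opens trees to induction, for the edge count as for the topology of the drawing.
  Connectedness extends a partial tree until it spans \<open>V\<close>; an edge of \<open>T\<close>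
  left over would close a cycle with the path between its ends.\<close>

lemma tree_grown:
  assumes "is_tree V T" shows "grown V T"
proof -
  have sg: "simple_graph V T" and ne: "V \<noteq> {}" and conn: "\<And>u v. u \<in> V \<Longrightarrow> v \<in> V \<Longrightarrow> (u, v) \<in> (darts T)\<^sup>*"
    and acyc: "\<And>xs. 3 \<le> length xs \<Longrightarrow> distinct xs \<Longrightarrow> \<not> cycle_edges xs \<subseteq> T"
    using assms by (auto simp: is_tree_def)
  have fin: "finite V" and edge: "\<And>e. e \<in> T \<Longrightarrow> e \<subseteq> V \<and> card e = 2" using sg by (auto simp: simple_graph_def)
  have "\<exists>F. grown V F \<and> F \<subseteq> T" if "grown S F" "S \<subseteq> V" "F \<subseteq> T" for S F
    using that
  proof (induction "card (V - S)" arbitrary: S F rule: less_induct)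
    case less
    show ?case
    proof (cases "S = V")
      case True then show ?thesis using less by blast
    next
      case False
      obtain r where "r \<in> S" using grown_basic[OF less.prems(1)] by blast
      obtain w where w: "w \<in> V" "w \<notin> S" using False less.prems(2) by blast
      obtain a b where ab: "(a, b) \<in> darts T" "a \<in> S" "b \<notin> S"
        using rtrancl_leaves_set[OF conn[of r w]] \<open>r \<in> S\<close> w less.prems(2) by blast
      then have T: "{a, b} \<in> T" by (auto simp: darts_def)
      have "b \<in> V" using edge[OF T] by blast
      then have "card (V - insert b S) < card (V - S)"
        using fin ab by (intro psubset_card_mono) auto
      moreover have "grown (insert b S) (insert {a, b} F)" using grown.step[OF less.prems(1) ab(2,3)] .
      ultimately show ?thesis using less.hyps[of "insert b S" "insert {a, b} F"] less.prems T \<open>b \<in> V\<close> by blast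
    qed
  qed
  moreover obtain r where "r \<in> V" using ne by blast
  ultimately obtain F where F: "grown V F" "F \<subseteq> T" using grown.base[of r] by blast
  have "T \<subseteq> F"
  proof
    fix e assume e: "e \<in> T"
    show "e \<in> F"
    proof (rule ccontr)
      assume nF: "e \<notin> F"
      obtain u v where uv: "e = {u, v}" "u \<noteq> v" using edge[OF e] by (auto simp: card_2_iff)
      obtain xs where xs: "xs \<noteq> []" "distinct xs" "hd xs = u" "last xs = v" "path_edges xs \<subseteq> F"
        using grown_path[OF F(1), of u v] edge[OF e] uv by blast
      have c: "cycle_edges xs \<subseteq> T" using xs e F(2) uv by (simp add: cycle_edges_eq insert_commute)
      have "3 \<le> length xs"
      proof (rule ccontr)
        assume "\<not> 3 \<le> length xs"
        moreover have "length xs \<noteq> 0" using xs(1) by simp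
        ultimately have "length xs = Suc 0 \<or> length xs = Suc (Suc 0)" by linarith
        then show False using xs uv nF by (auto simp: length_Suc_conv)
      qed
      then show False using acyc[OF _ xs(2)] c by blast
    qed
  qed
  then have "F = T" using F by blast
  then show ?thesis using F by simp
qed

lemma sum_vdegree:
  assumes "simple_graph V T" shows "(\<Sum>v\<in>V. vdegree T v) = 2 * card T"
proof -
  have fV: "finite V" and fT: "finite T" and e: "\<And>e. e \<in> T \<Longrightarrow> e \<subseteq> V \<and> card e = 2"
    using assms finite_subset[of T "Pow V"] by (auto simp: simple_graph_def)
  have "(\<Sum>v\<in>V. vdegree T v) = (\<Sum>v\<in>V. \<Sum>e\<in>T. if v \<in> e then 1 else 0)"
    unfolding vdegree_def using fT by (simp add: sum.If_cases Int_def)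
  also have "\<dots> = (\<Sum>e\<in>T. \<Sum>v\<in>V. if v \<in> e then 1 else 0)" by (rule sum.swap)
  also have "\<dots> = (\<Sum>e\<in>T. 2)"
  proof (rule sum.cong)
    fix x assume "x \<in> T"
    then have "V \<inter> {v. v \<in> x} = x" using e by auto
    then show "(\<Sum>v\<in>V. if v \<in> x then 1 else 0) = (2::nat)"
      using fV e[OF \<open>x \<in> T\<close>] by (simp add: sum.If_cases)
  qed simp
  finally show ?thesis by simp
qed

lemma vdegree_1_unique:
  assumes "vdegree T v = 1" "e \<in> T" "v \<in> e" "e' \<in> T" "v \<in> e'"
  shows "e = e'"
proof -
  obtain f where "{e \<in> T. v \<in> e} = {f}" using assms(1) unfolding vdegree_def by (meson card_1_singletonE)
  moreover have "e \<in> {e \<in> T. v \<in> e}" "e' \<in> {e \<in> T. v \<in> e}" using assms by simp_all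
  ultimately show ?thesis by (metis singletonD)
qed

lemma clockwise_leaves_distinct_set:
  assumes "clockwise_leaves T \<rho> ls" and sg: "simple_graph V T"
  shows "distinct ls" "set ls = {v \<in> V. vdegree T v = 1}"
proof -
  obtain ds where ds: "distinct ds" "set ds = darts T" "ls = filter (\<lambda>v. vdegree T v = 1) (map fst ds)"
    using assms by (auto simp: clockwise_leaves_def boundary_walk_def)
  have uniq: "a = b" if deg: "vdegree T v = 1" and ab: "{v, a} \<in> T" "{v, b} \<in> T" for v a b
  proof -
    have "{v, a} = {v, b}" using vdegree_1_unique[OF deg ab(1) _ ab(2)] by simp
    then show ?thesis by (auto simp: doubleton_eq_iff)
  qed
  have "ls = map fst (filter (\<lambda>d. vdegree T (fst d) = 1) ds)" using ds(3) by (simp add: filter_map comp_def)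
  moreover have "inj_on fst (set (filter (\<lambda>d. vdegree T (fst d) = 1) ds))"
    using ds(2) uniq by (auto simp: inj_on_def darts_def)
  ultimately show "distinct ls" using ds(1) by (simp add: distinct_map)
  show "set ls = {v \<in> V. vdegree T v = 1}"
  proof
    show "set ls \<subseteq> {v \<in> V. vdegree T v = 1}" using ds sg by (auto simp: darts_def simple_graph_def)
    show "{v \<in> V. vdegree T v = 1} \<subseteq> set ls"
    proof
      fix v assume v: "v \<in> {v \<in> V. vdegree T v = 1}"
      then obtain e where "{e \<in> T. v \<in> e} = {e}" unfolding vdegree_def using card_1_singletonE by blast
      then have e: "e \<in> T" "v \<in> e" by auto
      then obtain x y where "e = {x, y}" using sg by (auto simp: simple_graph_def card_2_iff)
      then obtain u where "e = {v, u}" using e(2) by (metis insert_commute insertE singletonD)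
      then have "(v, u) \<in> set ds" using e ds by (auto simp: darts_def)
      then show "v \<in> set ls" using v ds(3) by force
    qed
  qed
qed

section \<open>Degrees in a Halin graph\<close>

locale halin =
  fixes V :: "'a set" and E T C :: "'a set set" and ls :: "'a list"
  assumes tree: "is_tree V T" and no_deg2: "\<And>v. v \<in> V \<Longrightarrow> vdegree T v \<noteq> 2"
    and ls: "distinct ls" "set ls = {v \<in> V. vdegree T v = 1}" "3 \<le> length ls"
    and C: "C = cycle_edges ls" and E: "E = T \<union> C"
begin

lemma simple: "simple_graph V T" using tree by (simp add: is_tree_def)

lemma finite_V: "finite V" using simple by (simp add: simple_graph_def)

lemma T_edge: "e \<in> T \<Longrightarrow> e \<subseteq> V \<and> card e = 2" using simple by (simp add: simple_graph_def)

lemma finite_T: "finite T"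
  using finite_subset[of T "Pow V"] T_edge finite_V by auto

lemma leaves_subset: "set ls \<subseteq> V" using ls(2) by auto

text \<open>Two adjacent leaves have no further tree edges, so they would form a component of the
  tree, yet a third leaf exists. As a consequence no tree edge is a cycle edge.\<close>

lemma leaf_edge_inner:
  assumes "{a, b} \<in> T" "a \<in> set ls" shows "b \<notin> set ls"
proof
  assume b: "b \<in> set ls"
  have "\<not> set ls \<subseteq> {a, b}"
  proof
    assume "set ls \<subseteq> {a, b}"
    then have "card (set ls) \<le> card {a, b}" by (intro card_mono) auto
    also have "\<dots> \<le> 2" by (simp add: card_insert_if)
    finally show False using distinct_card[OF ls(1)] ls(3) by linarith
  qed
  then obtain w where w: "w \<in> set ls" "w \<noteq> a" "w \<noteq> b" by blast
  have "(a, w) \<in> (darts T)\<^sup>*" using tree assms w leaves_subset by (auto simp: is_tree_def)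
  then obtain x y where xy: "(x, y) \<in> darts T" "x \<in> {a, b}" "y \<notin> {a, b}"
    using rtrancl_leaves_set[of a w "darts T" "{a, b}"] w by blast
  have "vdegree T x = 1" using xy(2) assms b ls(2) by auto
  then have "{x, y} = {a, b}" using vdegree_1_unique[of T x "{x, y}" "{a, b}"] xy assms(1) by (auto simp: darts_def)
  then show False using xy(3) by blast
qed

lemma C_edge: "e \<in> C \<Longrightarrow> e \<subseteq> set ls"
  using cycle_edges_subset by (auto simp: C)

lemma T_C_disjoint: "T \<inter> C = {}"
proof (rule ccontr)
  assume "T \<inter> C \<noteq> {}"
  then obtain e where e: "e \<in> T" "e \<in> C" by blast
  then obtain a b where "e = {a, b}" using T_edge by (meson card_2_iff)
  then show False using leaf_edge_inner[of a b] C_edge e by blast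
qed

lemma finite_C: "finite C" by (simp add: C card_cycle_edges_le)

lemma vdegree_E: "vdegree E v = vdegree T v + vdegree C v"
proof -
  have "{e \<in> E. v \<in> e} = {e \<in> T. v \<in> e} \<union> {e \<in> C. v \<in> e}" using E by blast
  moreover have "card ({e \<in> T. v \<in> e} \<union> {e \<in> C. v \<in> e}) = card {e \<in> T. v \<in> e} + card {e \<in> C. v \<in> e}"
    using T_C_disjoint finite_T finite_C by (intro card_Un_disjoint) auto
  ultimately show ?thesis by (simp add: vdegree_def)
qed

lemma leaf_nbrs:
  assumes "v \<in> set ls"
  obtains t u w where "{v, t} \<in> T" "{v, u} \<in> C" "{v, w} \<in> C" "u \<noteq> w" "t \<notin> set ls" "u \<in> set ls" "w \<in> set ls"
    "{e \<in> E. v \<in> e} = {{v, t}, {v, u}, {v, w}}" "u \<noteq> v" "w \<noteq> v" "t \<noteq> v" "t \<in> V"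
proof -
  obtain u w where uw: "u \<in> set ls" "w \<in> set ls" "u \<noteq> v" "w \<noteq> v" "u \<noteq> w" "{e \<in> C. v \<in> e} = {{v, u}, {v, w}}"
    by (rule cycle_edges_nbrs[OF ls(1,3) assms, folded C])
  have "vdegree T v = 1" using assms ls(2) by auto
  then obtain e where e: "{e \<in> T. v \<in> e} = {e}" unfolding vdegree_def by (meson card_1_singletonE)
  then have e': "e \<in> T" "v \<in> e" by auto
  then obtain x y where "e = {x, y}" "x \<noteq> y" using T_edge by (meson card_2_iff)
  then obtain t where t: "e = {v, t}" "t \<noteq> v" using e'(2) by (metis insert_commute insertE singletonD)
  have "{e \<in> E. v \<in> e} = {e \<in> T. v \<in> e} \<union> {e \<in> C. v \<in> e}" using E by blast
  then have "{e \<in> E. v \<in> e} = {{v, t}, {v, u}, {v, w}}" using e t uw by auto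
  moreover have "t \<notin> set ls" using leaf_edge_inner[of v t] e' t assms by blast
  moreover have "{v, u} \<in> C" "{v, w} \<in> C" using uw(6) by blast+
  moreover have "t \<in> V" using T_edge[OF e'(1)] t by blast
  ultimately show ?thesis using that[of t u w] e' t uw by simp
qed

lemma leaf_degree: assumes "v \<in> set ls" shows "vdegree E v = 3"
proof -
  obtain t u w where "t \<notin> set ls" "u \<in> set ls" "w \<in> set ls" "u \<noteq> w" "{e \<in> E. v \<in> e} = {{v, t}, {v, u}, {v, w}}"
    by (rule leaf_nbrs[OF assms])
  moreover then have "card {{v, t}, {v, u}, {v, w}} = 3" using assms by (auto simp: card_insert_if doubleton_eq_iff)
  ultimately show ?thesis unfolding vdegree_def by simp
qed

lemma T_degree_pos: assumes "v \<in> V" shows "\<exists>e\<in>T. v \<in> e"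
proof -
  have "\<not> set ls \<subseteq> {v}"
  proof
    assume "set ls \<subseteq> {v}"
    then have "card (set ls) \<le> card {v}" by (intro card_mono) auto
    then show False using distinct_card[OF ls(1)] ls(3) by simp
  qed
  then obtain w where "w \<in> set ls" "w \<noteq> v" by blast
  then have "(v, w) \<in> (darts T)\<^sup>*" "v \<noteq> w" using tree assms leaves_subset by (auto simp: is_tree_def)
  then obtain y where "(v, y) \<in> darts T" by (meson converse_rtranclE)
  then show ?thesis by (auto simp: darts_def)
qed

lemma inner_degree: assumes "v \<in> V" "v \<notin> set ls" shows "vdegree E v = vdegree T v" "3 \<le> vdegree T v"
proof -
  have "{e \<in> C. v \<in> e} = {}" using C_edge assms(2) by blast
  then have "vdegree C v = 0" unfolding vdegree_def by (simp only: card.empty)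
  then show "vdegree E v = vdegree T v" by (simp add: vdegree_E)
  have "{e \<in> T. v \<in> e} \<noteq> {}" using T_degree_pos[OF assms(1)] by blast
  then have "vdegree T v \<noteq> 0" unfolding vdegree_def using finite_T by simp
  moreover have "vdegree T v \<noteq> 1" using assms ls(2) by blast
  ultimately show "3 \<le> vdegree T v" using no_deg2[OF assms(1)] by linarith
qed

lemma card_T: "card V = card T + 1"
  using grown_basic[OF tree_grown[OF tree]] by blast

lemma sum_T_degree: "(\<Sum>v\<in>V. vdegree T v) + 2 = 2 * card V"
  using sum_vdegree[OF simple] card_T by simp

end

lemma halin_construction_halin:
  assumes "halin_construction V E T C"
  obtains ls where "halin V E T C ls"
proof -
  obtain \<rho> ls where h: "is_tree V T" "\<forall>v\<in>V. vdegree T v \<noteq> 2" "clockwise_leaves T \<rho> ls" "3 \<le> length ls" "C = cycle_edges ls" "E = T \<union> C"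
    using assms by (auto simp: halin_construction_def)
  have "halin V E T C ls"
    using h clockwise_leaves_distinct_set[OF h(3)] by unfold_locales (auto simp: is_tree_def)
  then show ?thesis using that by blast
qed

section \<open>Counting segment ends\<close>

locale segment_halin = segments M + halin "seg_verts M" "seg_edges M" T C ls
  for M :: "complex set set" and T C :: "complex set set" and ls :: "complex list" +
  assumes outer: "outer_edges M = C"
begin

abbreviation "drawing F \<equiv> \<Union>e\<in>F. convex hull e"

lemma T_subset: "T \<subseteq> seg_edges M" and C_subset: "C \<subseteq> seg_edges M" using E by auto

lemma compact_drawing: "F \<subseteq> seg_edges M \<Longrightarrow> compact (drawing F)"
proof (rule compact_UN)
  assume F: "F \<subseteq> seg_edges M"
  show "finite F" using F finite_E finite_subset by blast
  show "compact (convex hull e)" if e: "e \<in> F" for e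
  proof -
    have "card e = 2" using card_edge e F by blast
    then show ?thesis by (metis card.infinite finite_imp_compact_convex_hull zero_neq_numeral)
  qed
qed

text \<open>Growing the tree edge by edge, the new edge meets the old drawing in at most the vertex
  it is attached to; Janiszewski's theorem then preserves connectedness of the complement.\<close>

lemma connected_complement_tree: "connected (- drawing T)"
proof -
  have "F \<subseteq> seg_edges M \<Longrightarrow> connected (- drawing F)" if "grown S F" for S F
    using that
  proof (induction rule: grown.induct)
    case (base r)
    then show ?case by (simp add: connected_UNIV)
  next
    case (step S F u v)
    let ?X = "drawing F" and ?Y = "convex hull {u, v}"
    have "?X \<inter> ?Y \<subseteq> {u}"
    proof
      fix z assume z: "z \<in> ?X \<inter> ?Y"
      then obtain e where e: "e \<in> F" "z \<in> convex hull e" by blast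
      have "e \<subseteq> S" using grown_basic[OF step.hyps(1)] e by blast
      then have "z \<in> e \<inter> {u, v}"
        using edges_meet_in_verts[of e "{u, v}" z] e z step by blast
      then show "z \<in> {u}" using \<open>e \<subseteq> S\<close> step.hyps by blast
    qed
    then have con: "connected (?X \<inter> ?Y)" by (metis connected_empty connected_sing subset_singletonD)
    have "connected (- ?Y)"
      using connected_complement_bounded_convex[of ?Y] by (simp add: bounded_convex_hull convex_convex_hull)
    moreover have "connected (- ?X)" "compact ?X" using step compact_drawing[of F] by auto
    moreover have "closed ?Y" by (simp add: finite_imp_compact_convex_hull compact_imp_closed)
    ultimately have "connected (- (?X \<union> ?Y))" using Janiszewski_connected[OF _ _ con] by blast
    then show ?case by (simp add: Un_commute)
  qed
  then show ?thesis using tree_grown[OF tree] T_subset by blast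
qed

lemma verts_in_tree_drawing: "v \<in> V \<Longrightarrow> v \<in> drawing T"
  using T_degree_pos by (meson UN_I hull_inc)

text \<open>Every vertex already lies on the drawing of the tree, so a cycle edge is attached at
  both its ends and nowhere else, as \<open>card_components_Un_segment_le\<close> requires.\<close>

lemma card_components_drawing:
  assumes "finite D" "D \<subseteq> C"
  shows "finite (components (- drawing (T \<union> D))) \<and> card (components (- drawing (T \<union> D))) \<le> 1 + card D"
  using assms
proof (induction rule: finite_induct)
  case empty
  have "components (- drawing T) \<subseteq> {- drawing T}"
    using connected_complement_tree by (metis components_eq_sing_iff components_empty empty_subsetI order_refl)
  then show ?case using card_mono[of "{- drawing T}" "components (- drawing T)"] finite_subset by fastforce
next
  case (insert e D)
  let ?X = "drawing (T \<union> D)"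
  have eE: "e \<in> seg_edges M" "e \<notin> T \<union> D" using insert C_subset T_C_disjoint by auto
  obtain a b where ab: "e = {a, b}" "a \<noteq> b" "a \<in> V" "b \<in> V" using edgeE[OF eE(1)] by metis
  have X: "a \<in> ?X" "b \<in> ?X" using verts_in_tree_drawing ab by blast+
  have "?X \<inter> closed_segment a b \<subseteq> {a, b}"
  proof
    fix z assume z: "z \<in> ?X \<inter> closed_segment a b"
    then obtain f where f: "f \<in> T \<union> D" "z \<in> convex hull f" by blast
    have "z \<in> f \<inter> e"
      using edges_meet_in_verts[of f e z] f z eE insert.prems C_subset T_subset
      by (auto simp: ab(1) segment_convex_hull)
    then show "z \<in> {a, b}" using ab by blast
  qed
  then have int: "?X \<inter> closed_segment a b = {a, b}" using X by auto
  have "T \<union> D \<subseteq> seg_edges M" using insert.prems C_subset T_subset by blast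
  then have cX: "compact ?X" by (rule compact_drawing)
  have eq: "drawing (T \<union> insert e D) = ?X \<union> closed_segment a b" by (auto simp: ab(1) segment_convex_hull)
  show ?case using card_components_Un_segment_le[OF cX _ X ab(2) int] insert unfolding eq by auto
qed

lemma card_circuits_le: "card (circuits M) \<le> length ls"
proof -
  have eq: "drawing (T \<union> C) = \<Union>M" using Union_edges E by simp
  have c: "finite (components (- \<Union>M))" "card (components (- \<Union>M)) \<le> 1 + card C"
    using card_components_drawing[OF finite_C order_refl] unfolding eq by auto
  \<comment> \<open>One of the at most \<open>1 + card C\<close> faces is unbounded and thus no
    circuit.\<close>
  have "bounded (\<Union>M)" using compact_drawing[OF equalityD1[OF E[symmetric]]] compact_imp_bounded unfolding eq by blast
  then obtain F where F: "F \<in> components (- \<Union>M)" "\<not> bounded F"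
    using cobounded_unbounded_components[of "- \<Union>M"] by auto
  then have "circuits M \<subseteq> components (- \<Union>M) - {F}" unfolding circuits_def by blast
  then have "card (circuits M) \<le> card (components (- \<Union>M) - {F})" using c by (intro card_mono) auto
  also have "\<dots> \<le> card C" using c F by simp
  also have "\<dots> \<le> length ls" by (simp add: C card_cycle_edges_le)
  finally show ?thesis .
qed

section \<open>Corners of the convex hull\<close>

definition "hull_corners = {x. x extreme_point_of (convex hull V)}"

lemma hull_corners: "hull_corners \<subseteq> V" "finite hull_corners" "convex hull V = convex hull hull_corners"
proof -
  show "hull_corners \<subseteq> V" using extreme_points_of_convex_hull by (auto simp: hull_corners_def)
  then show "finite hull_corners" using finite_V finite_subset by blast
  show "convex hull V = convex hull hull_corners"
    unfolding hull_corners_def by (rule Krein_Milman_polytope[OF finite_V])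
qed

lemma Union_subset_hull: "\<Union>M \<subseteq> convex hull V"
proof -
  have "convex hull e \<subseteq> convex hull V" if "e \<in> seg_edges M" for e
    using that edgeD by (intro hull_mono) (auto elim!: edgeE)
  then show ?thesis using Union_edges by blast
qed

lemma degree_ge_3: "v \<in> V \<Longrightarrow> 3 \<le> vdegree (seg_edges M) v"
  using leaf_degree inner_degree by (metis order_refl)

text \<open>With at most two extreme points the whole drawing would be collinear; but a vertex of
  degree at least 3 lies on two segments, and distinct collinear segments do not meet.\<close>

lemma card_hull_corners: "3 \<le> card hull_corners"
proof (rule ccontr)
  assume "\<not> 3 \<le> card hull_corners"
  then have "collinear hull_corners" using collinear_small[OF hull_corners(2)] by simp
  then have col: "collinear (\<Union>M)"
    using Union_subset_hull hull_corners(3) by (metis affine_hull_convex_hull collinear_affine_hull_collinear collinear_subset convex_hull_subset_affine_hull)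
  obtain v where v: "v \<in> V" using tree by (auto simp: is_tree_def)
  have "3 \<le> 2 * seg_count M v" using vdegree_plus_end_count[OF v] degree_ge_3[OF v] by linarith
  then have "\<not> card {s \<in> M. v \<in> s} \<le> Suc 0" unfolding seg_count_def by linarith
  then obtain s t where "s \<in> M" "t \<in> M" "v \<in> s" "v \<in> t" "s \<noteq> t"
    using card_le_Suc0_iff_eq[of "{s \<in> M. v \<in> s}"] finite_M by auto
  moreover then have "collinear (s \<union> t)" using col by (meson Sup_upper Un_least collinear_subset)
  ultimately show False using sys by (auto simp: segment_system_def)
qed

lemma hull_corner_end_count:
  assumes "x \<in> hull_corners" shows "end_count M x = vdegree (seg_edges M) x"
proof -
  have "x \<in> seg_ends s" if "s \<in> M" "x \<in> s" for s
    using assms that Union_subset_hull unfolding hull_corners_def seg_ends_def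
    by (auto simp: extreme_point_of_def)
  then have "{s \<in> M. x \<in> seg_ends s} = {s \<in> M. x \<in> s}" using seg_ends_card(4) by blast
  then have "end_count M x = seg_count M x" by (simp add: end_count_def seg_count_def)
  then show ?thesis using vdegree_plus_end_count[of x] assms hull_corners(1) by auto
qed

section \<open>Double counting of segment ends and of tree degrees\<close>

abbreviation "inner_verts \<equiv> V - set ls"
abbreviation "deg \<equiv> vdegree (seg_edges M)"

definition "odd_inner = {v \<in> inner_verts. odd (deg v)}"
definition "even_inner = {v \<in> inner_verts. even (deg v)}"

text \<open>Parity forces one end at an odd vertex. At a hull corner the number of ends is the
  degree, at least 3 if odd and at least 4 if even, so 2 may be added in both cases.\<close>

definition min_ends :: "complex \<Rightarrow> nat" where
  "min_ends v = (if odd (deg v) then 1 else 0) + (if v \<in> hull_corners then 2 else 0)"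

text \<open>The least possible degrees in the tree: an inner vertex has degree at least 3 there,
  hence at least 4 if its degree is even.\<close>

definition min_degree :: "complex \<Rightarrow> nat" where
  "min_degree v = (if v \<in> set ls then 1 else if odd (deg v) then 3 else 4)"

lemma min_ends_le: assumes "v \<in> V" shows "min_ends v \<le> end_count M v"
proof (cases "v \<in> hull_corners")
  case True
  have "min_ends v \<le> deg v" using degree_ge_3[OF assms] True by (auto simp: min_ends_def elim!: evenE)
  then show ?thesis using hull_corner_end_count[OF True] by simp
next
  case False
  have "even (deg v + end_count M v)" using vdegree_plus_end_count[OF assms] by simp
  then show ?thesis using False by (auto simp: min_ends_def elim: oddE)
qed

lemma min_degree_le: assumes "v \<in> V" shows "min_degree v \<le> vdegree T v"
proof (cases "v \<in> set ls")
  case True then show ?thesis using ls(2) by (simp add: min_degree_def)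
next
  case False
  then show ?thesis using inner_degree[OF assms False] by (auto simp: min_degree_def elim!: evenE)
qed

lemma card_split: "card V = length ls + card odd_inner + card even_inner"
proof -
  have "V = set ls \<union> (odd_inner \<union> even_inner)" using leaves_subset by (auto simp: odd_inner_def even_inner_def)
  moreover have "card (set ls \<union> (odd_inner \<union> even_inner)) = card (set ls) + card (odd_inner \<union> even_inner)"
    using finite_V by (intro card_Un_disjoint) (auto simp: odd_inner_def even_inner_def)
  moreover have "card (odd_inner \<union> even_inner) = card odd_inner + card even_inner"
    using finite_V by (intro card_Un_disjoint) (auto simp: odd_inner_def even_inner_def)
  ultimately show ?thesis using distinct_card[OF ls(1)] by simp
qed

lemma sum_min_ends: "(\<Sum>v\<in>V. min_ends v) = length ls + card odd_inner + 2 * card hull_corners"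
proof -
  have "(\<Sum>v\<in>V. if odd (deg v) then 1 else 0) = card {v \<in> V. odd (deg v)}"
    using finite_V by (simp add: sum.If_cases Int_def)
  also have "{v \<in> V. odd (deg v)} = set ls \<union> odd_inner"
    using leaf_degree leaves_subset by (auto simp: odd_inner_def)
  also have "card \<dots> = length ls + card odd_inner"
    using finite_V distinct_card[OF ls(1)] by (subst card_Un_disjoint) (auto simp: odd_inner_def)
  finally have 1: "(\<Sum>v\<in>V. if odd (deg v) then 1 else 0) = length ls + card odd_inner" .
  have "V \<inter> hull_corners = hull_corners" using hull_corners(1) by blast
  then have "(\<Sum>v\<in>V. if v \<in> hull_corners then 2 else 0) = 2 * card hull_corners"
    using finite_V by (simp add: sum.If_cases)
  then show ?thesis unfolding min_ends_def by (simp add: sum.distrib 1)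
qed

lemma sum_min_degree: "(\<Sum>v\<in>V. min_degree v) = length ls + 3 * card odd_inner + 4 * card even_inner"
proof -
  have "(\<Sum>v\<in>V. min_degree v) = (\<Sum>v\<in>set ls. min_degree v) + (\<Sum>v\<in>inner_verts. min_degree v)"
    using finite_V leaves_subset by (simp add: sum.subset_diff add.commute)
  also have "(\<Sum>v\<in>set ls. min_degree v) = length ls" using distinct_card[OF ls(1)] by (simp add: min_degree_def)
  also have "(\<Sum>v\<in>inner_verts. min_degree v) = (\<Sum>v\<in>inner_verts. if odd (deg v) then 3 else 4)"
    by (rule sum.cong) (auto simp: min_degree_def)
  also have "\<dots> = 3 * card odd_inner + 4 * card even_inner"
    using finite_V by (simp add: sum.If_cases odd_inner_def even_inner_def Int_def conj_commute conj_assoc)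
  finally show ?thesis by simp
qed

text \<open>The constant 6 is the extra 2 of \<open>min_ends\<close> at each of at least three hull
  corners.\<close>

lemma leaves_bound: "length ls + card odd_inner + 6 \<le> 2 * card M"
proof -
  have "(\<Sum>v\<in>V. min_ends v) \<le> (\<Sum>v\<in>V. end_count M v)" by (intro sum_mono min_ends_le)
  then show ?thesis using sum_min_ends sum_end_count card_hull_corners by linarith
qed

lemma inner_bound: "card odd_inner + 2 * card even_inner + 2 \<le> length ls"
proof -
  have "(\<Sum>v\<in>V. min_degree v) \<le> (\<Sum>v\<in>V. vdegree T v)" by (intro sum_mono min_degree_le)
  then show ?thesis using sum_min_degree sum_T_degree card_split by linarith
qed

text \<open>Equality of the totals turns all termwise estimates into equalities, so ends and degrees
  can be read off at each vertex.\<close>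

lemma equality_case:
  assumes "3 * card M \<le> card V + 10"
  shows "card hull_corners = 3" "\<And>v. v \<in> V \<Longrightarrow> end_count M v = min_ends v" "\<And>v. v \<in> inner_verts \<Longrightarrow> deg v = 4"
    "hull_corners \<subseteq> set ls"
proof -
  have eq: "card odd_inner = 0" "length ls + 6 = 2 * card M" "length ls = 2 * card even_inner + 2"
    using assms leaves_bound inner_bound card_split by linarith+
  have le: "(\<Sum>v\<in>V. min_ends v) \<le> (\<Sum>v\<in>V. end_count M v)" by (intro sum_mono min_ends_le)
  then show c: "card hull_corners = 3" using sum_min_ends sum_end_count eq card_hull_corners by linarith
  have "(\<Sum>v\<in>V. min_ends v) = (\<Sum>v\<in>V. end_count M v)" using sum_min_ends sum_end_count eq c by linarith
  then show ends: "end_count M v = min_ends v" if "v \<in> V" for v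
    using sum_mono_inv[of min_ends V "end_count M" v] min_ends_le that finite_V by simp
  have "(\<Sum>v\<in>V. min_degree v) = (\<Sum>v\<in>V. vdegree T v)" using sum_min_degree sum_T_degree card_split eq by linarith
  then have "vdegree T v = min_degree v" if "v \<in> V" for v
    using sum_mono_inv[of min_degree V "vdegree T" v] min_degree_le that finite_V by simp
  moreover have "odd_inner = {}" using eq(1) finite_V by (simp add: odd_inner_def)
  ultimately show inner4: "deg v = 4" if "v \<in> inner_verts" for v
    using that inner_degree[of v] by (auto simp: min_degree_def odd_inner_def)
  show "hull_corners \<subseteq> set ls"
  proof
    fix x assume x: "x \<in> hull_corners"
    then have "x \<in> V" using hull_corners by blast
    show "x \<in> set ls"
    proof (rule ccontr)
      assume "x \<notin> set ls"
      then have "deg x = 4" using inner4 \<open>x \<in> V\<close> by blast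
      \<comment> \<open>Four segment ends would meet at \<open>x\<close>, while equality allows only
        \<open>min_ends x = 2\<close>.\<close>
      then show False using ends[OF \<open>x \<in> V\<close>] hull_corner_end_count[OF x] x by (simp add: min_ends_def)
    qed
  qed
qed

end

section \<open>The outer face\<close>

lemma connected_subset_outside:
  assumes "connected P" "P \<inter> S = {}" "x \<in> P" "x \<in> outside S"
  shows "P \<subseteq> outside S"
proof
  fix y assume "y \<in> P"
  then have "connected_component (- S) x y" unfolding connected_component_def using assms by blast
  then show "y \<in> outside S" using assms(4) outside_same_component by blast
qed

text \<open>The bridge from Jordan curves to orientation: a curve with nonempty inside that lies in
  a triangle yields a nonzero determinant.\<close>

lemma interior_triangle_eq_empty_iff:
  fixes a b c :: complex
  shows "interior (convex hull {a, b, c}) = {} \<longleftrightarrow> cross (b - a) (c - a) = 0"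
proof
  assume z: "cross (b - a) (c - a) = 0"
  have "\<exists>u v. {a, b, c} \<subseteq> affine hull {u, v}"
  proof (cases "a = b")
    case True then show ?thesis by (metis hull_subset insert_absorb2)
  next
    case False
    then obtain t where "c - a = t *\<^sub>R (b - a)" using cross_eq_0_imp_scaleR[OF z] by auto
    then have "c = (1 - t) *\<^sub>R a + t *\<^sub>R b" by (simp add: algebra_simps)
    then have "c \<in> affine hull {a, b}" unfolding affine_hull_2 by (smt (verit) mem_Collect_eq)
    then have "{a, b, c} \<subseteq> affine hull {a, b}" by (simp add: hull_inc)
    then show ?thesis by blast
  qed
  then obtain u v where "{a, b, c} \<subseteq> affine hull {u, v}" by blast
  then have sub: "convex hull {a, b, c} \<subseteq> affine hull {u, v}" by (metis affine_affine_hull affine_imp_convex hull_minimal)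
  have "interior (affine hull {u, v}) = {}" by (rule empty_interior_affine_hull) (auto simp: card_insert_if)
  then show "interior (convex hull {a, b, c}) = {}" using interior_mono[OF sub] by blast
next
  assume e: "interior (convex hull {a, b, c}) = {}"
  show "cross (b - a) (c - a) = 0"
  proof (cases "a = b \<or> a = c \<or> b = c")
    case True then show ?thesis by auto
  next
    case False
    then have "affine_dependent {a, b, c}" using e interior_convex_hull_eq_empty[of "{a, b, c}"] by simp
    then have "collinear {a, b, c}" by (simp add: collinear_3_eq_affine_dependent)
    then obtain u v ta tb tc where "a = u + ta *\<^sub>R v" "b = u + tb *\<^sub>R v" "c = u + tc *\<^sub>R v"
      unfolding collinear_alt by (metis insertCI)
    then have "b - a = (tb - ta) *\<^sub>R v" "c - a = (tc - ta) *\<^sub>R v" by (auto simp: algebra_simps)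
    then show ?thesis by simp
  qed
qed

text \<open>The first pair of conditions yields a point of the segment from \<open>b\<close> to
  \<open>b'\<close> on the line through \<open>a\<close> and \<open>a'\<close>; the second pair
  shows that its parameter on that line lies in the unit interval. The products may vanish, as
  \<open>a'\<close> or \<open>b'\<close> may be the crossing.\<close>

lemma segments_cross:
  fixes a a' b b' :: complex
  assumes "cross (a' - a) (b - a) \<noteq> 0" "cross (a' - a) (b - a) * cross (a' - a) (b' - a) \<le> 0"
    and "cross (b' - b) (a - b) \<noteq> 0" "cross (b' - b) (a - b) * cross (b' - b) (a' - b) \<le> 0"
  shows "closed_segment a a' \<inter> closed_segment b b' \<noteq> {}"
proof -
  have ratio: "0 \<le> p / (p - q) \<and> p / (p - q) \<le> 1 \<and> p - q \<noteq> 0" if "p \<noteq> 0" "p * q \<le> 0" for p q :: real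
    using that by (auto simp: divide_simps mult_le_0_iff)
  define p q where "p = cross (a' - a) (b - a)" and "q = cross (a' - a) (b' - a)"
  \<comment> \<open>The determinant is affine along the second segment, with values \<open>p\<close>
    and \<open>q\<close> at its ends; this is its zero.\<close>
  define \<tau> where "\<tau> = p / (p - q)"
  have \<tau>: "0 \<le> \<tau>" "\<tau> \<le> 1" "p - q \<noteq> 0" using ratio[of p q] assms(1,2) by (auto simp: p_def q_def \<tau>_def)
  define x where "x = b + \<tau> *\<^sub>R (b' - b)"
  have "cross (a' - a) (x - a) = p - \<tau> * (p - q)" unfolding x_def p_def q_def by (simp add: cross_linear algebra_simps)
  also have "\<dots> = 0" using \<tau> by (simp add: \<tau>_def)
  finally have "cross (a' - a) (x - a) = 0" .
  then obtain \<sigma> where "x - a = \<sigma> *\<^sub>R (a' - a)" using cross_eq_0_imp_scaleR[of "a' - a"] assms(1) by fastforce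
  then have xs: "x = a + \<sigma> *\<^sub>R (a' - a)" by (simp add: algebra_simps)
  define r s where "r = cross (b' - b) (a - b)" and "s = cross (b' - b) (a' - b)"
  have rs: "r \<noteq> 0" "r * s \<le> 0" using assms(3,4) by (auto simp: r_def s_def)
  have "cross (b' - b) (x - b) = 0" by (simp add: x_def)
  moreover have "cross (b' - b) (x - b) = r - \<sigma> * (r - s)"
    unfolding xs r_def s_def by (simp add: cross_linear algebra_simps)
  ultimately have "\<sigma> = r / (r - s)" using ratio[OF rs] by (simp add: field_simps)
  then have "0 \<le> \<sigma>" "\<sigma> \<le> 1" using ratio[OF rs] by auto
  then have "x \<in> closed_segment a a'" unfolding xs closed_segment_def by (auto intro!: exI[of _ \<sigma>] simp: algebra_simps)
  moreover have "x \<in> closed_segment b b'" unfolding x_def closed_segment_def using \<tau> by (auto intro!: exI[of _ \<tau>] simp: algebra_simps)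
  ultimately show ?thesis by blast
qed

text \<open>A nondegenerate triangle contains a point of \<open>- X\<close> because \<open>X\<close>
  has empty interior, and misses one because \<open>X\<close> is bounded; the connected set
  \<open>- X\<close> would have to pass through the sides. Applied to the drawing of the tree, this
  is acyclicity in geometric form.\<close>

lemma triangle_sides_enclose:
  fixes X :: "complex set"
  assumes con: "connected (- X)" and "compact X" "interior X = {}"
    and sides: "closed_segment a b \<subseteq> X" "closed_segment b c \<subseteq> X" "closed_segment c a \<subseteq> X"
  shows "cross (b - a) (c - a) = 0"
proof (rule ccontr)
  let ?T = "convex hull {a, b, c}"
  assume "cross (b - a) (c - a) \<noteq> 0"
  then have "interior ?T \<noteq> {}" using interior_triangle_eq_empty_iff by blast
  then have "\<not> interior ?T \<subseteq> X" using assms(3) interior_maximal[of "interior ?T" X] by auto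
  then have 1: "- X \<inter> ?T \<noteq> {}" using interior_subset by blast
  have "bounded (X \<union> ?T)" using assms(2) by (simp add: compact_imp_bounded bounded_convex_hull)
  then have "X \<union> ?T \<noteq> UNIV" by (metis not_bounded_UNIV)
  then have "- X - ?T \<noteq> {}" by blast
  from connected_Int_frontier[OF con 1 this] have "- X \<inter> frontier ?T \<noteq> {}" .
  moreover have "frontier ?T \<subseteq> X" using sides frontier_of_triangle[of a b c] by auto
  ultimately show False by blast
qed

context segments
begin

lemma edges_not_same_direction:
  assumes "{w, a} \<in> E" "{w, b} \<in> E" "a - w = \<tau> *\<^sub>R (b - w)" "\<tau> > 0"
  shows "a = b"
proof (rule ccontr)
  assume "a \<noteq> b"
  have ne: "w \<noteq> a" "w \<noteq> b" using edgeD(1) assms(1,2) by blast+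
  define f where "f = line_coord w b"
  note f = line_coord_01[of w b, folded f_def] line_coord[OF ne(2), folded f_def]
  have a: "a = f \<tau>" using assms(3) by (simp add: f_def line_coord_def algebra_simps)
  \<comment> \<open>The midpoint of the shorter of the two edges, hence interior to both.\<close>
  define z where "z = f (min 1 \<tau> / 2)"
  have "z \<in> open_segment (f 0) (f 1)" "z \<in> open_segment (f 0) (f \<tau>)" unfolding z_def f(5) using assms(4) by auto
  then have z: "z \<in> open_segment w b" "z \<in> open_segment w a" unfolding f(1,2) a by auto
  then have "z \<in> convex hull {w, b}" "z \<in> convex hull {w, a}" "z \<noteq> w" "z \<noteq> a" "z \<noteq> b"
    by (auto simp: open_segment_def segment_convex_hull)
  moreover have "{w, a} \<noteq> {w, b}" using \<open>a \<noteq> b\<close> by (auto simp: doubleton_eq_iff)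
  ultimately show False using edges_meet_in_verts[OF assms(1,2), of z] by blast
qed

lemma closed_edges: "F \<subseteq> E \<Longrightarrow> closed (\<Union>e\<in>F. convex hull e)"
proof (rule closed_UN)
  assume F: "F \<subseteq> E"
  then show "finite F" using finite_E finite_subset by blast
  show "\<forall>e\<in>F. closed (convex hull e)"
    using F by (auto simp: seg_edges_def intro!: compact_imp_closed finite_imp_compact_convex_hull)
qed

text \<open>A face that touches one side of an edge near an end touches that side along the whole edge:
  a thin strip on that side misses the drawing.\<close>

lemma half_ball_edge_outer:
  assumes e: "{w, t} \<in> E" and r: "r > 0" and k: "k \<noteq> 0"
    and H: "\<And>x. x \<in> ball w r \<Longrightarrow> k * cross (t - w) (x - w) > 0 \<Longrightarrow> x \<in> outside (\<Union>M)"
  shows "{w, t} \<in> outer_edges M"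
proof -
  have wt: "w \<noteq> t" using edgeD(1)[OF e] .
  let ?d = "t - w" and ?O = "outside (\<Union>M)"
  \<comment> \<open>A normal vector of the edge that points to the side on which the ball is known
    to be outer.\<close>
  define n where "n = k *\<^sub>R (\<i> * ?d)"
  have cn: "k * cross ?d n > 0"
  proof -
    have "k * cross ?d n = k\<^sup>2 * ((Re ?d)\<^sup>2 + (Im ?d)\<^sup>2)" by (simp add: n_def cross_def power2_eq_square algebra_simps)
    moreover have "(Re ?d)\<^sup>2 + (Im ?d)\<^sup>2 > 0" using wt by (auto simp: complex_eq_iff sum_power2_gt_zero_iff)
    ultimately show ?thesis using k by simp
  qed
  define f where "f = line_coord w t"
  note f = line_coord_01[of w t, folded f_def] line_coord[OF wt, folded f_def]
  have f': "f a = w + a *\<^sub>R ?d" for a by (simp add: f_def line_coord_def)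
  define Z where "Z = (\<Union>e'\<in>E - {{w, t}}. convex hull e')"
  have Z: "closed Z" unfolding Z_def by (rule closed_edges) auto
  have UM: "\<Union>M = Z \<union> closed_segment w t"
    using Union_edges e unfolding Z_def by (auto simp: segment_convex_hull)
  have "open_segment w t \<subseteq> closure ?O"
  proof
    fix z assume z: "z \<in> open_segment w t"
    then obtain \<tau> where \<tau>: "z = f \<tau>" using closed_segment_param[of z w t] f' by (metis open_closed_segment)
    then have \<tau>01: "0 < \<tau>" "\<tau> < 1" using z f(5)[of \<tau> 0 1] unfolding f(1,2) by auto
    \<comment> \<open>The strip starts at \<open>f \<sigma>\<close>, so near \<open>w\<close> that
      its first points lie in the ball, and runs on to \<open>z\<close>.\<close>
    define \<sigma> where "\<sigma> = min \<tau> (r / (2 * norm ?d))"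
    have \<sigma>: "0 < \<sigma>" "\<sigma> \<le> \<tau>" "\<sigma> * norm ?d \<le> r / 2"
    proof -
      show "0 < \<sigma>" "\<sigma> \<le> \<tau>" using \<tau>01 r wt by (auto simp: \<sigma>_def)
      have "\<sigma> * norm ?d \<le> r / (2 * norm ?d) * norm ?d" by (rule mult_right_mono) (auto simp: \<sigma>_def)
      then show "\<sigma> * norm ?d \<le> r / 2" using wt by simp
    qed
    let ?K = "closed_segment (f \<sigma>) (f \<tau>)"
    have K: "?K \<subseteq> open_segment w t"
    proof -
      have "f \<sigma> \<in> open_segment (f 0) (f 1)" "f \<tau> \<in> open_segment (f 0) (f 1)" unfolding f(5) using \<sigma> \<tau>01 by auto
      then show ?thesis unfolding f(1,2) by (simp add: closed_segment_subset convex_open_segment)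
    qed
    have "?K \<inter> Z = {}"
    proof (rule ccontr)
      assume "?K \<inter> Z \<noteq> {}"
      then obtain x e' where x: "x \<in> ?K" "e' \<in> E" "e' \<noteq> {w, t}" "x \<in> convex hull e'" unfolding Z_def by blast
      then have "x \<in> open_segment w t" using K by blast
      then have "x \<in> convex hull {w, t}" "x \<notin> {w, t}" by (auto simp: open_segment_def segment_convex_hull)
      then show False using edges_meet_in_verts[OF e x(2)] x by blast
    qed
    then obtain \<delta> where \<delta>: "\<delta> > 0" "\<And>x y. x \<in> ?K \<Longrightarrow> y \<in> Z \<Longrightarrow> \<delta> \<le> dist x y"
      using separate_compact_closed[OF compact_segment Z] by metis
    define \<epsilon> where "\<epsilon> = min (\<delta> / norm n) (r / (2 * norm n))"
    have "n \<noteq> 0" using cn by auto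
    then have \<epsilon>: "\<epsilon> > 0" using \<delta> r by (simp add: \<epsilon>_def)
    have \<epsilon>n: "s * norm n < \<delta>" "s * norm n < r / 2" if "s < \<epsilon>" for s
      using that \<open>n \<noteq> 0\<close> by (auto simp: \<epsilon>_def field_simps)
    \<comment> \<open>The strip along \<open>?K\<close> on that side. It misses the drawing, since
      it stays off the line of the edge and closer than \<open>\<delta>\<close> to
      \<open>?K\<close>.\<close>
    define P where "P = (\<Union>x\<in>?K. \<Union>y\<in>(\<lambda>s. s *\<^sub>R n) ` {0<..<\<epsilon>}. {x + y})"
    have Pc: "connected P" unfolding P_def
      by (intro convex_connected convex_sums convex_closed_segment convex_linear_image)
        (auto simp: bounded_linear.linear bounded_linear_scaleR_left)
    have side: "k * cross ?d (x + s *\<^sub>R n - w) = s * (k * cross ?d n)" if "x \<in> ?K" for x s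
    proof -
      have "x \<in> closed_segment w t" using that K open_closed_segment by blast
      then obtain a where "x = w + a *\<^sub>R ?d" using closed_segment_param by blast
      then show ?thesis by (simp add: cross_linear)
    qed
    have PM: "P \<inter> \<Union>M = {}"
    proof (rule ccontr)
      assume "P \<inter> \<Union>M \<noteq> {}"
      then obtain y where y: "y \<in> P" "y \<in> \<Union>M" by blast
      then obtain x s where x': "x \<in> ?K" "0 < s" "s < \<epsilon>" "y = x + s *\<^sub>R n" unfolding P_def by auto
      then have x: "x \<in> ?K" "0 < s" "s < \<epsilon>" "x + s *\<^sub>R n \<in> \<Union>M" using y by auto
      from x(4) consider "x + s *\<^sub>R n \<in> Z" | "x + s *\<^sub>R n \<in> closed_segment w t" unfolding UM by blast
      then show False
      proof cases
        case 1
        then have "\<delta> \<le> s * norm n" using \<delta>(2)[OF x(1)] x(2) by (fastforce simp: dist_norm)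
        then show False using \<epsilon>n(1)[OF x(3)] by simp
      next
        case 2
        then obtain a where "x + s *\<^sub>R n = w + a *\<^sub>R ?d" using closed_segment_param by blast
        then have "cross ?d (x + s *\<^sub>R n - w) = 0" by simp
        then have "s * (k * cross ?d n) = 0" using side[OF x(1), of s] by simp
        then show False using mult_pos_pos[OF x(2) cn] by linarith
      qed
    qed
    have "f \<sigma> + (\<epsilon> / 2) *\<^sub>R n \<in> ?O"
    proof (rule H)
      have "dist w (f \<sigma> + (\<epsilon> / 2) *\<^sub>R n) \<le> norm (\<sigma> *\<^sub>R ?d) + norm ((\<epsilon> / 2) *\<^sub>R n)"
        unfolding f' dist_norm by (metis (no_types, lifting) add.assoc add_diff_cancel_left' norm_minus_commute norm_triangle_ineq)
      also have "\<dots> = \<sigma> * norm ?d + \<epsilon> / 2 * norm n" using \<sigma> \<epsilon> by simp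
      also have "\<dots> < r" using \<sigma>(3) \<epsilon>n(2)[of "\<epsilon> / 2"] \<epsilon> by simp
      finally show "f \<sigma> + (\<epsilon> / 2) *\<^sub>R n \<in> ball w r" by simp
      have "k * cross ?d (f \<sigma> + (\<epsilon> / 2) *\<^sub>R n - w) = \<epsilon> / 2 * (k * cross ?d n)" by (rule side) simp
      moreover have "\<epsilon> / 2 * (k * cross ?d n) > 0" by (rule mult_pos_pos[OF _ cn]) (use \<epsilon> in simp)
      ultimately show "0 < k * cross ?d (f \<sigma> + (\<epsilon> / 2) *\<^sub>R n - w)" by linarith
    qed
    moreover have inP: "x + s *\<^sub>R n \<in> P" if "x \<in> ?K" "0 < s" "s < \<epsilon>" for x s
    proof -
      have "s *\<^sub>R n \<in> (\<lambda>s. s *\<^sub>R n) ` {0<..<\<epsilon>}" using that by auto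
      then show ?thesis unfolding P_def using that(1) by blast
    qed
    ultimately have PO: "P \<subseteq> ?O"
      using connected_subset_outside[OF Pc PM inP[of "f \<sigma>" "\<epsilon> / 2"]] \<epsilon> by simp
    show "z \<in> closure ?O"
      unfolding closure_approachable
    proof (intro allI impI)
      fix \<eta> :: real assume \<eta>: "0 < \<eta>"
      define s where "s = min (\<epsilon> / 2) (\<eta> / (2 * norm n))"
      have s: "0 < s" "s < \<epsilon>" using \<epsilon> \<eta> \<open>n \<noteq> 0\<close> by (auto simp: s_def)
      have "s * norm n \<le> \<eta> / (2 * norm n) * norm n" by (rule mult_right_mono) (auto simp: s_def)
      then have "s * norm n < \<eta>" using \<eta> \<open>n \<noteq> 0\<close> by simp
      then have "dist (z + s *\<^sub>R n) z < \<eta>" using s by (simp add: dist_norm)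
      moreover have "z + s *\<^sub>R n \<in> ?O" using inP[of z s] s PO \<tau> by auto
      ultimately show "\<exists>y\<in>?O. dist y z < \<eta>" by blast
    qed
  qed
  then have "closure (open_segment w t) \<subseteq> closure ?O" by (rule closure_minimal) simp
  moreover have "closure (open_segment w t) = closed_segment w t" using wt by simp
  ultimately have "closed_segment w t \<subseteq> closure ?O" by simp
  moreover have "closed_segment w t \<inter> ?O = {}" using UM outside_no_overlap[of "\<Union>M"] by blast
  moreover have "interior ?O \<subseteq> ?O" by (rule interior_subset)
  ultimately have "closed_segment w t \<subseteq> frontier ?O" unfolding frontier_def by blast
  then show ?thesis using e by (simp add: outer_edges_def segment_convex_hull)
qed

lemma polygonal_arc:
  assumes "distinct xs" "2 \<le> length xs" "path_edges xs \<subseteq> E"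
  shows "\<exists>g. arc g \<and> pathstart g = hd xs \<and> pathfinish g = last xs \<and> path_image g = (\<Union>e\<in>path_edges xs. convex hull e)"
  using assms
proof (induction xs rule: path_edges.induct)
  case (1 a b xs)
  have ab: "{a, b} \<in> E" "a \<noteq> b" using 1 by auto
  show ?case
  proof (cases "xs = []")
    case True
    then show ?thesis using ab by (intro exI[of _ "linepath a b"]) (simp add: segment_convex_hull)
  next
    case False
    then have "2 \<le> length (b # xs)" by (cases xs) auto
    then obtain g where g: "arc g" "pathstart g = b" "pathfinish g = last (b # xs)"
      "path_image g = (\<Union>e\<in>path_edges (b # xs). convex hull e)" using 1 by auto
    have "path_image (linepath a b) \<inter> path_image g \<subseteq> {b}"
    proof
      fix z assume "z \<in> path_image (linepath a b) \<inter> path_image g"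
      then obtain e where z: "z \<in> convex hull {a, b}" "e \<in> path_edges (b # xs)" "z \<in> convex hull e"
        using g(4) by (auto simp: segment_convex_hull)
      have a: "a \<notin> e" using path_edges_subset[OF z(2)] 1 by auto
      then have "z \<in> {a, b} \<inter> e" using edges_meet_in_verts[OF ab(1), of e z] z 1 by auto
      then show "z \<in> {b}" using a by blast
    qed
    then have "arc (linepath a b +++ g)" using g ab by (intro arc_join) auto
    then show ?thesis using g
      by (intro exI[of _ "linepath a b +++ g"]) (auto simp: path_image_join segment_convex_hull)
  qed
qed auto

end

text \<open>Cramer's rule without division: it expands \<open>v\<close> in the directions
  \<open>a\<close> and \<open>b\<close>.\<close>

lemma cross_cross_eq: "cross a v *\<^sub>R b - cross b v *\<^sub>R a = cross a b *\<^sub>R v"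
  by (simp add: complex_eq_iff cross_def algebra_simps)

lemma open_segment_opposite:
  fixes w a b :: complex
  assumes "w \<in> open_segment a b"
  obtains c where "c > 0" "a - w = - c *\<^sub>R (b - w)"
proof -
  obtain \<tau> where \<tau>: "0 < \<tau>" "\<tau> < 1" "w = (1 - \<tau>) *\<^sub>R a + \<tau> *\<^sub>R b" using assms by (auto simp: in_segment)
  have "(1 - \<tau>) *\<^sub>R (a - w) = - \<tau> *\<^sub>R (b - w)" unfolding \<tau>(3) by (simp add: algebra_simps)
  then have "(1 / (1 - \<tau>)) *\<^sub>R ((1 - \<tau>) *\<^sub>R (a - w)) = (1 / (1 - \<tau>)) *\<^sub>R (- \<tau> *\<^sub>R (b - w))" by simp
  then have "a - w = - (\<tau> / (1 - \<tau>)) *\<^sub>R (b - w)" using \<tau> by simp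
  then show ?thesis using that[of "\<tau> / (1 - \<tau>)"] \<tau> by simp
qed

text \<open>Since \<open>a\<close> lies in the triangle, the line through \<open>A\<close> and
  \<open>a\<close> separates \<open>B\<close> from \<open>D\<close>; since \<open>b\<close> lies in
  the hull of \<open>A\<close>, \<open>a\<close> and \<open>D\<close>, it is not on the side of
  \<open>B\<close>. Exchanging the roles gives the other pair of signs for
  \<open>segments_cross\<close>.\<close>

lemma chords_cross:
  fixes A B D a b :: complex
  assumes hull: "a \<in> convex hull {A, B, D}" "b \<in> convex hull {A, B, D}"
    and ne: "cross (a - A) (B - A) \<noteq> 0" "cross (a - A) (D - A) \<noteq> 0" "cross (b - B) (A - B) \<noteq> 0" "cross (b - B) (D - B) \<noteq> 0"
    and sub: "b \<in> convex hull {A, a, D}" "a \<in> convex hull {B, b, D}"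
  shows "closed_segment A a \<inter> closed_segment B b \<noteq> {}"
proof -
  have sep: "cross (x - P) (Q - P) * cross (x - P) (y - P) \<le> 0"
    if x: "x \<in> convex hull {P, Q, R}" and y: "y \<in> convex hull {P, x, R}" for P Q R x y
  proof -
    obtain u v w where uvw: "x = u *\<^sub>R P + v *\<^sub>R Q + w *\<^sub>R R" "0 \<le> u" "0 \<le> v" "0 \<le> w" "u + v + w = 1"
      using x unfolding convex_hull_3 by blast
    have u: "u = 1 - v - w" using uvw by simp
    have xP: "x - P = v *\<^sub>R (Q - P) + w *\<^sub>R (R - P)" unfolding uvw(1) u by (simp add: algebra_simps)
    obtain u' v' w' where uvw': "y = u' *\<^sub>R P + v' *\<^sub>R x + w' *\<^sub>R R" "0 \<le> u'" "0 \<le> v'" "0 \<le> w'" "u' + v' + w' = 1"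
      using y unfolding convex_hull_3 by blast
    have u': "u' = 1 - v' - w'" using uvw' by simp
    have yP: "y - P = v' *\<^sub>R (x - P) + w' *\<^sub>R (R - P)" unfolding uvw'(1) u' by (simp add: algebra_simps)
    define k where "k = cross (Q - P) (R - P)"
    have k': "cross (R - P) (Q - P) = - k" by (simp add: k_def cross_commute[of "R - P"])
    have 1: "cross (x - P) (Q - P) = - w * k" unfolding xP cross_linear(3) cross_simps k' by simp
    have 2: "cross (x - P) (R - P) = v * k" unfolding xP cross_linear(3) cross_simps k_def by simp
    have 3: "cross (x - P) (y - P) = w' * (v * k)" unfolding yP cross_linear(1) cross_simps 2 by simp
    have "cross (x - P) (Q - P) * cross (x - P) (y - P) = - (w * w' * v * (k * k))" unfolding 1 3 by simp
    moreover have "w * w' * v * (k * k) \<ge> 0" using uvw uvw' by simp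
    ultimately show ?thesis by linarith
  qed
  have "b \<in> convex hull {B, A, D}" using hull(2) by (simp add: insert_commute)
  from segments_cross[OF ne(1) sep[OF hull(1) sub(1)] ne(3) sep[OF this sub(2)]] show ?thesis .
qed

context segment_halin
begin

text \<open>The outer face meets a leaf \<open>w\<close> only in the sector between its two cycle edges, as otherwise it would
  run along the tree edge at \<open>w\<close>. At an extreme point of the closed curve \<open>c\<close> this sector is inside \<open>c\<close>.\<close>

lemma reflex_leaf_not_extreme:
  assumes w: "{w, t} \<in> T" "{w, u1} \<in> C" "{w, u2} \<in> C" "u1 \<noteq> u2"
    and nb: "{e \<in> seg_edges M. w \<in> e} = {{w, t}, {w, u1}, {w, u2}}"
    and opp: "w \<in> open_segment t u2"
    and c: "simple_path c" "pathfinish c = pathstart c"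
    and Q: "path_image c = drawing D \<union> closed_segment p q" "D \<subseteq> C" "{w, u1} \<in> D" "{w, u2} \<in> D"
      "w \<notin> closed_segment p q" "closed_segment p q \<subseteq> \<Union>M"
    and ext: "w extreme_point_of (convex hull path_image c)"
  shows False
proof -
  let ?Q = "path_image c"
  define d1 d2 where "d1 = u1 - w" and "d2 = u2 - w"
  have eE: "{w, t} \<in> seg_edges M" "{w, u1} \<in> seg_edges M" "{w, u2} \<in> seg_edges M" using w T_subset C_subset by auto
  have ne: "t \<noteq> w" "u1 \<noteq> w" "u2 \<noteq> w" using eE edgeD(1) by blast+
  have tu: "t \<noteq> u1" using w T_C_disjoint by blast
  obtain c0 where c0: "c0 > 0" "t - w = - c0 *\<^sub>R d2" using open_segment_opposite[OF opp] unfolding d2_def by metis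
  define \<kappa> where "\<kappa> = cross d2 d1"
  have \<kappa>: "\<kappa> \<noteq> 0"
  proof
    assume "\<kappa> = 0"
    then obtain \<sigma> where \<sigma>: "d1 = \<sigma> *\<^sub>R d2" using cross_eq_0_imp_scaleR[of d2 d1] ne by (auto simp: \<kappa>_def d2_def)
    have "\<sigma> \<noteq> 0" using \<sigma> ne by (auto simp: d1_def)
    then consider "\<sigma> > 0" | "\<sigma> < 0" by linarith
    then show False
    proof cases
      case 1
      then show False using edges_not_same_direction[OF eE(2,3), of \<sigma>] \<sigma> w(4) by (simp add: d1_def d2_def)
    next
      case 2
      have "u1 - w = (- \<sigma> / c0) *\<^sub>R (t - w)" using \<sigma> c0 by (simp add: d1_def)
      moreover have "- \<sigma> / c0 > 0" using divide_neg_pos[OF 2 c0(1)] by simp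
      ultimately show False using edges_not_same_direction[OF eE(2,1)] tu by blast
    qed
  qed
  \<comment> \<open>The coordinates at \<open>w\<close> along \<open>u1 - w\<close> and
    \<open>u2 - w\<close>. The edges to \<open>u1\<close> and \<open>u2\<close> leave along the
    positive axes, and the edge to \<open>t\<close> along the negative second axis.\<close>
  define \<alpha> \<beta> where "\<alpha> x = cross ((1 / \<kappa>) *\<^sub>R d2) (x - w)" and "\<beta> x = cross ((- 1 / \<kappa>) *\<^sub>R d1) (x - w)" for x
  have coord: "x = w + \<alpha> x *\<^sub>R d1 + \<beta> x *\<^sub>R d2" for x
  proof -
    have "\<kappa> *\<^sub>R (x - w) = cross d2 (x - w) *\<^sub>R d1 - cross d1 (x - w) *\<^sub>R d2" by (simp add: cross_cross_eq \<kappa>_def)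
    then have "(1 / \<kappa>) *\<^sub>R (\<kappa> *\<^sub>R (x - w)) = (1 / \<kappa>) *\<^sub>R (cross d2 (x - w) *\<^sub>R d1 - cross d1 (x - w) *\<^sub>R d2)" by simp
    then have "x - w = \<alpha> x *\<^sub>R d1 + \<beta> x *\<^sub>R d2" using \<kappa> by (simp add: \<alpha>_def \<beta>_def scaleR_diff_right)
    then show ?thesis by (simp add: algebra_simps)
  qed
  have cd: "cross d1 d2 = - \<kappa>" by (simp add: \<kappa>_def cross_commute[of d1])
  have ab: "\<alpha> (w + a *\<^sub>R d1 + b *\<^sub>R d2) = a" "\<beta> (w + a *\<^sub>R d1 + b *\<^sub>R d2) = b" for a b
    using \<kappa> cd by (simp_all add: \<alpha>_def \<beta>_def cross_linear \<kappa>_def[symmetric] add.assoc)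
  have seg1: "\<alpha> x \<ge> 0 \<and> \<beta> x = 0" if x: "x \<in> closed_segment w u1" for x
  proof -
    obtain a where "x = w + a *\<^sub>R d1 + 0 *\<^sub>R d2" "0 \<le> a" using x by (auto simp: closed_segment_def d1_def algebra_simps)
    then show ?thesis using ab[of a 0] by simp
  qed
  have seg2: "\<alpha> x = 0 \<and> \<beta> x \<ge> 0" if x: "x \<in> closed_segment w u2" for x
  proof -
    obtain a where "x = w + 0 *\<^sub>R d1 + a *\<^sub>R d2" "0 \<le> a" using x by (auto simp: closed_segment_def d2_def algebra_simps)
    then show ?thesis using ab[of 0 a] by simp
  qed
  have segt: "\<alpha> x = 0 \<and> \<beta> x \<le> 0" if x: "x \<in> closed_segment w t" for x
  proof -
    obtain a where a: "x = (1 - a) *\<^sub>R w + a *\<^sub>R t" "0 \<le> a" using x by (auto simp: closed_segment_def)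
    have "x = w + a *\<^sub>R (t - w)" unfolding a(1) by (simp add: algebra_simps)
    then have "x = w + 0 *\<^sub>R d1 + (- a * c0) *\<^sub>R d2" using c0(2) by simp
    then have "\<alpha> x = 0" "\<beta> x = - a * c0" using ab[of 0 "- a * c0"] by simp_all
    then show ?thesis using a(2) c0(1) by simp
  qed
  define Z where "Z = drawing {e \<in> seg_edges M. w \<notin> e} \<union> closed_segment p q"
  have "closed Z" unfolding Z_def using closed_edges[of "{e \<in> seg_edges M. w \<notin> e}"] by (intro closed_Un) auto
  have "w \<notin> Z"
  proof
    assume "w \<in> Z"
    then obtain e where e: "e \<in> seg_edges M" "w \<notin> e" "w \<in> convex hull e" using Q(5) by (auto simp: Z_def)
    then have "w \<in> e \<inter> {w, t}" by (intro edges_meet_in_verts) (use eE in \<open>auto intro: hull_inc\<close>)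
    then show False using e by blast
  qed
  then obtain r1 where r1: "r1 > 0" "ball w r1 \<inter> Z = {}"
    using \<open>closed Z\<close> by (metis Compl_iff open_Compl open_contains_ball disjoint_eq_subset_Compl)
  \<comment> \<open>Within radius \<open>r\<close> only edges at \<open>w\<close> are met, and the
    positive half axes are covered by the cycle edges.\<close>
  define r where "r = min r1 (min (norm d1) (norm d2))"
  have r: "r > 0" "r \<le> r1" "r \<le> norm d1" "r \<le> norm d2" using r1 ne by (auto simp: r_def d1_def d2_def)
  let ?B = "ball w r" and ?O = "outside (\<Union>M)"
  have BZ: "?B \<inter> Z = {}" using r r1 by (metis disjoint_iff mem_ball order_less_le_trans)
  have BM: "x \<in> closed_segment w t \<union> closed_segment w u1 \<union> closed_segment w u2" if xB: "x \<in> ?B" and xM: "x \<in> \<Union>M" for x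
  proof -
    obtain e where e: "e \<in> seg_edges M" "x \<in> convex hull e" using xM Union_edges by blast
    have "w \<in> e"
    proof (rule ccontr)
      assume "w \<notin> e"
      then have "x \<in> Z" unfolding Z_def using e by blast
      then show False using BZ xB by blast
    qed
    then have "e \<in> {{w, t}, {w, u1}, {w, u2}}" using e nb by blast
    then show ?thesis using e by (auto simp: segment_convex_hull)
  qed
  have BQ: "x \<in> closed_segment w u1 \<union> closed_segment w u2" if xB: "x \<in> ?B" and xQ: "x \<in> ?Q" for x
  proof -
    have "x \<notin> closed_segment p q" using BZ xB unfolding Z_def by blast
    then obtain e where e: "e \<in> D" "x \<in> convex hull e" using xQ Q(1) by blast
    then have eC: "e \<in> C" "e \<in> seg_edges M" using Q(2) C_subset by auto
    have "w \<in> e"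
    proof (rule ccontr)
      assume "w \<notin> e"
      then have "x \<in> Z" unfolding Z_def using e eC by blast
      then show False using BZ xB by blast
    qed
    then have "e \<in> {{w, t}, {w, u1}, {w, u2}}" using eC nb by blast
    moreover have "e \<noteq> {w, t}" using eC w(1) T_C_disjoint by blast
    ultimately show ?thesis using e by (auto simp: segment_convex_hull)
  qed
  have on2: "x \<in> closed_segment w u2" if "x \<in> ?B" "\<alpha> x = 0" "\<beta> x \<ge> 0" for x
  proof -
    have x: "x = w + \<beta> x *\<^sub>R d2" using coord[of x] that by simp
    then have "dist w x = \<beta> x * norm d2" using that(3) by (metis abs_of_nonneg add_diff_cancel_left' dist_commute dist_norm norm_scaleR)
    then have "\<beta> x * norm d2 < norm d2" using that(1) r by simp
    moreover have "norm d2 > 0" using ne by (simp add: d2_def)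
    ultimately have "\<beta> x < 1" by simp
    moreover have "x = (1 - \<beta> x) *\<^sub>R w + \<beta> x *\<^sub>R u2" using x by (simp add: d2_def algebra_simps)
    ultimately show ?thesis using that(3) unfolding closed_segment_def by (smt (verit) mem_Collect_eq)
  qed
  have on1: "x \<in> closed_segment w u1" if "x \<in> ?B" "\<beta> x = 0" "\<alpha> x \<ge> 0" for x
  proof -
    have x: "x = w + \<alpha> x *\<^sub>R d1" using coord[of x] that by simp
    then have "dist w x = \<alpha> x * norm d1" using that(3) by (metis abs_of_nonneg add_diff_cancel_left' dist_commute dist_norm norm_scaleR)
    then have "\<alpha> x * norm d1 < norm d1" using that(1) r by simp
    moreover have "norm d1 > 0" using ne by (simp add: d1_def)
    ultimately have "\<alpha> x < 1" by simp
    moreover have "x = (1 - \<alpha> x) *\<^sub>R w + \<alpha> x *\<^sub>R u1" using x by (simp add: d1_def algebra_simps)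
    ultimately show ?thesis using that(3) unfolding closed_segment_def by (smt (verit) mem_Collect_eq)
  qed
  have wQ: "closed_segment w u1 \<subseteq> ?Q" "closed_segment w u2 \<subseteq> ?Q"
    unfolding Q(1) using Q(3,4) by (auto simp: segment_convex_hull)
  then have inQ: "w \<in> ?Q" "u1 \<in> ?Q" "u2 \<in> ?Q" by auto
  have QM: "?Q \<subseteq> \<Union>M" using Q edge_subset_Union C_subset by blast
  have cvx: "convex {x. \<alpha> x > 0}" "convex {x. \<alpha> x < 0}" "convex {x. \<beta> x > 0}" "convex {x. \<beta> x < 0}"
    unfolding \<alpha>_def \<beta>_def by (rule convex_cross_gt convex_cross_lt)+
  \<comment> \<open>The open half disc across the line through \<open>t\<close> and
    \<open>u2\<close>. Being free of the drawing, it would belong to the outer face as a whole once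
    it meets it, and then the edge to \<open>t\<close> would be an outer edge.\<close>
  define H where "H = ?B \<inter> {x. \<alpha> x < 0}"
  have HO: "H \<inter> ?O = {}"
  proof (rule ccontr)
    assume "H \<inter> ?O \<noteq> {}"
    then obtain y where y: "y \<in> H" "y \<in> ?O" by blast
    have "connected H" unfolding H_def by (intro convex_connected convex_Int convex_ball cvx)
    moreover have "H \<inter> \<Union>M = {}" using BM seg1 seg2 segt unfolding H_def by fastforce
    ultimately have "H \<subseteq> ?O" using y by (rule connected_subset_outside)
    have "{w, t} \<in> outer_edges M"
    proof (rule half_ball_edge_outer[OF eE(1) r(1), of "1 / (c0 * \<kappa>)"])
      show "1 / (c0 * \<kappa>) \<noteq> 0" using c0 \<kappa> by simp
      fix x assume x: "x \<in> ?B" "0 < 1 / (c0 * \<kappa>) * cross (t - w) (x - w)"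
      have "1 / (c0 * \<kappa>) * cross (t - w) (x - w) = - \<alpha> x" using c0 \<kappa> unfolding c0(2) \<alpha>_def cross_simps by simp
      then show "x \<in> ?O" using x \<open>H \<subseteq> ?O\<close> by (auto simp: H_def)
    qed
    then show False using outer w(1) T_C_disjoint by blast
  qed
  \<comment> \<open>The sector between the cycle edges. The edge to \<open>u2\<close> borders the
    outer face, and since \<open>H\<close> is excluded, the outer face must touch it from this
    side.\<close>
  define S where "S = ?B \<inter> ({x. \<alpha> x > 0} \<inter> {x. \<beta> x > 0})"
  have conS: "connected S" unfolding S_def by (intro convex_connected convex_Int convex_ball cvx)
  have SQ: "S \<inter> ?Q = {}" using BQ seg1 seg2 unfolding S_def by fastforce
  have SO: "S \<subseteq> outside ?Q"
  proof -
    have "closed_segment w u2 \<subseteq> frontier ?O" using w(3) outer by (auto simp: outer_edges_def segment_convex_hull)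
    moreover define \<eta> where "\<eta> = r / (2 * norm d2)"
    have nd2: "norm d2 > 0" using ne by (simp add: d2_def)
    have \<eta>: "0 < \<eta>" "\<eta> * norm d2 < r" "\<eta> \<le> 1" using r nd2 by (auto simp: \<eta>_def field_simps)
    define x0 where "x0 = w + 0 *\<^sub>R d1 + \<eta> *\<^sub>R d2"
    have x0B: "x0 \<in> ?B" using \<eta> by (simp add: x0_def dist_norm)
    have x0: "\<alpha> x0 = 0" "\<beta> x0 = \<eta>" unfolding x0_def ab by auto
    have "x0 \<in> closed_segment w u2" using on2 x0B x0 \<eta> by simp
    ultimately have "x0 \<in> closure ?O" by (auto simp: frontier_def)
    moreover have "open (?B \<inter> {x. \<beta> x > 0})"
    proof -
      have "continuous_on UNIV \<beta>" unfolding \<beta>_def cross_def by (intro continuous_intros)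
      then have "open {x. \<beta> x > 0}" by (simp add: open_Collect_less continuous_on_const)
      then show ?thesis by blast
    qed
    moreover have "x0 \<in> ?B \<inter> {x. \<beta> x > 0}" using x0B x0 \<eta> by simp
    ultimately have "(?B \<inter> {x. \<beta> x > 0}) \<inter> ?O \<noteq> {}" using open_Int_closure_eq_empty by blast
    then obtain y where y: "y \<in> ?O" "y \<in> ?B" "\<beta> y > 0" by blast
    have "y \<notin> \<Union>M" using y(1) outside_no_overlap by blast
    then have "y \<notin> closed_segment w u2" using edge_subset_Union[OF eE(3)] by (auto simp: segment_convex_hull)
    then have "\<alpha> y \<noteq> 0" using on2 y by fastforce
    moreover have "\<not> \<alpha> y < 0" using HO y by (auto simp: H_def)
    ultimately have "y \<in> S" using y by (simp add: S_def)
    moreover have "y \<in> outside ?Q" using y(1) outside_mono[OF QM] by blast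
    ultimately show ?thesis using connected_subset_outside[OF conS SQ] by blast
  qed
  \<comment> \<open>The disc without the closed sector. It is outside the curve because it contains
    \<open>p0\<close>, the reflection at \<open>w\<close> of a hull point \<open>p1\<close>: with
    \<open>p0\<close> also in the hull, \<open>w\<close> would not be extreme.\<close>
  define R where "R = (?B \<inter> {x. \<alpha> x < 0}) \<union> (?B \<inter> {x. \<beta> x < 0})"
  have RO: "R \<subseteq> outside ?Q"
  proof -
    define \<epsilon> where "\<epsilon> = min (1/2) (r / (4 * (norm d1 + norm d2)))"
    have nd: "norm d1 + norm d2 > 0" using ne by (simp add: d1_def d2_def add_pos_pos)
    have \<epsilon>: "0 < \<epsilon>" "\<epsilon> \<le> 1/2" "\<epsilon> * (norm d1 + norm d2) < r"
    proof -
      show "0 < \<epsilon>" "\<epsilon> \<le> 1/2" using r nd by (auto simp: \<epsilon>_def)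
      have "\<epsilon> * (norm d1 + norm d2) \<le> r / (4 * (norm d1 + norm d2)) * (norm d1 + norm d2)"
        using nd by (intro mult_right_mono) (auto simp: \<epsilon>_def)
      also have "\<dots> = r / 4" using nd by (simp add: field_simps)
      finally show "\<epsilon> * (norm d1 + norm d2) < r" using r by simp
    qed
    define p0 where "p0 = w + (- \<epsilon>) *\<^sub>R d1 + (- \<epsilon>) *\<^sub>R d2"
    have p0: "\<alpha> p0 = - \<epsilon>" "\<beta> p0 = - \<epsilon>" unfolding p0_def ab by auto
    have "dist w p0 = norm (\<epsilon> *\<^sub>R d1 + \<epsilon> *\<^sub>R d2)" unfolding p0_def dist_norm by (simp add: algebra_simps)
    also have "\<dots> \<le> \<epsilon> * norm d1 + \<epsilon> * norm d2" using \<epsilon>(1) by (metis abs_of_pos norm_scaleR norm_triangle_ineq)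
    also have "\<dots> < r" using \<epsilon>(3) by (simp add: algebra_simps)
    finally have p0B: "p0 \<in> ?B" by simp
    have "R \<inter> ?Q = {}" using BQ seg1 seg2 unfolding R_def by fastforce
    moreover have "connected R" unfolding R_def
    proof (rule connected_Un)
      show "connected (?B \<inter> {x. \<alpha> x < 0})" "connected (?B \<inter> {x. \<beta> x < 0})"
        by (intro convex_connected convex_Int convex_ball cvx)+
      show "?B \<inter> {x. \<alpha> x < 0} \<inter> (?B \<inter> {x. \<beta> x < 0}) \<noteq> {}" using p0 p0B \<epsilon>(1) by fastforce
    qed
    moreover have "p0 \<in> R" using p0 p0B \<epsilon> by (simp add: R_def)
    moreover have "p0 \<notin> convex hull ?Q"
    proof
      assume p0h: "p0 \<in> convex hull ?Q"
      define p1 where "p1 = w + \<epsilon> *\<^sub>R d1 + \<epsilon> *\<^sub>R d2"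
      have "p1 = (1 - 2 * \<epsilon>) *\<^sub>R w + \<epsilon> *\<^sub>R u1 + \<epsilon> *\<^sub>R u2" by (simp add: p1_def d1_def d2_def complex_eq_iff algebra_simps)
      then have "p1 \<in> convex hull {w, u1, u2}" unfolding convex_hull_3 using \<epsilon>
        by (rule_tac CollectI, rule_tac exI[of _ "1 - 2 * \<epsilon>"], rule_tac exI[of _ \<epsilon>], rule_tac exI[of _ \<epsilon>]) simp
      then have "p1 \<in> convex hull ?Q" using inQ hull_mono[of "{w, u1, u2}" ?Q convex] by blast
      moreover have "w \<in> open_segment p0 p1"
      proof -
        have "w = midpoint p0 p1" by (simp add: midpoint_def p0_def p1_def complex_eq_iff)
        moreover have "p0 \<noteq> p1" using p0(1) ab(1)[of \<epsilon> \<epsilon>] \<epsilon>(1) by (auto simp: p1_def)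
        ultimately show ?thesis by simp
      qed
      ultimately show False using ext p0h by (auto simp: extreme_point_of_def)
    qed
    then have "p0 \<in> outside ?Q" using outside_subset_convex[OF convex_convex_hull hull_subset] by blast
    ultimately show ?thesis using connected_subset_outside by blast
  qed
  \<comment> \<open>Every point near \<open>w\<close> is now outside the curve or on it, while
    \<open>w\<close> is a limit of inside points.\<close>
  have "w \<in> frontier (inside ?Q)" using Jordan_inside_outside[OF c] inQ(1) by simp
  then have "w \<in> closure (inside ?Q)" by (simp add: frontier_def)
  then obtain z where z: "z \<in> inside ?Q" "z \<in> ?B" using r(1) by (auto simp: closure_approachable dist_commute)
  have "z \<notin> outside ?Q" "z \<notin> ?Q" using z(1) inside_Int_outside[of ?Q] inside_no_overlap[of ?Q] by blast+
  then have "z \<notin> S" "z \<notin> R" using SO RO by blast+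
  then have "\<alpha> z \<ge> 0" "\<beta> z \<ge> 0" "\<not> (\<alpha> z > 0 \<and> \<beta> z > 0)" using z(2) unfolding S_def R_def by auto
  then consider "\<alpha> z = 0" "\<beta> z \<ge> 0" | "\<beta> z = 0" "\<alpha> z \<ge> 0" by linarith
  then show False using on1[OF z(2)] on2[OF z(2)] \<open>z \<notin> ?Q\<close> wQ by cases blast+
qed

end

section \<open>The case of equality\<close>

text \<open>The direction in which the list runs is not known, so the two corners after
  \<open>A\<close> may appear in either order.\<close>

lemma cyclic_order_three:
  assumes "distinct ls" "A \<in> set ls" "B \<in> set ls" "D \<in> set ls" "A \<noteq> B" "A \<noteq> D" "B \<noteq> D"
  obtains ys zs ws B' D' where "{B', D'} = {B, D}" "distinct (A # ys @ B' # zs @ D' # ws)"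
    "set (A # ys @ B' # zs @ D' # ws) = set ls" "cycle_edges (A # ys @ B' # zs @ D' # ws) = cycle_edges ls"
proof -
  obtain xs1 xs2 where x: "ls = xs1 @ A # xs2" using assms(2) by (meson split_list)
  let ?r = "xs2 @ xs1"
  have r: "B \<in> set ?r" "D \<in> set ?r" "distinct (A # ?r)" "set (A # ?r) = set ls" "cycle_edges (A # ?r) = cycle_edges ls"
    using assms x cycle_edges_swap[of "A # xs2" xs1] by auto
  obtain ys r2 where y: "?r = ys @ B # r2" using r(1) by (meson split_list)
  then have "D \<in> set ys \<or> D \<in> set r2" using r(2) assms(7) by auto
  then show ?thesis
  proof
    assume "D \<in> set r2"
    then obtain zs ws where "r2 = zs @ D # ws" by (meson split_list)
    then show ?thesis using that[of B D ys zs ws] r y by simp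
  next
    assume "D \<in> set ys"
    then obtain y1 y2 where "ys = y1 @ D # y2" by (meson split_list)
    then show ?thesis using that[of D B y1 y2 r2] r y by (simp add: insert_commute)
  qed
qed

lemma path_edges_subset_cycle_edges: "path_edges xs \<subseteq> cycle_edges xs"
  by (cases "xs = []") (auto simp: cycle_edges_eq)

lemma path_edges_infix: "path_edges xs \<subseteq> path_edges (us @ xs @ vs)"
  by (auto simp: path_edges_append)

lemma interior_convex_hull_pair:
  "interior (convex hull {a, b}) = {}" for a b :: complex
  by (rule empty_interior_convex_hull) (auto simp: card_insert_if)

text \<open>The assumption negates the bound to be proved; the locale exists to be refuted.\<close>

locale extremal_halin = segment_halin +
  assumes tight: "3 * card M \<le> card V + 10"
begin

lemmas eq_case = equality_case[OF tight]

lemma plain_leaf: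
  assumes "v \<in> set ls" "v \<notin> hull_corners" shows "end_count M v = 1" "seg_count M v = 2"
proof -
  have v: "v \<in> V" using assms leaves_subset by blast
  show "end_count M v = 1" using eq_case(2)[OF v] assms leaf_degree by (simp add: min_ends_def)
  then show "seg_count M v = 2" using vdegree_plus_end_count[OF v] leaf_degree assms by simp
qed

lemma inner_vert:
  assumes "v \<in> inner_verts" shows "end_count M v = 0" "seg_count M v = 2"
proof -
  have v: "v \<in> V" "v \<notin> hull_corners" using assms eq_case(4) by auto
  show "end_count M v = 0" using eq_case(2)[OF v(1)] v eq_case(3)[OF assms] by (simp add: min_ends_def)
  then show "seg_count M v = 2" using vdegree_plus_end_count[OF v(1)] eq_case(3)[OF assms] by simp
qed

text \<open>Two segments contain \<open>w\<close> but only one ends there. The other passes through,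
  and its nearest vertices on both sides give opposite edges.\<close>

lemma plain_leaf_straight:
  assumes "w \<in> set ls" "w \<notin> hull_corners"
  obtains a b where "{w, a} \<in> seg_edges M" "{w, b} \<in> seg_edges M" "w \<in> open_segment a b"
proof -
  have w: "w \<in> V" using assms leaves_subset by blast
  have sub: "{s \<in> M. w \<in> seg_ends s} \<subseteq> {s \<in> M. w \<in> s}" using seg_ends_card(4) by blast
  have "card {s \<in> M. w \<in> seg_ends s} < card {s \<in> M. w \<in> s}"
    using plain_leaf[OF assms] unfolding end_count_def seg_count_def by simp
  then have "{s \<in> M. w \<in> seg_ends s} \<noteq> {s \<in> M. w \<in> s}" by (metis less_irrefl)
  then obtain s where s: "s \<in> M" "w \<in> s" "w \<notin> seg_ends s" using sub by blast
  obtain p q where pq: "p \<noteq> q" "s = closed_segment p q" "p \<in> V" "q \<in> V" using segE[OF s(1)] .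
  have wpq: "w \<noteq> p" "w \<noteq> q" using s pq by auto
  obtain a where a: "{w, a} \<in> seg_edges M" "a \<in> closed_segment w p" using nearest_vert[OF w pq(3) wpq(1) s(1,2)] pq by auto
  obtain b where b: "{w, b} \<in> seg_edges M" "b \<in> closed_segment w q" using nearest_vert[OF w pq(4) wpq(2) s(1,2)] pq by auto
  define f where "f = line_coord p q"
  note f = line_coord_01[of p q, folded f_def] line_coord[OF pq(1), folded f_def]
  have par: "\<exists>t. x = f t" if "x \<in> closed_segment p q" for x
    using closed_segment_param[OF that] by (metis f_def line_coord_def)
  obtain \<tau> where \<tau>: "w = f \<tau>" using par s pq by blast
  have "closed_segment w p \<subseteq> closed_segment p q" "closed_segment w q \<subseteq> closed_segment p q"
    using s pq by (simp_all add: subset_closed_segment)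
  then have "a \<in> closed_segment p q" "b \<in> closed_segment p q" using a b by auto
  then obtain \<sigma>1 \<sigma>2 where \<sigma>: "a = f \<sigma>1" "b = f \<sigma>2" using par[of a] par[of b] by blast
  have "f \<tau> \<in> closed_segment (f 0) (f 1)" "f \<sigma>1 \<in> closed_segment (f \<tau>) (f 0)" "f \<sigma>2 \<in> closed_segment (f \<tau>) (f 1)"
    using s(2) a(2) b(2) pq(2) \<sigma> \<tau> unfolding f(1,2) by auto
  moreover have "f \<tau> \<noteq> f \<sigma>1" "f \<tau> \<noteq> f \<sigma>2" using edgeD(1)[OF a(1)] edgeD(1)[OF b(1)] \<sigma> \<tau> by auto
  ultimately have "f \<tau> \<in> open_segment (f \<sigma>1) (f \<sigma>2)" unfolding f(3-5) by argo
  then show ?thesis using that a b \<sigma> \<tau> by simp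
qed

text \<open>Meant is the piece, up to the first leaf, of the segment that enters the interior at a
  corner \<open>A\<close>. As it meets the cycle only at its ends, it closes a chain of cycle edges
  to a simple curve.\<close>

definition chord :: "complex \<Rightarrow> complex \<Rightarrow> bool" where
  "chord A a \<longleftrightarrow> a \<in> set ls \<and> a \<noteq> A \<and> (\<exists>s\<in>M. closed_segment A a \<subseteq> s) \<and> closed_segment A a \<subseteq> drawing T \<and>
     (\<forall>e\<in>C. closed_segment A a \<inter> convex hull e \<subseteq> {A, a})"

lemma leaf_on_chord:
  assumes "chord A a" "z \<in> set ls" "z \<in> closed_segment A a" shows "z = A \<or> z = a"
proof -
  obtain t u w where "{z, u} \<in> C" using leaf_nbrs[OF assms(2)] by metis
  then have "closed_segment A a \<inter> convex hull {z, u} \<subseteq> {A, a}" using assms(1) by (auto simp: chord_def)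
  then show ?thesis using assms(3) by (auto intro: hull_inc)
qed

text \<open>The segment along the tree edge at \<open>A\<close> starts at \<open>A\<close>, since
  all segments at a hull corner end there; its other end is a leaf, since no segment ends at an
  inner vertex. The first leaf after \<open>A\<close> serves as \<open>a\<close>.\<close>

lemma corner_has_chord:
  assumes A: "A \<in> hull_corners" obtains a where "chord A a"
proof -
  have Als: "A \<in> set ls" using A eq_case(4) by blast
  then have AV: "A \<in> V" using leaves_subset by blast
  obtain t where t: "{A, t} \<in> T" "t \<notin> set ls" using leaf_nbrs[OF Als] by metis
  then have tE: "{A, t} \<in> seg_edges M" using T_subset by blast
  obtain s where s: "s \<in> M" "A \<in> s" "t \<in> s" using edgeD(5)[OF tE] by blast
  have "end_count M A = seg_count M A"
    using vdegree_plus_end_count[OF AV] hull_corner_end_count[OF A] by simp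
  then have "{s \<in> M. A \<in> seg_ends s} = {s \<in> M. A \<in> s}"
    unfolding end_count_def seg_count_def using seg_ends_card(4) finite_M by (intro card_subset_eq) auto
  then have "A \<in> seg_ends s" using s by blast
  moreover obtain p q where pq: "p \<noteq> q" "s = closed_segment p q" "p \<in> V" "q \<in> V" using segE[OF s(1)] .
  ultimately have "A = p \<or> A = q" by simp
  then obtain b where b: "b \<noteq> A" "s = closed_segment A b" "b \<in> V"
  proof
    assume "A = p" then show ?thesis using that[of q] pq by simp
  next
    assume "A = q" then show ?thesis using that[of p] pq by (simp add: closed_segment_commute)
  qed
  have "b \<in> set ls"
  proof (rule ccontr)
    assume "b \<notin> set ls"
    then have "end_count M b = 0" using inner_vert(1) b by blast
    moreover have "s \<in> {s \<in> M. b \<in> seg_ends s}" using b s by simp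
    ultimately show False unfolding end_count_def using finite_M by (auto simp: card_eq_0_iff)
  qed
  then have "set ls \<inter> s - {A} \<noteq> {}" using b by auto
  then obtain a where a: "a \<in> set ls \<inter> s - {A}" "\<And>y. y \<in> set ls \<inter> s - {A} \<Longrightarrow> dist A a \<le> dist A y"
    using ex_min_on_finite[of "set ls \<inter> s - {A}" "dist A"] by blast
  have sub: "closed_segment A a \<subseteq> s" using a s convex_seg by (simp add: closed_segment_subset)
  have leaf: "z \<in> {A, a}" if z: "z \<in> set ls" "z \<in> closed_segment A a" for z
  proof (rule ccontr)
    assume n: "z \<notin> {A, a}"
    then have "z \<in> open_segment A a" using z by (auto simp: open_segment_def)
    then have "dist A z < dist A a" using dist_in_open_segment by (metis dist_commute)
    moreover have "z \<in> set ls \<inter> s - {A}" using z n sub by blast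
    ultimately show False using a(2) by fastforce
  qed
  \<comment> \<open>An edge to \<open>a\<close> would leave \<open>A\<close> in the direction of the
    tree edge to \<open>t\<close> and hence equal it, but \<open>t\<close> is no leaf.\<close>
  have AaE: "{A, a} \<notin> seg_edges M"
  proof
    assume e: "{A, a} \<in> seg_edges M"
    have "a \<in> closed_segment A b" "t \<in> closed_segment A b" using a s b by auto
    then obtain x y where xy: "a = A + x *\<^sub>R (b - A)" "t = A + y *\<^sub>R (b - A)" using closed_segment_param by metis
    define f where "f = line_coord A b"
    note f = line_coord_01[of A b, folded f_def] line_coord[OF b(1)[symmetric], folded f_def]
    have xy': "a = f x" "t = f y" using xy by (auto simp: f_def line_coord_def)
    have "f x \<in> closed_segment (f 0) (f 1)" "f y \<in> closed_segment (f 0) (f 1)" "f x \<noteq> f 0" "f y \<noteq> f 0"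
      using \<open>a \<in> closed_segment A b\<close> \<open>t \<in> closed_segment A b\<close> edgeD(1)[OF e] edgeD(1)[OF tE] xy' unfolding f(1,2) by auto
    then have "x > 0" "y > 0" unfolding f(3,4) by auto
    then have "a - A = (x / y) *\<^sub>R (t - A)" "x / y > 0" using xy by auto
    then have "a = t" using edges_not_same_direction[OF e tE] by blast
    then show False using a t by blast
  qed
  have dr: "closed_segment A a \<subseteq> drawing T"
  proof
    fix x assume x: "x \<in> closed_segment A a"
    have aV: "a \<in> V" "A \<noteq> a" using a leaves_subset by auto
    obtain e where e: "e \<in> seg_edges M" "x \<in> convex hull e" "e \<subseteq> closed_segment A a"
      using segment_covered[OF AV aV s(1,2) _ x] a by blast
    have "e \<notin> C"
    proof
      assume eC: "e \<in> C"
      then have "e \<subseteq> {A, a}" using C_edge leaf e(3) by blast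
      then have "e = {A, a}" using card_edge[OF e(1)] aV by (metis card_2_iff card_subset_eq finite.emptyI finite.insertI card_insert_if card.empty card_gt_0_iff insert_absorb singletonD numeral_2_eq_2)
      then show False using AaE e by blast
    qed
    then show "x \<in> drawing T" using e E by blast
  qed
  have "closed_segment A a \<inter> convex hull e \<subseteq> {A, a}" if e: "e \<in> C" for e
  proof
    fix z assume z: "z \<in> closed_segment A a \<inter> convex hull e"
    then obtain f where f: "f \<in> T" "z \<in> convex hull f" using dr by blast
    then have "z \<in> f \<inter> e" using edges_meet_in_verts[of f e z] T_subset C_subset T_C_disjoint e z by blast
    then have "z \<in> set ls" using C_edge e by blast
    then show "z \<in> {A, a}" using leaf z by blast
  qed
  then have "chord A a" unfolding chord_def using a sub s dr by blast
  then show ?thesis using that by blast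
qed

lemma chord_subset: "chord A a \<Longrightarrow> closed_segment A a \<subseteq> \<Union>M"
  by (auto simp: chord_def)

text \<open>The chain and the segment from \<open>p\<close> to \<open>q\<close> form a Jordan curve,
  and the extreme points of its hull are vertices of the chain. One other than \<open>p\<close>,
  \<open>q\<close> and the hull corners is excluded by the straight segment through it. The inside
  of the curve is a nonempty open subset of the hull.\<close>

lemma chain_hull:
  assumes ch: "closed_segment p q \<subseteq> \<Union>M" "\<forall>e\<in>C. closed_segment p q \<inter> convex hull e \<subseteq> {p, q}"
    and xs: "distinct xs" "path_edges xs \<subseteq> C" "hd xs = p" "last xs = q" "p \<noteq> q" "xs \<noteq> []"
  shows "set xs \<subseteq> convex hull ({p, q} \<union> (hull_corners \<inter> set xs))"
    and "interior (convex hull ({p, q} \<union> (hull_corners \<inter> set xs))) \<noteq> {}"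
proof -
  have len: "2 \<le> length xs" using xs(3-6) by (cases xs rule: path_edges.cases) auto
  obtain g where g: "arc g" "pathstart g = p" "pathfinish g = q" "path_image g = drawing (path_edges xs)"
    using polygonal_arc[OF xs(1) len] xs C_subset by blast
  define c where "c = g +++ linepath q p"
  have c: "simple_path c" "pathfinish c = pathstart c"
  proof -
    have "path_image g \<inter> path_image (linepath q p) \<subseteq> {p, q}"
      using ch(2) xs(2) g(4) by (auto simp: closed_segment_commute)
    then show "simple_path c" unfolding c_def using g xs(5) by (intro simple_path_join_loop) auto
    show "pathfinish c = pathstart c" using g by (simp add: c_def)
  qed
  let ?Q = "path_image c"
  have Q: "?Q = drawing (path_edges xs) \<union> closed_segment p q"
    using g by (simp add: c_def path_image_join closed_segment_commute)
  have vQ: "set xs \<subseteq> ?Q"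
  proof
    fix x assume "x \<in> set xs"
    then obtain ys zs where yz: "xs = ys @ x # zs" by (meson split_list)
    show "x \<in> ?Q"
    proof (cases "zs = []")
      case True then show ?thesis using xs yz Q by simp
    next
      case False
      then have "{x, hd zs} \<in> path_edges xs" using yz by (simp add: path_edges_append path_edges_Cons)
      then show ?thesis using Q by (blast intro: hull_inc)
    qed
  qed
  have pq: "p \<in> set xs" "q \<in> set xs" using xs by auto
  have "convex hull e \<subseteq> convex hull set xs" if "e \<in> path_edges xs" for e
    using path_edges_subset[OF that] by (rule hull_mono)
  moreover have "closed_segment p q \<subseteq> convex hull set xs" using pq by (simp add: segment_convex_hull hull_mono)
  ultimately have "?Q \<subseteq> convex hull set xs" using Q by blast
  then have hQ: "convex hull ?Q = convex hull set xs"
    using vQ by (metis convex_convex_hull hull_minimal hull_mono subset_antisym)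
  have extr: "w \<in> {p, q} \<union> (hull_corners \<inter> set xs)" if ext: "w extreme_point_of (convex hull set xs)" for w
  proof (rule ccontr)
    assume n: "w \<notin> {p, q} \<union> (hull_corners \<inter> set xs)"
    have wxs: "w \<in> set xs" using extreme_point_of_convex_hull[OF ext] .
    then obtain ys zs where yz: "xs = ys @ w # zs" by (meson split_list)
    have "ys \<noteq> []" "zs \<noteq> []" using n xs(3,4) yz by auto
    define u1 u2 where "u1 = last ys" and "u2 = hd zs"
    have pe: "{u1, w} \<in> path_edges xs" "{w, u2} \<in> path_edges xs"
      using yz \<open>ys \<noteq> []\<close> \<open>zs \<noteq> []\<close> by (auto simp: path_edges_append path_edges_Cons u1_def u2_def)
    have "u1 \<in> set ys" "u2 \<in> set zs" using \<open>ys \<noteq> []\<close> \<open>zs \<noteq> []\<close> by (auto simp: u1_def u2_def)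
    then have une: "u1 \<noteq> u2" using xs(1) yz by auto
    have uC: "{w, u1} \<in> C" "{w, u2} \<in> C" using pe xs(2) by (auto simp: insert_commute)
    have wls: "w \<in> set ls" using C_edge uC by blast
    obtain t a b where tab: "{w, t} \<in> T" "{w, a} \<in> C" "{w, b} \<in> C" "{e \<in> seg_edges M. w \<in> e} = {{w, t}, {w, a}, {w, b}}"
      by (rule leaf_nbrs[OF wls])
    have ut: "u1 \<noteq> t" "u2 \<noteq> t" using uC tab(1) T_C_disjoint by blast+
    have "{w, u1} \<in> {e \<in> seg_edges M. w \<in> e}" "{w, u2} \<in> {e \<in> seg_edges M. w \<in> e}" using uC C_subset by auto
    then have "{w, u1} \<in> {{w, t}, {w, a}, {w, b}}" "{w, u2} \<in> {{w, t}, {w, a}, {w, b}}" unfolding tab(4) .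
    then have "u1 \<in> {a, b}" "u2 \<in> {a, b}" using ut by (auto simp: doubleton_eq_iff)
    then have "{u1, u2} = {a, b}" using une by auto
    then have nb: "{e \<in> seg_edges M. w \<in> e} = {{w, t}, {w, u1}, {w, u2}}"
      unfolding tab(4) by (auto simp: doubleton_eq_iff)
    have nb': "{e \<in> seg_edges M. w \<in> e} = {{w, t}, {w, u2}, {w, u1}}" unfolding nb by blast
    have wn: "w \<notin> hull_corners" using n wxs by blast
    obtain x y where xy: "{w, x} \<in> seg_edges M" "{w, y} \<in> seg_edges M" "w \<in> open_segment x y"
      using plain_leaf_straight[OF wls wn] .
    have "x \<noteq> y" using xy(3) by auto
    have "{w, x} \<in> {e \<in> seg_edges M. w \<in> e}" "{w, y} \<in> {e \<in> seg_edges M. w \<in> e}" using xy by auto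
    then have "{w, x} \<in> {{w, t}, {w, u1}, {w, u2}}" "{w, y} \<in> {{w, t}, {w, u1}, {w, u2}}" unfolding nb .
    then have "x \<in> {t, u1, u2}" "y \<in> {t, u1, u2}" using edgeD(1)[OF xy(1)] edgeD(1)[OF xy(2)] by (auto simp: doubleton_eq_iff)
    \<comment> \<open>Cases by which two of the three edges at \<open>w\<close> are opposite: two
      cycle edges contradict extremality at once, the tree edge and a cycle edge do so by
      \<open>reflex_leaf_not_extreme\<close>.\<close>
    then consider "{x, y} = {u1, u2}" | "{x, y} = {t, u2}" | "{x, y} = {t, u1}" using \<open>x \<noteq> y\<close> by blast
    moreover have seg: "w \<in> open_segment k l" if "{x, y} = {k, l}" for k l
      using xy(3) that by (auto simp: doubleton_eq_iff open_segment_commute)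
    moreover have wch: "w \<notin> closed_segment p q"
    proof
      assume "w \<in> closed_segment p q"
      then have "w \<in> closed_segment p q \<inter> convex hull {w, u1}" by (auto intro: hull_inc)
      then show False using ch(2) uC n by blast
    qed
    moreover have ext': "w extreme_point_of (convex hull ?Q)" using ext hQ by simp
    moreover have pe': "{w, u1} \<in> path_edges xs" using pe by (simp add: insert_commute)
    ultimately show False
    proof cases
      case 1
      then have "w \<in> open_segment u1 u2" using seg by blast
      moreover have "u1 \<in> convex hull set xs" "u2 \<in> convex hull set xs"
        using \<open>u1 \<in> set ys\<close> \<open>u2 \<in> set zs\<close> yz by (auto intro: hull_inc)
      ultimately show False using ext by (auto simp: extreme_point_of_def)
    next
      case 2
      show False
        by (rule reflex_leaf_not_extreme[OF tab(1) uC une nb seg[OF 2] c Q xs(2) pe' pe(2) wch ch(1) ext'])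
    next
      case 3
      show False
        by (rule reflex_leaf_not_extreme[OF tab(1) uC(2,1) une[symmetric] nb' seg[OF 3] c Q xs(2) pe(2) pe' wch ch(1) ext'])
    qed
  qed
  have "convex hull set xs = convex hull {w. w extreme_point_of (convex hull set xs)}"
    by (rule Krein_Milman_polytope) simp
  also have "\<dots> \<subseteq> convex hull ({p, q} \<union> (hull_corners \<inter> set xs))" using extr by (intro hull_mono) blast
  finally have sub: "convex hull set xs \<subseteq> convex hull ({p, q} \<union> (hull_corners \<inter> set xs))" .
  then show "set xs \<subseteq> convex hull ({p, q} \<union> (hull_corners \<inter> set xs))" using hull_subset[of "set xs" convex] by blast
  have J: "inside ?Q \<noteq> {}" "open (inside ?Q)" using Jordan_inside_outside[OF c] by auto
  have "inside ?Q \<subseteq> convex hull ?Q"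
    using outside_subset_convex[OF convex_convex_hull hull_subset, of ?Q] inside_Int_outside[of ?Q] by blast
  then have "inside ?Q \<subseteq> interior (convex hull ({p, q} \<union> (hull_corners \<inter> set xs)))"
    using J sub hQ by (intro interior_maximal) auto
  then show "interior (convex hull ({p, q} \<union> (hull_corners \<inter> set xs))) \<noteq> {}" using J by blast
qed

definition corner_order where
  "corner_order A ys B zs D ws \<longleftrightarrow> hull_corners = {A, B, D} \<and> distinct (A # ys @ B # zs @ D # ws) \<and>
     set (A # ys @ B # zs @ D # ws) = set ls \<and> cycle_edges (A # ys @ B # zs @ D # ws) = C"

text \<open>Moving on to the next corner preserves the situation, so facts about the chord at
  \<open>A\<close> carry over to \<open>B\<close> and \<open>D\<close>.\<close>

lemma corner_order_rotate: "corner_order A ys B zs D ws \<Longrightarrow> corner_order B zs D ws A ys"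
  unfolding corner_order_def using cycle_edges_swap[of "B # zs @ D # ws" "A # ys"] by (simp add: insert_commute) blast

lemma corner_order_sets:
  assumes "corner_order A ys B zs D ws"
  shows "hull_corners \<inter> set ys = {}" "hull_corners \<inter> set zs = {}" "hull_corners \<inter> set ws = {}" "A \<noteq> B" "A \<noteq> D" "B \<noteq> D"
  using assms unfolding corner_order_def by auto

text \<open>If one of the two chains between \<open>A\<close> and \<open>a\<close> contained no
  corner besides its ends, its hull would be a segment, against \<open>chain_hull\<close>. So
  \<open>a\<close> separates \<open>B\<close> from \<open>D\<close> on the cycle apart from
  \<open>A\<close>, and each chain lies in a triangle with one further corner.\<close>

lemma chord_end:
  assumes ord: "corner_order A ys B zs D ws" and ch: "chord A a"
  shows "a \<in> set zs" "cross (a - A) (B - A) \<noteq> 0" "cross (a - A) (D - A) \<noteq> 0"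
    "set ws \<subseteq> convex hull {A, a, D}" "set ys \<subseteq> convex hull {A, a, B}"
proof -
  note o = ord[unfolded corner_order_def]
  note os = corner_order_sets[OF ord]
  have ch': "closed_segment A a \<subseteq> \<Union>M" "\<forall>e\<in>C. closed_segment A a \<inter> convex hull e \<subseteq> {A, a}" "A \<noteq> a"
    "closed_segment a A \<subseteq> \<Union>M" "\<forall>e\<in>C. closed_segment a A \<inter> convex hull e \<subseteq> {a, A}"
    using ch chord_subset[OF ch] by (auto simp: chord_def closed_segment_commute)
  have pe: "path_edges xs \<subseteq> C" if "us @ xs @ vs = A # ys @ B # zs @ D # ws" for us xs vs
    using path_edges_infix[of xs us vs] path_edges_subset_cycle_edges[of "us @ xs @ vs"] that o by auto
  \<comment> \<open>The second chain returns to \<open>A\<close> across the end of the list, so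
    \<open>A\<close> is placed last.\<close>
  have pe2: "path_edges xs \<subseteq> C" if "us @ xs @ vs = (ys @ B # zs @ D # ws) @ [A]" for us xs vs
  proof -
    have "path_edges (us @ xs @ vs) \<subseteq> cycle_edges (A # ys @ B # zs @ D # ws)"
      unfolding that by (auto simp: path_edges_append path_edges_Cons cycle_edges_eq split: if_splits)
    then show ?thesis using path_edges_infix[of xs us vs] o by blast
  qed
  have fwd: "False" if "us @ xs @ vs = A # ys @ B # zs @ D # ws" "hd xs = A" "last xs = a" "xs \<noteq> []" "hull_corners \<inter> set xs \<subseteq> {A, a}" for us xs vs
  proof -
    have "distinct (us @ xs @ vs)" using that o by metis
    then have "distinct xs" by simp
    from chain_hull(2)[OF ch'(1,2) this pe[OF that(1)] that(2,3) ch'(3) that(4)]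
    have "interior (convex hull ({A, a} \<union> hull_corners \<inter> set xs)) \<noteq> {}" .
    moreover have "{A, a} \<union> hull_corners \<inter> set xs = {A, a}" using that(5) by blast
    ultimately show False using interior_convex_hull_pair by simp
  qed
  have bwd: "False" if "us @ xs @ vs = (ys @ B # zs @ D # ws) @ [A]" "hd xs = a" "last xs = A" "xs \<noteq> []" "hull_corners \<inter> set xs \<subseteq> {A, a}" for us xs vs
  proof -
    have "distinct (us @ xs @ vs)" unfolding that(1) using o by auto
    then have "distinct xs" by simp
    from chain_hull(2)[OF ch'(4,5) this pe2[OF that(1)] that(2,3) ch'(3)[symmetric] that(4)]
    have "interior (convex hull ({a, A} \<union> hull_corners \<inter> set xs)) \<noteq> {}" .
    moreover have "{a, A} \<union> hull_corners \<inter> set xs = {a, A}" using that(5) by blast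
    ultimately show False using interior_convex_hull_pair by simp
  qed
  have "a \<in> set ls" "a \<noteq> A" using ch by (auto simp: chord_def)
  then consider "a \<in> set ys" | "a = B" | "a \<in> set zs" | "a = D" | "a \<in> set ws" using o by auto
  then show azs: "a \<in> set zs"
  proof cases
    case 1
    then obtain y1 y2 where y: "ys = y1 @ a # y2" by (meson split_list)
    show ?thesis using fwd[of "[]" "A # y1 @ [a]" "y2 @ B # zs @ D # ws"] y os by auto
  next
    case 2
    show ?thesis using fwd[of "[]" "A # ys @ [B]" "zs @ D # ws"] 2 os by auto
  next
    case 4
    show ?thesis using bwd[of "ys @ B # zs" "D # ws @ [A]" "[]"] 4 os by auto
  next
    case 5
    then obtain w1 w2 where w: "ws = w1 @ a # w2" by (meson split_list)
    show ?thesis using bwd[of "ys @ B # zs @ D # w1" "a # w2 @ [A]" "[]"] w os by auto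
  qed
  then obtain z1 z2 where z: "zs = z1 @ a # z2" by (meson split_list)
  let ?f = "A # ys @ B # z1 @ [a]" and ?b = "a # z2 @ D # ws @ [A]"
  have cf: "{A, a} \<union> hull_corners \<inter> set ?f = {A, a, B}" using os z o by auto
  have cb: "{a, A} \<union> hull_corners \<inter> set ?b = {A, a, D}" using os z o by auto
  have df: "distinct ?f" and db: "distinct ?b" using o z by auto
  have pf: "path_edges ?f \<subseteq> C" by (rule pe[of "[]" _ "z2 @ D # ws"]) (simp add: z)
  have pb: "path_edges ?b \<subseteq> C" by (rule pe2[of "ys @ B # z1" _ "[]"]) (simp add: z)
  have hf: "hd ?f = A" "last ?f = a" "?f \<noteq> []" and hb: "hd ?b = a" "last ?b = A" "?b \<noteq> []" by auto
  note F = chain_hull[OF ch'(1,2) df pf hf(1,2) ch'(3) hf(3), unfolded cf]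
  note Bk = chain_hull[OF ch'(4,5) db pb hb(1,2) ch'(3)[symmetric] hb(3), unfolded cb]
  show "cross (a - A) (B - A) \<noteq> 0" using F(2) interior_triangle_eq_empty_iff by blast
  show "cross (a - A) (D - A) \<noteq> 0" using Bk(2) interior_triangle_eq_empty_iff by blast
  show "set ws \<subseteq> convex hull {A, a, D}" using Bk(1) by auto
  show "set ys \<subseteq> convex hull {A, a, B}" using F(1) by auto
qed

text \<open>\<open>chord_end\<close> at both corners places \<open>b\<close> between
  \<open>D\<close> and \<open>A\<close>, and \<open>a\<close> between \<open>B\<close> and
  \<open>D\<close>, each in the triangle required by \<open>chords_cross\<close>. The crossing is no
  leaf, because a leaf on both chords would be an end of both.\<close>

lemma corner_chords_meet:
  assumes ord: "corner_order A ys B zs D ws" and ch: "chord A a" "chord B b"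
  obtains x s t where "x \<in> closed_segment A a" "x \<in> closed_segment B b" "x \<in> inner_verts"
    "s \<in> M" "t \<in> M" "s \<noteq> t" "closed_segment A a \<subseteq> s" "closed_segment B b \<subseteq> t"
proof -
  note ord' = corner_order_rotate[OF ord]
  note a = chord_end[OF ord ch(1)] and b = chord_end[OF ord' ch(2)]
  have hull: "v \<in> convex hull {A, B, D}" if "v \<in> set ls" for v
    using that leaves_subset hull_corners(3) hull_subset[of V convex] ord unfolding corner_order_def by auto
  have abl: "a \<in> set ls" "b \<in> set ls" using ch by (auto simp: chord_def)
  have "b \<in> convex hull {A, a, D}" "a \<in> convex hull {B, b, D}" using a b by auto
  then obtain x where x: "x \<in> closed_segment A a" "x \<in> closed_segment B b"
    using chords_cross[OF hull[OF abl(1)] hull[OF abl(2)] a(2,3) b(3,2)] by blast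
  obtain s t where st: "s \<in> M" "t \<in> M" "closed_segment A a \<subseteq> s" "closed_segment B b \<subseteq> t"
    using ch by (auto simp: chord_def)
  have "s \<noteq> t"
  proof
    assume "s = t"
    then have "A \<in> s" "a \<in> s" "B \<in> s" using st by auto
    moreover have "A \<noteq> a" using ch by (auto simp: chord_def)
    ultimately obtain r where "B = A + r *\<^sub>R (a - A)" using seg_param[OF st(1)] by metis
    then have "cross (a - A) (B - A) = 0" by simp
    then show False using a(2) by blast
  qed
  then have "x \<in> V" using common_point_vert[OF st(1,2)] st x by blast
  moreover have "x \<notin> set ls"
  proof
    assume "x \<in> set ls"
    then have "x = A \<or> x = a" "x = B \<or> x = b" using leaf_on_chord ch x by blast+
    moreover have "distinct (A # ys @ B # zs @ D # ws)" using ord by (simp add: corner_order_def)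
    ultimately show False using a(1) b(1) by auto
  qed
  ultimately show ?thesis using that[of x s t] x st \<open>s \<noteq> t\<close> by blast
qed

lemma extremal_contradiction: False
proof -
  obtain A B D where ABD: "hull_corners = {A, B, D}" "A \<noteq> B" "A \<noteq> D" "B \<noteq> D"
    using eq_case(1) by (auto simp: card_3_iff)
  then have "A \<in> set ls" "B \<in> set ls" "D \<in> set ls" using eq_case(4) by auto
  then obtain ys zs ws B' D' where o: "{B', D'} = {B, D}" "distinct (A # ys @ B' # zs @ D' # ws)"
    "set (A # ys @ B' # zs @ D' # ws) = set ls" "cycle_edges (A # ys @ B' # zs @ D' # ws) = cycle_edges ls"
    by (rule cyclic_order_three[OF ls(1) _ _ _ ABD(2-4)])
  then have ord: "corner_order A ys B' zs D' ws" using ABD(1) C unfolding corner_order_def by simp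
  note ord2 = corner_order_rotate[OF ord]
  note ord3 = corner_order_rotate[OF ord2]
  have corners: "A \<in> hull_corners" "B' \<in> hull_corners" "D' \<in> hull_corners" using ord by (auto simp: corner_order_def)
  obtain a where a: "chord A a" using corner_has_chord[OF corners(1)] .
  obtain b where b: "chord B' b" using corner_has_chord[OF corners(2)] .
  obtain d where d: "chord D' d" using corner_has_chord[OF corners(3)] .
  obtain x sa sb where x: "x \<in> closed_segment A a" "x \<in> closed_segment B' b" "x \<in> inner_verts"
    "sa \<in> M" "sb \<in> M" "sa \<noteq> sb" "closed_segment A a \<subseteq> sa" "closed_segment B' b \<subseteq> sb"
    using corner_chords_meet[OF ord a b] .
  obtain y sb' sd where y: "y \<in> closed_segment B' b" "y \<in> closed_segment D' d" "y \<in> inner_verts"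
    "sb' \<in> M" "sd \<in> M" "sb' \<noteq> sd" "closed_segment B' b \<subseteq> sb'" "closed_segment D' d \<subseteq> sd"
    using corner_chords_meet[OF ord2 b d] .
  obtain z sd' sa' where z: "z \<in> closed_segment D' d" "z \<in> closed_segment A a" "z \<in> inner_verts"
    "sd' \<in> M" "sa' \<in> M" "sd' \<noteq> sa'" "closed_segment D' d \<subseteq> sd'" "closed_segment A a \<subseteq> sa'"
    using corner_chords_meet[OF ord3 d a] .
  have same: "s = s'" if "s \<in> M" "s' \<in> M" "closed_segment p q \<subseteq> s" "closed_segment p q \<subseteq> s'" "p \<noteq> q" for s s' p q
    using seg_unique[OF that(1,2), of p q] that by auto
  have "sa' = sa" "sb' = sb" "sd' = sd" using same x y z a b d unfolding chord_def by metis+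
  then have ne: "sa \<noteq> sb" "sb \<noteq> sd" "sd \<noteq> sa" using x y z by auto
  \<comment> \<open>Equality permits only two segments at an inner vertex, so the three pairwise
    crossings are distinct.\<close>
  have two: "\<not> (v \<in> sa \<and> v \<in> sb \<and> v \<in> sd)" if v: "v \<in> inner_verts" for v
  proof
    assume "v \<in> sa \<and> v \<in> sb \<and> v \<in> sd"
    then have "{sa, sb, sd} \<subseteq> {s \<in> M. v \<in> s}" using x y by blast
    then have "card {sa, sb, sd} \<le> seg_count M v" unfolding seg_count_def using finite_M by (intro card_mono) auto
    then show False using inner_vert(2)[OF v] ne by simp
  qed
  have in_segs: "x \<in> sa" "x \<in> sb" "y \<in> sb" "y \<in> sd" "z \<in> sd" "z \<in> sa"
    using x y z \<open>sa' = sa\<close> \<open>sb' = sb\<close> \<open>sd' = sd\<close> by auto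
  then have nxy: "x \<noteq> y" "y \<noteq> z" "x \<noteq> z" using two[OF x(3)] two[OF y(3)] by auto
  have "cross (y - x) (z - x) = 0"
  proof (rule triangle_sides_enclose[OF connected_complement_tree])
    show "compact (drawing T)" using compact_drawing T_subset by blast
    show "interior (drawing T) = {}"
    proof -
      have "interior (drawing F) = {}" if "finite F" "F \<subseteq> seg_edges M" for F
        using that
      proof (induction rule: finite_induct)
        case (insert e F)
        have "card e = 2" using insert card_edge by blast
        then have "interior (convex hull e) = {}"
          by (intro empty_interior_convex_hull) (auto intro: card_ge_0_finite)
        moreover have "closed (drawing F)" using closed_edges insert by blast
        ultimately have "interior (drawing F \<union> convex hull e) = {}"
          using interior_closed_Un_empty_interior insert by (metis insert_subset)
        then show ?case by (simp add: Un_commute)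
      qed simp
      then show ?thesis using finite_T T_subset by blast
    qed
    have "closed_segment A a \<subseteq> drawing T" "closed_segment B' b \<subseteq> drawing T" "closed_segment D' d \<subseteq> drawing T"
      using a b d by (auto simp: chord_def)
    then show "closed_segment x y \<subseteq> drawing T" "closed_segment y z \<subseteq> drawing T" "closed_segment z x \<subseteq> drawing T"
      using x y z by (meson closed_segment_subset convex_closed_segment order_trans)+
  qed
  \<comment> \<open>The crossings are collinear although distinct, which makes \<open>sa\<close> and
    \<open>sb\<close> collinear while they meet in \<open>x\<close>.\<close>
  then obtain r where r: "z - x = r *\<^sub>R (y - x)" using cross_eq_0_imp_scaleR[of "y - x"] nxy by auto
  have line: "\<exists>c. v = x + c *\<^sub>R (y - x)" if v: "v \<in> sa \<union> sb" for v
  proof (cases "v \<in> sb")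
    case True
    then show ?thesis using seg_param[OF x(5) in_segs(2,3) nxy(1)] by metis
  next
    case False
    then have "v \<in> sa" using v by blast
    then obtain c where "v = x + c *\<^sub>R (z - x)" using seg_param[OF x(4) in_segs(1,6) nxy(3)] by metis
    then have "v = x + (c * r) *\<^sub>R (y - x)" using r by simp
    then show ?thesis by blast
  qed
  then have "collinear (sa \<union> sb)" unfolding collinear_alt by blast
  then have "sa \<inter> sb = {}" using sys x(4-6) by (auto simp: segment_system_def)
  then show False using in_segs by blast
qed

end

context segment_halin
begin

lemma card_verts_bound: "card V + 11 \<le> 3 * card M"
proof (rule ccontr)
  assume "\<not> card V + 11 \<le> 3 * card M"
  then interpret extremal_halin M T C ls by unfold_locales simp
  show False by (rule extremal_contradiction)
qed

end

lemma segment_halin_graph_segment_halin: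
  assumes "segment_halin_graph M"
  obtains T C ls where "segment_halin M T C ls"
proof -
  obtain T C where h: "segment_system M" "halin_construction (seg_verts M) (seg_edges M) T C" "outer_edges M = C"
    using assms by (auto simp: segment_halin_graph_def)
  obtain ls where ls: "halin (seg_verts M) (seg_edges M) T C ls" using halin_construction_halin[OF h(2)] .
  then have "finite (seg_verts M)" by (rule halin.finite_V)
  then have "segment_halin M T C ls"
    using h ls by (auto simp: segment_halin_def segments_def segment_halin_axioms_def)
  then show ?thesis using that by blast
qed

lemma segment_halin_graph_bounds:
  assumes "segment_halin_graph M"
  shows "int (card (intersection_points M)) \<le> 3 * int (card M) - 11" "int (card (circuits M)) \<le> 2 * int (card M) - 6"
proof -
  obtain T C ls where "segment_halin M T C ls" using segment_halin_graph_segment_halin[OF assms] .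
  then interpret segment_halin M T C ls .
  have "card (intersection_points M) \<le> card (seg_verts M)"
    using finite_verts by (intro card_mono) (auto simp: seg_verts_def)
  then show "int (card (intersection_points M)) \<le> 3 * int (card M) - 11" using card_verts_bound by linarith
  show "int (card (circuits M)) \<le> 2 * int (card M) - 6" using card_circuits_le leaves_bound by linarith
qed

section \<open>Plane trees from boundary walks\<close>

text \<open>A cycle through the vertex attached last would need two edges there, and only one
  exists.\<close>

lemma grown_is_tree: assumes "grown V T" shows "is_tree V T"
proof -
  have edges: "card e = 2" if "e \<in> T" for e
    using assms that by (induction rule: grown.induct) (auto simp: card_insert_if)
  have acyc: "\<not> cycle_edges xs \<subseteq> T" if "3 \<le> length xs" "distinct xs" for xs
    using assms that
  proof (induction rule: grown.induct)
    case (base r)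
    then show ?case by (cases "xs = []") (auto simp: cycle_edges_eq)
  next
    case (step S F u v)
    show ?case
    proof
      assume c: "cycle_edges xs \<subseteq> insert {u, v} F"
      have vF: "v \<notin> e" if "e \<in> F" for e using grown_basic[OF step.hyps(1)] that step.hyps(3) by blast
      show False
      proof (cases "v \<in> set xs")
        case True
        obtain a b where ab: "a \<noteq> v" "b \<noteq> v" "a \<noteq> b" "{e \<in> cycle_edges xs. v \<in> e} = {{v, a}, {v, b}}"
          by (rule cycle_edges_nbrs[OF step.prems(2,1) True])
        have "{v, a} \<in> {e \<in> cycle_edges xs. v \<in> e}" "{v, b} \<in> {e \<in> cycle_edges xs. v \<in> e}" unfolding ab(4) by auto
        then have "{v, a} = {u, v}" "{v, b} = {u, v}" using c vF by blast+
        then show False using ab by (auto simp: doubleton_eq_iff)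
      next
        case False
        then have "{u, v} \<notin> cycle_edges xs" using cycle_edges_subset[of "{u, v}" xs] by blast
        then have "cycle_edges xs \<subseteq> F" using c by blast
        then show False using step.IH step.prems by blast
      qed
    qed
  qed
  have walk: "xs \<noteq> [] \<Longrightarrow> path_edges xs \<subseteq> T \<Longrightarrow> (hd xs, last xs) \<in> (darts T)\<^sup>*" for xs
  proof (induction xs rule: path_edges.induct)
    case (1 a b xs)
    then have "(b, last (b # xs)) \<in> (darts T)\<^sup>*" by auto
    moreover have "(a, b) \<in> darts T" using 1 by (auto simp: darts_def)
    ultimately show ?case by auto
  qed auto
  have "(u, v) \<in> (darts T)\<^sup>*" if "u \<in> V" "v \<in> V" for u v
    using grown_path[OF assms that] walk by metis
  then show ?thesis using acyc edges grown_basic[OF assms] unfolding is_tree_def simple_graph_def by blast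
qed

text \<open>The orbit of \<open>v\<close> enters the old cycle at \<open>f p\<close>, follows it
  round to \<open>p\<close> and from there returns to \<open>v\<close>.\<close>

lemma cyclic_on_insert:
  assumes "cyclic_on f N" "p \<in> N" "v \<notin> N"
  shows "cyclic_on (f(p := v, v := f p)) (insert v N)"
proof -
  define g where "g = f(p := v, v := f p)"
  have pv: "p \<noteq> v" using assms by auto
  then have g: "g v = f p" "g p = v" "\<And>y. y \<noteq> p \<Longrightarrow> y \<noteq> v \<Longrightarrow> g y = f y" by (auto simp: g_def)
  have N: "N = orbit f p" using assms(1,2) by (simp add: cyclic_on_alldef)
  have fp: "f p \<in> orbit g v" using orbit.base[of g v] g(1) by simp
  have sub: "y \<in> orbit g v" if "y \<in> orbit f p" for y
    using that
  proof (induction rule: orbit.induct)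
    case base
    show ?case by (rule fp)
  next
    case (step y)
    then have "y \<noteq> v" using N assms(3) by auto
    show ?case
    proof (cases "y = p")
      case True then show ?thesis using fp by simp
    next
      case False
      then show ?thesis using orbit.step[OF step.IH] g(3)[of y] \<open>y \<noteq> v\<close> by simp
    qed
  qed
  have vo: "v \<in> orbit g v" using orbit.step[OF sub[of p]] N assms(2) g(2) by simp
  have "y \<in> insert v N" if "y \<in> orbit g v" for y
    using that
  proof (induction rule: orbit.induct)
    case base
    then show ?case using N orbit.base[of f p] g(1) by simp
  next
    case (step y)
    then show ?case using N orbit.base[of f p] orbit.step[of y f p] g by (cases "y = v"; cases "y = p") auto
  qed
  then have "insert v N = orbit g v" using sub N vo by blast
  then show ?thesis unfolding cyclic_on_def g_def by blast
qed

text \<open>Attaching a leaf \<open>v\<close> to \<open>u\<close> right after the dart \<open>(p, u)\<close> inserts \<open>v\<close> after \<open>p\<close> in the rotation at \<open>u\<close>.\<close>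

inductive plane_walk :: "'a set \<Rightarrow> 'a set set \<Rightarrow> ('a \<times> 'a) list \<Rightarrow> bool" where
  base: "a \<noteq> b \<Longrightarrow> plane_walk {a, b} {{a, b}} [(a, b), (b, a)]"
| step: "plane_walk V T (xs @ (p, u) # ys) \<Longrightarrow> v \<notin> V \<Longrightarrow>
    plane_walk (insert v V) (insert {u, v} T) (xs @ (p, u) # (u, v) # (v, u) # ys)"

text \<open>As an equation between lists, the successor condition can be checked piecewise when two
  darts are inserted.\<close>

lemma boundary_walk_rotate1:
  "boundary_walk T \<rho> ds \<longleftrightarrow> distinct ds \<and> set ds = darts T \<and> rotate1 ds = map (\<lambda>(u, v). (v, \<rho> v u)) ds"
proof -
  have eq: "(\<forall>i<length ds. case ds ! i of (u, v) \<Rightarrow> ds ! (Suc i mod length ds) = (v, \<rho> v u)) \<longleftrightarrow>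
    rotate1 ds = map (\<lambda>(u, v). (v, \<rho> v u)) ds"
    by (subst list_eq_iff_nth_eq) (auto simp: nth_rotate1 case_prod_beta)
  show ?thesis unfolding boundary_walk_def eq ..
qed

lemma plane_walk_grown: "plane_walk V T ds \<Longrightarrow> grown V T \<and> set ds = darts T \<and> distinct ds"
proof (induction rule: plane_walk.induct)
  case (base a b)
  have "grown (insert b {a}) (insert {a, b} {})" using base by (intro grown.step grown.base) auto
  moreover have "set [(a, b), (b, a)] = darts {{a, b}}" by (auto simp: darts_def doubleton_eq_iff)
  ultimately show ?case using base by (simp add: insert_commute)
next
  case (step V T xs p u ys v)
  then have g: "grown V T" and ds: "set (xs @ (p, u) # ys) = darts T" by auto
  have edge: "x \<in> V \<and> y \<in> V" if "(x, y) \<in> darts T" for x y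
    using grown_basic[OF g] that by (auto simp: darts_def)
  have u: "u \<in> V" using edge[of p u] ds by auto
  have "darts (insert {u, v} T) = darts T \<union> {(u, v), (v, u)}" by (auto simp: darts_def doubleton_eq_iff)
  moreover have "set (xs @ (p, u) # (u, v) # (v, u) # ys) = set (xs @ (p, u) # ys) \<union> {(u, v), (v, u)}" by auto
  ultimately have "set (xs @ (p, u) # (u, v) # (v, u) # ys) = darts (insert {u, v} T)" using ds by metis
  moreover have "(u, v) \<notin> darts T" "(v, u) \<notin> darts T" using edge step.hyps by blast+
  then have "distinct (xs @ (p, u) # (u, v) # (v, u) # ys)" using step.IH ds step.hyps u by auto
  ultimately show ?case using grown.step[OF g u step.hyps(2)] by simp
qed

lemma plane_walk_rotation:
  "plane_walk V T ds \<Longrightarrow> \<exists>\<rho>. rotation_system V T \<rho> \<and> boundary_walk T \<rho> ds"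
proof (induction rule: plane_walk.induct)
  case (base a b)
  define \<rho> :: "'a \<Rightarrow> 'a \<Rightarrow> 'a" where "\<rho> = (\<lambda>x y. y :: 'a)"
  have "cyclic_on (\<rho> x) {y}" for x y
    unfolding cyclic_on_def \<rho>_def by (auto intro: orbit.base elim: orbit.induct)
  moreover have "nbrs {{a, b}} a = {b}" "nbrs {{a, b}} b = {a}" using base by (auto simp: nbrs_def doubleton_eq_iff)
  ultimately have "rotation_system {a, b} {{a, b}} \<rho>" by (simp add: rotation_system_def)
  moreover have "boundary_walk {{a, b}} \<rho> [(a, b), (b, a)]"
    using plane_walk_grown[OF plane_walk.base[OF base]] unfolding boundary_walk_rotate1 by (simp add: \<rho>_def)
  ultimately show ?case by blast
next
  case (step V T xs p u ys v)
  obtain \<rho> where \<rho>: "rotation_system V T \<rho>" "boundary_walk T \<rho> (xs @ (p, u) # ys)" using step.IH by blast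
  note g = plane_walk_grown[OF step.hyps(1)] and g' = plane_walk_grown[OF plane_walk.step[OF step.hyps]]
  have edge: "x \<in> V \<and> y \<in> V" if "{x, y} \<in> T" for x y
    using grown_basic[OF conjunct1[OF g]] that by (meson insert_subset)
  have pu: "{p, u} \<in> T" using g by (auto simp: darts_def)
  then have uV: "u \<in> V" "u \<noteq> v" "p \<noteq> v" using edge step.hyps by blast+
  define \<rho>' where "\<rho>' = \<rho>(u := (\<rho> u)(p := v, v := \<rho> u p), v := (\<lambda>_. u))"
  have rot: "rotation_system (insert v V) (insert {u, v} T) \<rho>'"
    unfolding rotation_system_def
  proof
    fix x assume "x \<in> insert v V"
    then consider "x = v" | "x = u" | "x \<in> V" "x \<noteq> u" "x \<noteq> v" by blast
    then show "cyclic_on (\<rho>' x) (nbrs (insert {u, v} T) x)"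
    proof cases
      case 1
      have "nbrs (insert {u, v} T) v = {u}" using edge step.hyps(2) by (auto simp: nbrs_def doubleton_eq_iff)
      moreover have "cyclic_on (\<lambda>_. u) {u}"
        unfolding cyclic_on_def by (auto intro: orbit.base elim: orbit.cases)
      ultimately show ?thesis using 1 by (simp add: \<rho>'_def)
    next
      case 2
      have "nbrs (insert {u, v} T) u = insert v (nbrs T u)" using uV by (auto simp: nbrs_def doubleton_eq_iff)
      moreover have "cyclic_on ((\<rho> u)(p := v, v := \<rho> u p)) (insert v (nbrs T u))"
      proof (rule cyclic_on_insert)
        show "cyclic_on (\<rho> u) (nbrs T u)" using \<rho>(1) uV by (simp add: rotation_system_def)
        show "p \<in> nbrs T u" using pu by (simp add: nbrs_def insert_commute)
        show "v \<notin> nbrs T u" using edge step.hyps(2) by (auto simp: nbrs_def)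
      qed
      ultimately show ?thesis using 2 uV by (simp add: \<rho>'_def)
    next
      case 3
      then have "nbrs (insert {u, v} T) x = nbrs T x" by (auto simp: nbrs_def doubleton_eq_iff)
      then show ?thesis using \<rho>(1) 3 by (simp add: rotation_system_def \<rho>'_def)
    qed
  qed
  \<comment> \<open>Among the old darts only the successor of \<open>(p, u)\<close> changes: the
    detour to \<open>v\<close> and back ends where that dart used to lead.\<close>
  let ?f = "\<lambda>(u, v). (v, \<rho> v u)" and ?g = "\<lambda>(u, v). (v, \<rho>' v u)"
  have r: "rotate1 (xs @ (p, u) # ys) = map ?f (xs @ (p, u) # ys)" "distinct (xs @ (p, u) # ys)"
    using \<rho>(2) by (auto simp: boundary_walk_rotate1)
  have same: "?g d = ?f d" if d: "d \<in> set xs \<union> set ys" for d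
  proof -
    obtain x y where xy: "d = (x, y)" by fastforce
    then have "{x, y} \<in> T" using d g by (auto simp: darts_def)
    then have "x \<noteq> v" "y \<noteq> v" using edge step.hyps(2) by blast+
    moreover have "\<not> (x = p \<and> y = u)" using r(2) d xy by auto
    ultimately show ?thesis using xy by (auto simp: \<rho>'_def)
  qed
  have maps: "map ?g xs = map ?f xs" "map ?g ys = map ?f ys" using same by (auto simp: map_eq_conv)
  have new: "?g (p, u) = (u, v)" "?g (u, v) = (v, u)" "?g (v, u) = ?f (p, u)" using uV by (simp_all add: \<rho>'_def)
  have "rotate1 (xs @ (p, u) # (u, v) # (v, u) # ys) = map ?g (xs @ (p, u) # (u, v) # (v, u) # ys)"
  proof (cases xs)
    case Nil
    then show ?thesis using r(1) maps new by simp
  next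
    case (Cons x xs')
    then have "(xs' @ [(p, u)]) @ (ys @ [x]) = map ?f xs @ (?f (p, u) # map ?f ys)" using r(1) by simp
    moreover have "length (xs' @ [(p, u)]) = length (map ?f xs)" using Cons by simp
    ultimately have "xs' @ [(p, u)] = map ?f xs" "ys @ [x] = ?f (p, u) # map ?f ys" unfolding append_eq_append_conv[OF disjI1[OF \<open>length _ = length _\<close>]] by blast+
    moreover have "rotate1 (xs @ (p, u) # (u, v) # (v, u) # ys) = (xs' @ [(p, u)]) @ [(u, v), (v, u)] @ (ys @ [x])" using Cons by simp
    ultimately show ?thesis using maps new by simp
  qed
  then have "boundary_walk (insert {u, v} T) \<rho>' (xs @ (p, u) # (u, v) # (v, u) # ys)"
    using g' unfolding boundary_walk_rotate1 by simp
  then show ?case using rot by blast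
qed

section \<open>Extremal segment Halin graphs\<close>

context segments
begin

text \<open>The functional \<open>f\<close> turns betweenness on \<open>s\<close> into order, so the
  edges on \<open>s\<close> join consecutive vertices of the sorted list.\<close>

lemma seg_path_edges:
  assumes s: "s \<in> M" and f: "linear (f :: complex \<Rightarrow> real)" "inj_on f s"
    and xs: "V \<inter> s = set xs" "sorted_wrt (\<lambda>x y. f y < f x) xs"
  shows "{e \<in> E. e \<subseteq> s} = path_edges xs"
proof -
  have cvx: "f ((1 - t) *\<^sub>R x + t *\<^sub>R y) = (1 - t) * f x + t * f y" for t x y
    using f(1) by (simp add: linear_add linear_scale)
  have btw: "f y < f z \<and> f z < f x" if zo: "z \<in> open_segment x y" and lt: "f y < f x" for x y z
  proof -
    obtain t where t: "0 < t" "t < 1" "z = (1 - t) *\<^sub>R x + t *\<^sub>R y" using zo by (auto simp: in_segment)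
    have "f z - f y = (1 - t) * (f x - f y)" "f x - f z = t * (f x - f y)" unfolding t(3) cvx by (simp_all add: algebra_simps)
    moreover have "(1 - t) * (f x - f y) > 0" "t * (f x - f y) > 0" using t lt by (simp_all add: mult_pos_pos)
    ultimately show ?thesis by linarith
  qed
  have mid: "z \<in> open_segment x y" if "x \<in> s" "y \<in> s" "z \<in> s" "f y < f z" "f z < f x" for x y z
  proof -
    define t where "t = (f x - f z) / (f x - f y)"
    have t: "0 < t" "t < 1" "t * (f x - f y) = f x - f z" using that by (auto simp: t_def)
    let ?w = "(1 - t) *\<^sub>R x + t *\<^sub>R y"
    have w: "?w \<in> open_segment x y" using t that by (auto simp: in_segment)
    moreover have "?w \<in> s" using w convex_seg[OF s] that by (meson closed_segment_subset open_closed_segment subsetD)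
    moreover have "f ?w = f z" unfolding cvx using t(3) by (simp add: algebra_simps)
    ultimately show ?thesis using f(2) that(3) by (metis inj_onD)
  qed
  have less: "f (xs ! j) < f (xs ! i) \<longleftrightarrow> i < j" if "i < length xs" "j < length xs" for i j
    using that xs(2) by (metis linorder_neqE_nat order_less_asym order_less_irrefl sorted_wrt_nth_less)
  have inV: "xs ! i \<in> V \<and> xs ! i \<in> s" if "i < length xs" for i using that xs(1) nth_mem by blast
  show ?thesis
  proof
    show "path_edges xs \<subseteq> {e \<in> E. e \<subseteq> s}"
    proof
      fix e assume "e \<in> path_edges xs"
      then obtain i where i: "Suc i < length xs" "e = {xs ! i, xs ! Suc i}" unfolding path_edges_nth by blast
      have lt: "f (xs ! Suc i) < f (xs ! i)" using less[of i "Suc i"] i by simp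
      have "V \<inter> open_segment (xs ! i) (xs ! Suc i) = {}"
      proof (rule ccontr)
        assume "V \<inter> open_segment (xs ! i) (xs ! Suc i) \<noteq> {}"
        then obtain z where z: "z \<in> V" "z \<in> open_segment (xs ! i) (xs ! Suc i)" by blast
        have "z \<in> s" using z(2) convex_seg[OF s] inV[of i] inV[of "Suc i"] i
          by (meson Suc_lessD closed_segment_subset open_closed_segment subsetD)
        then obtain k where k: "k < length xs" "z = xs ! k" using z(1) xs(1) by (metis IntI in_set_conv_nth)
        then have "i < k" "k < Suc i" using btw[OF z(2) lt] less i by auto
        then show False by simp
      qed
      moreover have "xs ! i \<noteq> xs ! Suc i" using lt by auto
      ultimately show "e \<in> {e \<in> E. e \<subseteq> s}" using edgeI[of "xs ! i" "xs ! Suc i" s] inV[of i] inV[of "Suc i"] i s by auto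
    qed
    show "{e \<in> E. e \<subseteq> s} \<subseteq> path_edges xs"
    proof
      fix e assume "e \<in> {e \<in> E. e \<subseteq> s}"
      then have e: "e \<in> E" "e \<subseteq> s" by auto
      obtain u v where uv: "e = {u, v}" "u \<noteq> v" "u \<in> V" "v \<in> V" "V \<inter> open_segment u v = {}" using edgeE[OF e(1)] by metis
      obtain i j where ij: "i < length xs" "u = xs ! i" "j < length xs" "v = xs ! j"
        using uv e(2) xs(1) by (metis IntI in_set_conv_nth insert_subset)
      have cons: "l = Suc k" if kl: "k < l" "l < length xs" "{xs ! k, xs ! l} = e" for k l
      proof (rule ccontr)
        assume "l \<noteq> Suc k"
        then have k: "Suc k < l" using kl by simp
        have "xs ! Suc k \<in> open_segment (xs ! k) (xs ! l)"
          using mid[of "xs ! k" "xs ! l" "xs ! Suc k"] inV less k kl by simp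
        moreover have "open_segment (xs ! k) (xs ! l) = open_segment u v"
          using kl(3) uv(1) by (metis doubleton_eq_iff open_segment_commute)
        ultimately show False using uv(5) inV[of "Suc k"] k kl by auto
      qed
      have "i \<noteq> j" using uv ij by auto
      then consider "i < j" | "j < i" by linarith
      then show "e \<in> path_edges xs"
      proof cases
        case 1
        then show ?thesis using cons[of i j] ij uv unfolding path_edges_nth by auto
      next
        case 2
        have "e = {xs ! j, xs ! i}" using uv ij by auto
        then show ?thesis using cons[of j i] 2 ij unfolding path_edges_nth by auto
      qed
    qed
  qed
qed

lemma edges_by_segment: "E = (\<Union>s\<in>M. {e \<in> E. e \<subseteq> s})"
proof -
  have "\<exists>s\<in>M. e \<subseteq> s" if "e \<in> E" for e using edgeE[OF that] by (metis empty_subsetI insert_subset)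
  then show ?thesis by blast
qed

end

lemma closed_segment_ReIm:
  assumes "0 \<le> u" "u \<le> 1" "Re z = (1 - u) * Re p + u * Re q" "Im z = (1 - u) * Im p + u * Im q"
  shows "z \<in> closed_segment p q"
  unfolding closed_segment_def using assms by (auto intro!: exI[of _ u] simp: complex_eq_iff)

lemma collinear_on_line:
  fixes S :: "complex set"
  assumes "collinear S" "p \<in> S" "q \<in> S" "p \<noteq> q" "z \<in> S"
    and "\<alpha> * Re p + \<beta> * Im p = \<gamma>" "\<alpha> * Re q + \<beta> * Im q = \<gamma>"
  shows "\<alpha> * Re z + \<beta> * Im z = \<gamma>"
proof -
  obtain u v where uv: "\<And>x. x \<in> S \<Longrightarrow> \<exists>c. x = u + c *\<^sub>R v" using assms(1) unfolding collinear_alt by blast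
  obtain a b c where abc: "p = u + a *\<^sub>R v" "q = u + b *\<^sub>R v" "z = u + c *\<^sub>R v" using uv assms by metis
  have "a \<noteq> b" using abc assms(4) by auto
  have "(a - b) * (\<alpha> * Re v + \<beta> * Im v) = 0" using assms(6,7) unfolding abc by (simp add: algebra_simps)
  then have v0: "\<alpha> * Re v + \<beta> * Im v = 0" using \<open>a \<noteq> b\<close> by simp
  have "\<alpha> * Re z + \<beta> * Im z = (\<alpha> * Re p + \<beta> * Im p) + (c - a) * (\<alpha> * Re v + \<beta> * Im v)"
    unfolding abc by (simp add: algebra_simps)
  then show ?thesis using v0 assms(6) by simp
qed

text \<open>A triangle with corners \<open>0\<close>, \<open>vB\<close>, \<open>vC\<close>, its three medians, and \<open>n\<close> chords parallel to the side from \<open>vB\<close>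
  to \<open>vC\<close>, so close to \<open>0\<close> that they cross only the median from \<open>0\<close> to \<open>vP\<close>. The \<open>i\<close>th chord runs from \<open>a i\<close>
  to \<open>b i\<close> and crosses the median in \<open>s i\<close>. At index \<open>0\<close> the points are the feet of the other two
  medians and the centroid; at index \<open>Suc n\<close> all three are the corner \<open>0\<close>.\<close>

locale fan =
  fixes n :: nat
begin

text \<open>The sides on the axes have length \<open>2 * K\<close>, so their median feet are at
  distance \<open>K\<close> from the corner. The value n + 1 puts the ends of the chords at the
  integer distances 1 to n and makes index \<open>Suc n\<close> the corner itself.\<close>

definition K :: real where "K = real n + 1"

definition a :: "nat \<Rightarrow> complex" where "a i = Complex (K - real i) 0"
definition b :: "nat \<Rightarrow> complex" where "b i = Complex 0 (K - real i)"
definition s :: "nat \<Rightarrow> complex" where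
  "s i = (if i = 0 then Complex (2 * K / 3) (2 * K / 3) else Complex ((K - real i) / 2) ((K - real i) / 2))"
definition vB :: complex where "vB = Complex (2 * K) 0"
definition vC :: complex where "vC = Complex 0 (2 * K)"
definition vP :: complex where "vP = Complex K K"

lemma K: "K > 0" "K \<ge> 1" by (auto simp: K_def)

lemma K_eq [simp]: "K = real i \<longleftrightarrow> i = Suc n" "real i = K \<longleftrightarrow> i = Suc n"
  by (auto simp: K_def)

lemma coords [simp]:
  "Re (a i) = K - real i" "Im (a i) = 0" "Re (b i) = 0" "Im (b i) = K - real i"
  "Re (s i) = (if i = 0 then 2 * K / 3 else (K - real i) / 2)" "Im (s i) = Re (s i)"
  "Re vB = 2 * K" "Im vB = 0" "Re vC = 0" "Im vC = 2 * K" "Re vP = K" "Im vP = K"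
  by (auto simp: a_def b_def s_def vB_def vC_def vP_def)

lemma corner_zero [simp]: "a (Suc n) = 0" "b (Suc n) = 0" "s (Suc n) = 0"
  by (auto simp: complex_eq_iff K_def)

lemma zero_iff: "a i = 0 \<longleftrightarrow> i = Suc n" "b i = 0 \<longleftrightarrow> i = Suc n" "s i = 0 \<longleftrightarrow> i = Suc n"
  using K by (auto simp: complex_eq_iff)

lemma shared_points:
  "a i = b j \<longleftrightarrow> i = Suc n \<and> j = Suc n" "a i = s j \<longleftrightarrow> i = Suc n \<and> j = Suc n" "b i = s j \<longleftrightarrow> i = Suc n \<and> j = Suc n"
proof -
  have "a i = 0" if e: "a i = b j" using arg_cong[OF e, of Re] by (simp add: complex_eq_iff)
  then show "a i = b j \<longleftrightarrow> i = Suc n \<and> j = Suc n" using zero_iff(1)[of i] zero_iff(2)[of j] by auto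
  have "s j = 0" if e: "a i = s j" using arg_cong[OF e, of Im] unfolding complex_eq_iff coords by simp
  then show "a i = s j \<longleftrightarrow> i = Suc n \<and> j = Suc n" using zero_iff(1)[of i] zero_iff(3)[of j] by auto
  have "s j = 0" if e: "b i = s j" using arg_cong[OF e, of Re] unfolding complex_eq_iff coords by simp
  then show "b i = s j \<longleftrightarrow> i = Suc n \<and> j = Suc n" using zero_iff(2)[of i] zero_iff(3)[of j] by auto
qed

lemma apex_points:
  "vB \<noteq> a i" "vB \<noteq> b i" "vB \<noteq> s i" "vC \<noteq> a i" "vC \<noteq> b i" "vC \<noteq> s i" "vP \<noteq> a i" "vP \<noteq> b i" "vP \<noteq> s i"
  "vB \<noteq> vC" "vB \<noteq> vP" "vC \<noteq> vP"
  using K by (auto simp: complex_eq_iff)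

lemma inj_points: "a i = a j \<longleftrightarrow> i = j" "b i = b j \<longleftrightarrow> i = j" "s i = s j \<longleftrightarrow> i = j"
  using K by (auto simp: complex_eq_iff)

lemmas distinct_points = inj_points shared_points apex_points shared_points[THEN eq_commute[THEN trans]] apex_points[symmetric]

section \<open>The segments of the example\<close>

definition tri :: "complex set" where "tri = {z. 0 \<le> Re z \<and> 0 \<le> Im z \<and> Re z + Im z \<le> 2 * K}"

text \<open>Cutting the triangle by a line makes incidence with a segment a linear condition, and
  within the triangle the line is the segment.\<close>

definition chop :: "real \<Rightarrow> real \<Rightarrow> real \<Rightarrow> complex set" where
  "chop \<alpha> \<beta> \<gamma> = {z \<in> tri. \<alpha> * Re z + \<beta> * Im z = \<gamma>}"

abbreviation "AB \<equiv> chop 0 1 0"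
abbreviation "AC \<equiv> chop 1 0 0"
abbreviation "BC \<equiv> chop 1 1 (2 * K)"
abbreviation "AP \<equiv> chop 1 (- 1) 0"
abbreviation "BQ \<equiv> chop 1 2 (2 * K)"
abbreviation "CR \<equiv> chop 2 1 (2 * K)"
abbreviation "XY i \<equiv> chop 1 1 (K - real i)"

definition M :: "complex set set" where "M = {AB, AC, BC, AP, BQ, CR} \<union> XY ` {1..n}"

lemma convex_tri: "convex tri"
proof -
  have "tri = {z. Re z \<ge> 0} \<inter> {z. Im z \<ge> 0} \<inter> {z. Complex 1 1 \<bullet> z \<le> 2 * K}"
    by (auto simp: tri_def inner_complex_def)
  then show ?thesis by (simp add: convex_Int convex_halfspace_Re_ge convex_halfspace_Im_ge convex_halfspace_le)
qed

lemma tri_hull: "tri = convex hull {0, vB, vC}"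
proof
  show "convex hull {0, vB, vC} \<subseteq> tri" using convex_tri K by (intro hull_minimal) (auto simp: tri_def)
  show "tri \<subseteq> convex hull {0, vB, vC}"
  proof
    fix z assume z: "z \<in> tri"
    let ?v = "Re z / (2 * K)" and ?w = "Im z / (2 * K)"
    have 1: "z = (1 - ?v - ?w) *\<^sub>R 0 + ?v *\<^sub>R vB + ?w *\<^sub>R vC" using K by (simp add: complex_eq_iff)
    have 2: "0 \<le> ?v" "0 \<le> ?w" using z K by (auto simp: tri_def)
    have 3: "?v + ?w \<le> 1" using z K by (simp add: tri_def add_divide_distrib[symmetric])
    show "z \<in> convex hull {0, vB, vC}" unfolding convex_hull_3
      by (rule CollectI, rule exI[of _ "1 - ?v - ?w"], rule exI[of _ ?v], rule exI[of _ ?w], intro conjI)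
        (use 1 2 3 in \<open>simp_all\<close>)
  qed
qed

lemma chop_segment:
  assumes pq: "p \<in> chop \<alpha> \<beta> \<gamma>" "q \<in> chop \<alpha> \<beta> \<gamma>"
    and u: "\<And>z. z \<in> chop \<alpha> \<beta> \<gamma> \<Longrightarrow> \<exists>u. 0 \<le> u \<and> u \<le> 1 \<and> Re z = (1 - u) * Re p + u * Re q \<and> Im z = (1 - u) * Im p + u * Im q"
  shows "chop \<alpha> \<beta> \<gamma> = closed_segment p q"
proof
  show "chop \<alpha> \<beta> \<gamma> \<subseteq> closed_segment p q" using u closed_segment_ReIm by blast
  have "chop \<alpha> \<beta> \<gamma> = tri \<inter> {z. Complex \<alpha> \<beta> \<bullet> z = \<gamma>}" by (auto simp: chop_def inner_complex_def)
  then have "convex (chop \<alpha> \<beta> \<gamma>)" by (simp add: convex_tri convex_Int convex_hyperplane)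
  then show "closed_segment p q \<subseteq> chop \<alpha> \<beta> \<gamma>" using pq by (simp add: closed_segment_subset)
qed

lemma segs:
  "AB = closed_segment vB 0" "AC = closed_segment vC 0" "BC = closed_segment vB vC" "AP = closed_segment vP 0"
  "BQ = closed_segment vB (b 0)" "CR = closed_segment vC (a 0)"
  "i \<in> {1..n} \<Longrightarrow> XY i = closed_segment (a i) (b i)"
proof -
  note d = chop_def tri_def
  show "AB = closed_segment vB 0"
  proof (rule chop_segment)
    fix z assume "z \<in> AB"
    then show "\<exists>u. 0 \<le> u \<and> u \<le> 1 \<and> Re z = (1 - u) * Re vB + u * Re 0 \<and> Im z = (1 - u) * Im vB + u * Im 0"
      using K by (intro exI[of _ "1 - Re z / (2 * K)"]) (auto simp: d field_simps)
  qed (use K in \<open>auto simp: d\<close>)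
  show "AC = closed_segment vC 0"
  proof (rule chop_segment)
    fix z assume "z \<in> AC"
    then show "\<exists>u. 0 \<le> u \<and> u \<le> 1 \<and> Re z = (1 - u) * Re vC + u * Re 0 \<and> Im z = (1 - u) * Im vC + u * Im 0"
      using K by (intro exI[of _ "1 - Im z / (2 * K)"]) (auto simp: d field_simps)
  qed (use K in \<open>auto simp: d\<close>)
  show "BC = closed_segment vB vC"
  proof (rule chop_segment)
    fix z assume "z \<in> BC"
    then show "\<exists>u. 0 \<le> u \<and> u \<le> 1 \<and> Re z = (1 - u) * Re vB + u * Re vC \<and> Im z = (1 - u) * Im vB + u * Im vC"
      using K by (intro exI[of _ "Im z / (2 * K)"]) (auto simp: d left_diff_distrib divide_le_eq_1)
  qed (use K in \<open>auto simp: d\<close>)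
  show "AP = closed_segment vP 0"
  proof (rule chop_segment)
    fix z assume "z \<in> AP"
    then show "\<exists>u. 0 \<le> u \<and> u \<le> 1 \<and> Re z = (1 - u) * Re vP + u * Re 0 \<and> Im z = (1 - u) * Im vP + u * Im 0"
      using K by (intro exI[of _ "1 - Re z / K"]) (auto simp: d field_simps)
  qed (use K in \<open>auto simp: d\<close>)
  show "BQ = closed_segment vB (b 0)"
  proof (rule chop_segment)
    fix z assume "z \<in> BQ"
    then show "\<exists>u. 0 \<le> u \<and> u \<le> 1 \<and> Re z = (1 - u) * Re vB + u * Re (b 0) \<and> Im z = (1 - u) * Im vB + u * Im (b 0)"
      using K by (intro exI[of _ "Im z / K"]) (auto simp: d left_diff_distrib divide_le_eq_1)
  qed (use K in \<open>auto simp: d\<close>)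
  show "CR = closed_segment vC (a 0)"
  proof (rule chop_segment)
    fix z assume "z \<in> CR"
    then show "\<exists>u. 0 \<le> u \<and> u \<le> 1 \<and> Re z = (1 - u) * Re vC + u * Re (a 0) \<and> Im z = (1 - u) * Im vC + u * Im (a 0)"
      using K by (intro exI[of _ "Re z / K"]) (auto simp: d left_diff_distrib divide_le_eq_1)
  qed (use K in \<open>auto simp: d\<close>)
  show "XY i = closed_segment (a i) (b i)" if i: "i \<in> {1..n}"
  proof (rule chop_segment)
    have Ki: "K - real i > 0" "i \<noteq> Suc n" using i by (auto simp: K_def)
    fix z assume z: "z \<in> XY i"
    show "\<exists>u. 0 \<le> u \<and> u \<le> 1 \<and> Re z = (1 - u) * Re (a i) + u * Re (b i) \<and> Im z = (1 - u) * Im (a i) + u * Im (b i)"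
    proof (intro exI[of _ "Im z / (K - real i)"] conjI)
      have "Re z = (K - real i) - Im z" using z by (simp add: d)
      then show "Re z = (1 - Im z / (K - real i)) * Re (a i) + Im z / (K - real i) * Re (b i)"
        using Ki by (simp add: left_diff_distrib)
    qed (use z Ki in \<open>auto simp: d divide_le_eq_1\<close>)
  next
    have "real i \<le> real n" using i by simp
    then show "a i \<in> XY i" "b i \<in> XY i" by (auto simp: d K_def)
  qed
qed

section \<open>The vertices of the example\<close>

definition W :: "complex set" where "W = {vB, vC, vP} \<union> a ` {..Suc n} \<union> b ` {..Suc n} \<union> s ` {..Suc n}"

lemma W_I: "vB \<in> W" "vC \<in> W" "vP \<in> W" "i \<le> Suc n \<Longrightarrow> a i \<in> W" "i \<le> Suc n \<Longrightarrow> b i \<in> W" "i \<le> Suc n \<Longrightarrow> s i \<in> W" "0 \<in> W"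
proof -
  show "0 \<in> W" using corner_zero(1) unfolding W_def by (metis UnI1 UnI2 atMost_iff image_eqI order_refl)
qed (auto simp: W_def)

lemma M_segment:
  assumes "t \<in> M" obtains p q where "t = closed_segment p q" "p \<noteq> q" "p \<in> W" "q \<in> W"
proof -
  have z: "vB \<noteq> 0" "vC \<noteq> 0" "vP \<noteq> 0" using distinct_points corner_zero by metis+
  from assms consider "t = AB" | "t = AC" | "t = BC" | "t = AP" | "t = BQ" | "t = CR" | i where "i \<in> {1..n}" "t = XY i"
    unfolding M_def by blast
  then show ?thesis
  proof cases
    case 1 then show ?thesis using that[of vB 0] z W_I segs by simp
  next
    case 2 then show ?thesis using that[of vC 0] z W_I segs by simp
  next
    case 3 then show ?thesis using that[of vB vC] W_I segs distinct_points by simp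
  next
    case 4 then show ?thesis using that[of vP 0] z W_I segs by simp
  next
    case 5 then show ?thesis using that[of vB "b 0"] W_I segs distinct_points by simp
  next
    case 6 then show ?thesis using that[of vC "a 0"] W_I segs distinct_points by simp
  next
    case (7 i) then show ?thesis using that[of "a i" "b i"] W_I segs(7)[of i] distinct_points by simp
  qed
qed

lemma M_intersections:
  assumes "t \<in> M" "t' \<in> M" "t \<noteq> t'" "z \<in> t" "z \<in> t'" shows "z \<in> W"
proof -
  note d = chop_def tri_def
  have vBI: "z \<in> W" if "Re z = 2 * K" "Im z = 0" using that W_I(1) by (metis complex_eqI coords(7,8))
  have vCI: "z \<in> W" if "Re z = 0" "Im z = 2 * K" using that W_I(2) by (metis complex_eqI coords(9,10))
  have vPI: "z \<in> W" if "Re z = K" "Im z = K" using that W_I(3) by (metis complex_eqI coords(11,12))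
  have aI: "z \<in> W" if "Re z = K - real i" "Im z = 0" "i \<le> Suc n" for i using that W_I(4) by (metis complex_eqI coords(1,2))
  have bI: "z \<in> W" if "Re z = 0" "Im z = K - real i" "i \<le> Suc n" for i using that W_I(5) by (metis complex_eqI coords(3,4))
  have oI: "z \<in> W" if "Re z = 2 * K / 3" "Im z = 2 * K / 3"
  proof -
    have "z = s 0" using that by (simp add: complex_eq_iff)
    then show ?thesis using W_I(6)[of 0] by simp
  qed
  have sI: "z \<in> W" if "Re z = (K - real i) / 2" "Im z = (K - real i) / 2" "i \<in> {1..n}" for i
  proof -
    have "z = s i" using that by (simp add: complex_eq_iff)
    then show ?thesis using W_I(6)[of i] that by simp
  qed
  have zI: "z \<in> W" if "Re z = 0" "Im z = 0" using that W_I(7) by (metis complex_eqI zero_complex.sel)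
  have AB: "z \<in> AB \<Longrightarrow> z \<in> AC \<Longrightarrow> z \<in> W" "z \<in> AB \<Longrightarrow> z \<in> BC \<Longrightarrow> z \<in> W" "z \<in> AB \<Longrightarrow> z \<in> AP \<Longrightarrow> z \<in> W"
    "z \<in> AB \<Longrightarrow> z \<in> BQ \<Longrightarrow> z \<in> W" "z \<in> AB \<Longrightarrow> z \<in> CR \<Longrightarrow> z \<in> W" "i \<in> {1..n} \<Longrightarrow> z \<in> AB \<Longrightarrow> z \<in> XY i \<Longrightarrow> z \<in> W" for i
    using zI vBI aI[of 0] aI[of i] by (auto simp: d)
  have AC: "z \<in> AC \<Longrightarrow> z \<in> BC \<Longrightarrow> z \<in> W" "z \<in> AC \<Longrightarrow> z \<in> AP \<Longrightarrow> z \<in> W"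
    "z \<in> AC \<Longrightarrow> z \<in> BQ \<Longrightarrow> z \<in> W" "z \<in> AC \<Longrightarrow> z \<in> CR \<Longrightarrow> z \<in> W" "i \<in> {1..n} \<Longrightarrow> z \<in> AC \<Longrightarrow> z \<in> XY i \<Longrightarrow> z \<in> W" for i
    using zI vCI bI[of 0] bI[of i] by (auto simp: d)
  have BC: "z \<in> BC \<Longrightarrow> z \<in> AP \<Longrightarrow> z \<in> W" "z \<in> BC \<Longrightarrow> z \<in> BQ \<Longrightarrow> z \<in> W" "z \<in> BC \<Longrightarrow> z \<in> CR \<Longrightarrow> z \<in> W" 
    "i \<in> {1..n} \<Longrightarrow> z \<in> BC \<Longrightarrow> z \<in> XY i \<Longrightarrow> z \<in> W" for i
    using vPI vBI vCI K by (auto simp: d)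
  have AP: "z \<in> AP \<Longrightarrow> z \<in> BQ \<Longrightarrow> z \<in> W" "z \<in> AP \<Longrightarrow> z \<in> CR \<Longrightarrow> z \<in> W" "i \<in> {1..n} \<Longrightarrow> z \<in> AP \<Longrightarrow> z \<in> XY i \<Longrightarrow> z \<in> W"
    "z \<in> BQ \<Longrightarrow> z \<in> CR \<Longrightarrow> z \<in> W" for i
    using oI sI[of i] by (auto simp: d)
  have XY: "i \<in> {1..n} \<Longrightarrow> z \<in> BQ \<Longrightarrow> z \<in> XY i \<Longrightarrow> z \<in> W" "i \<in> {1..n} \<Longrightarrow> z \<in> CR \<Longrightarrow> z \<in> XY i \<Longrightarrow> z \<in> W"
    "z \<in> XY i \<Longrightarrow> z \<in> XY j \<Longrightarrow> i = j" for i j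
    by (auto simp: d K_def)
  \<comment> \<open>A symmetric relation, so one fact for each unordered pair of kinds of segments
    suffices.\<close>
  define P where "P t t' \<longleftrightarrow> (z \<in> t \<longrightarrow> z \<in> t' \<longrightarrow> t \<noteq> t' \<longrightarrow> z \<in> W)" for t t' :: "complex set"
  have "P AB AC" "P AB BC" "P AB AP" "P AB BQ" "P AB CR" "i \<in> {1..n} \<Longrightarrow> P AB (XY i)"
    "P AC BC" "P AC AP" "P AC BQ" "P AC CR" "i \<in> {1..n} \<Longrightarrow> P AC (XY i)"
    "P BC AP" "P BC BQ" "P BC CR" "i \<in> {1..n} \<Longrightarrow> P BC (XY i)"
    "P AP BQ" "P AP CR" "i \<in> {1..n} \<Longrightarrow> P AP (XY i)" "P BQ CR"
    "i \<in> {1..n} \<Longrightarrow> P BQ (XY i)" "i \<in> {1..n} \<Longrightarrow> P CR (XY i)" for i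
    by (simp_all add: P_def AB AC BC AP XY(1,2))
  note facts = this
  have sym: "P t' t" if "P t t'" for t t' using that by (auto simp: P_def)
  have more: "P t t" "P (XY i) (XY j)" for t i j using XY(3)[of i j] by (auto simp: P_def)
  have "P t t'" using assms(1,2) unfolding M_def
    by (elim UnE insertE imageE emptyE; hypsubst) (rule facts sym[OF facts(1)] more facts[THEN sym]; assumption?)+
  then show ?thesis using assms(3-5) by (auto simp: P_def)
qed

text \<open>The six coefficient pairs are pairwise linearly independent. Distinct segments with the
  same pair are parallel; with different pairs, collinearity of the union would put the second
  segment on two crossing lines.\<close>

lemma segment_system_M: "segment_system M"
  unfolding segment_system_def
proof (intro conjI ballI impI)
  show "finite M" by (simp add: M_def)
  show "\<exists>p q. p \<noteq> q \<and> t = closed_segment p q" if "t \<in> M" for t using M_segment[OF that] by metis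
  fix t t' assume t: "t \<in> M" "t' \<in> M" "t \<noteq> t' \<and> collinear (t \<union> t')"
  have form: "\<exists>\<alpha> \<beta> \<gamma>. (\<alpha>, \<beta>) \<in> {(0, 1), (1, 0), (1, 1), (1, - 1), (1, 2), (2, 1)} \<and> u = chop \<alpha> \<beta> \<gamma>" if "u \<in> M" for u
    using that unfolding M_def by blast
  obtain \<alpha> \<beta> \<gamma> where 1: "(\<alpha>, \<beta>) \<in> {(0, 1), (1, 0), (1, 1), (1, - 1), (1, 2), (2, 1)}" "t = chop \<alpha> \<beta> \<gamma>" using form[OF t(1)] by blast
  obtain \<alpha>' \<beta>' \<gamma>' where 2: "(\<alpha>', \<beta>') \<in> {(0, 1), (1, 0), (1, 1), (1, - 1), (1, 2), (2, 1)}" "t' = chop \<alpha>' \<beta>' \<gamma>'" using form[OF t(2)] by blast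
  show "t \<inter> t' = {}"
  proof (rule ccontr)
    assume "t \<inter> t' \<noteq> {}"
    then obtain z where z: "z \<in> t" "z \<in> t'" by blast
    have "(\<alpha>, \<beta>) \<noteq> (\<alpha>', \<beta>')"
    proof
      assume "(\<alpha>, \<beta>) = (\<alpha>', \<beta>')"
      moreover then have "\<gamma> = \<gamma>'" using z 1(2) 2(2) by (auto simp: chop_def)
      ultimately show False using t 1(2) 2(2) by simp
    qed
    then have det: "\<alpha> * \<beta>' - \<alpha>' * \<beta> \<noteq> 0" using 1(1) 2(1) by auto
    obtain p q where pq: "t = closed_segment p q" "p \<noteq> q" using M_segment[OF t(1)] by metis
    obtain p' q' where pq': "t' = closed_segment p' q'" "p' \<noteq> q'" using M_segment[OF t(2)] by metis
    have mem: "p \<in> t" "q \<in> t" "p' \<in> t'" "q' \<in> t'" using pq pq' by auto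
    have l: "\<alpha> * Re p + \<beta> * Im p = \<gamma>" "\<alpha> * Re q + \<beta> * Im q = \<gamma>" using mem(1,2) unfolding 1(2) chop_def by blast+
    have eq: "\<alpha> * Re x + \<beta> * Im x = \<gamma>" if "x \<in> t'" for x
      using collinear_on_line[OF conjunct2[OF t(3)] _ _ pq(2) _ l] mem that by blast
    have eq': "\<alpha>' * Re x + \<beta>' * Im x = \<gamma>'" if "x \<in> t'" for x using that unfolding 2(2) chop_def by blast
    define x y where "x = Re p' - Re q'" and "y = Im p' - Im q'"
    have xy: "\<alpha> * x + \<beta> * y = 0" "\<alpha>' * x + \<beta>' * y = 0"
      using eq[OF mem(3)] eq[OF mem(4)] eq'[OF mem(3)] eq'[OF mem(4)] by (simp_all add: x_def y_def algebra_simps)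
    have "(\<alpha> * \<beta>' - \<alpha>' * \<beta>) * x = \<beta>' * (\<alpha> * x + \<beta> * y) - \<beta> * (\<alpha>' * x + \<beta>' * y)"
      "(\<alpha> * \<beta>' - \<alpha>' * \<beta>) * y = \<alpha> * (\<alpha>' * x + \<beta>' * y) - \<alpha>' * (\<alpha> * x + \<beta> * y)" by (simp_all add: algebra_simps)
    then have "(\<alpha> * \<beta>' - \<alpha>' * \<beta>) * x = 0" "(\<alpha> * \<beta>' - \<alpha>' * \<beta>) * y = 0"
      unfolding xy by simp_all
    then have "x = 0" "y = 0" using det by simp_all
    then show False using pq'(2) by (simp add: x_def y_def complex_eq_iff)
  qed
qed

lemma seg_verts_M: "seg_verts M = W"
proof
  show "seg_verts M \<subseteq> W"
  proof
    fix x assume "x \<in> seg_verts M"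
    then consider "x \<in> intersection_points M" | "x \<in> segment_endpoints M" by (auto simp: seg_verts_def)
    then show "x \<in> W"
    proof cases
      case 1 then show ?thesis using M_intersections by (auto simp: intersection_points_def)
    next
      case 2
      then obtain y where "closed_segment x y \<in> M" by (auto simp: segment_endpoints_def)
      then obtain p q where "closed_segment x y = closed_segment p q" "p \<in> W" "q \<in> W" using M_segment by metis
      then show ?thesis by (auto simp: closed_segment_eq doubleton_eq_iff)
    qed
  qed
  have ends: "p \<in> seg_verts M \<and> q \<in> seg_verts M" if "closed_segment p q \<in> M" for p q
    using that by (auto simp: seg_verts_def segment_endpoints_def) (metis closed_segment_commute)
  have inM: "AB \<in> M" "AC \<in> M" "BC \<in> M" "AP \<in> M" "BQ \<in> M" "CR \<in> M" "i \<in> {1..n} \<Longrightarrow> XY i \<in> M" for i by (auto simp: M_def)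
  have v: "vB \<in> seg_verts M" "0 \<in> seg_verts M" "vC \<in> seg_verts M" "vP \<in> seg_verts M" "b 0 \<in> seg_verts M" "a 0 \<in> seg_verts M"
    "i \<in> {1..n} \<Longrightarrow> a i \<in> seg_verts M" "i \<in> {1..n} \<Longrightarrow> b i \<in> seg_verts M" for i
    using ends inM segs by metis+
  have cases: "i = 0 \<or> i \<in> {1..n} \<or> i = Suc n" if "i \<le> Suc n" for i using that by auto
  have "a i \<in> seg_verts M" "b i \<in> seg_verts M" if "i \<le> Suc n" for i using cases[OF that] v by auto
  moreover have "s i \<in> seg_verts M" if i: "i \<le> Suc n" for i
  proof -
    have both: "x \<in> seg_verts M" if "t \<in> M" "t' \<in> M" "x \<in> t" "x \<in> t'" "vP \<in> t" "vP \<notin> t'" for x t t'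
      using that by (auto simp: seg_verts_def intersection_points_def)
    consider "i = 0" | "i \<in> {1..n}" | "i = Suc n" using cases[OF i] by blast
    then show ?thesis
    proof cases
      case 1 then show ?thesis using both[OF inM(4,5), of "s 0"] K by (auto simp: chop_def tri_def)
    next
      case 2 then show ?thesis using both[OF inM(4) inM(7)[OF 2], of "s i"] K by (auto simp: chop_def tri_def K_def)
    next
      case 3 then show ?thesis using v by simp
    qed
  qed
  ultimately show "W \<subseteq> seg_verts M" using v unfolding W_def by auto
qed

sublocale segments M
  by unfold_locales (auto simp: segment_system_M seg_verts_M W_def)

section \<open>The edges of the example\<close>

lemma Re_inj: "\<beta> \<noteq> 0 \<Longrightarrow> inj_on Re (chop \<alpha> \<beta> \<gamma>)" and Im_inj: "\<alpha> \<noteq> 0 \<Longrightarrow> inj_on Im (chop \<alpha> \<beta> \<gamma>)"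
  by (auto simp: inj_on_def chop_def complex_eq_iff)

text \<open>Each list follows its segment with falling real or imaginary part, the order expected by
  \<open>seg_path_edges\<close>, and ends in the corner 0.\<close>

definition "lAB = vB # map a [0..<Suc (Suc n)]"
definition "lAC = vC # map b [0..<Suc (Suc n)]"
definition "lAP = vP # map s [0..<Suc (Suc n)]"

lemma set_lists:
  "set lAB = insert vB (a ` {..Suc n})" "set lAC = insert vC (b ` {..Suc n})" "set lAP = insert vP (s ` {..Suc n})"
  by (auto simp: lAB_def lAC_def lAP_def atLeast0LessThan lessThan_Suc_atMost simp del: upt_Suc)

lemma verts_on:
  "W \<inter> AB = set lAB" "W \<inter> AC = set lAC" "W \<inter> AP = set lAP"
  "W \<inter> BC = set [vB, vP, vC]" "W \<inter> BQ = set [vB, s 0, b 0]" "W \<inter> CR = set [vC, s 0, a 0]"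
  "i \<in> {1..n} \<Longrightarrow> W \<inter> XY i = set [a i, s i, b i]"
proof -
  note d = chop_def tri_def
  have zin: "0 \<in> a ` {..Suc n}" "0 \<in> b ` {..Suc n}" "0 \<in> s ` {..Suc n}"
    using corner_zero by (metis atMost_iff image_eqI order_refl)+
  have le: "real j \<le> K" if "j \<le> Suc n" for j using that by (simp add: K_def)
  have neg: "K - real j \<noteq> 2 * K" "K \<noteq> - real j" for j using K by auto
  show "W \<inter> AB = set lAB" unfolding set_lists W_def using K zin le by (auto simp: d split: if_splits)
  show "W \<inter> AC = set lAC" unfolding set_lists W_def using K zin le by (auto simp: d split: if_splits)
  show "W \<inter> AP = set lAP" unfolding set_lists W_def using K zin le by (auto simp: d split: if_splits)
  show "W \<inter> BC = set [vB, vP, vC]" unfolding W_def using K by (auto simp: d neg split: if_splits)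
  show "W \<inter> BQ = set [vB, s 0, b 0]" unfolding W_def using K by (auto simp: d neg split: if_splits)
  show "W \<inter> CR = set [vC, s 0, a 0]" unfolding W_def using K by (auto simp: d neg split: if_splits)
  show "W \<inter> XY i = set [a i, s i, b i]" if i: "i \<in> {1..n}"
    unfolding W_def using K i le[of i] by (auto simp: d neg split: if_splits)
qed

lemma path_edges_map_upt: "path_edges (map f [0..<Suc m]) = (\<lambda>i. {f i, f (Suc i)}) ` {..<m}"
  unfolding path_edges_nth by (force simp: nth_append simp del: upt_Suc)

lemma sorted_map_upt:
  assumes "\<And>i j. i < j \<Longrightarrow> f (g j) < (f (g i) :: real)"
  shows "sorted_wrt (\<lambda>x y. f y < f x) (map g [0..<m])"
  unfolding sorted_wrt_map by (rule sorted_wrt_mono_rel[OF _ sorted_wrt_upt]) (use assms in auto)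

definition "boundary_edges = path_edges lAB \<union> path_edges lAC \<union> path_edges [vB, vP, vC]"

text \<open>The parameter cuts the spine at \<open>s (Suc k)\<close>, so that the tree can be built
  by induction; for \<open>k = n\<close> the spine reaches the corner 0.\<close>

definition tree_edges :: "nat \<Rightarrow> complex set set" where
  "tree_edges k = (\<Union>i\<le>k. {{s i, s (Suc i)}, {s i, a i}, {s i, b i}}) \<union> {{s 0, vB}, {s 0, vP}, {s 0, vC}}"

lemma edges_on:
  "{e \<in> seg_edges M. e \<subseteq> AB} = path_edges lAB" "{e \<in> seg_edges M. e \<subseteq> AC} = path_edges lAC"
  "{e \<in> seg_edges M. e \<subseteq> BC} = path_edges [vB, vP, vC]" "{e \<in> seg_edges M. e \<subseteq> AP} = path_edges lAP"
  "{e \<in> seg_edges M. e \<subseteq> BQ} = path_edges [vB, s 0, b 0]" "{e \<in> seg_edges M. e \<subseteq> CR} = path_edges [vC, s 0, a 0]"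
  "i \<in> {1..n} \<Longrightarrow> {e \<in> seg_edges M. e \<subseteq> XY i} = path_edges [a i, s i, b i]"
proof -
  have lin: "linear Re" "linear Im" by (simp_all add: bounded_linear.linear bounded_linear_Re bounded_linear_Im)
  have sr: "sorted_wrt (\<lambda>x y. Re y < Re x) lAB" "sorted_wrt (\<lambda>x y. Im y < Im x) lAC" "sorted_wrt (\<lambda>x y. Re y < Re x) lAP"
    using K sorted_map_upt[of Re a] sorted_map_upt[of Im b] sorted_map_upt[of Re s]
    by (auto simp: lAB_def lAC_def lAP_def simp del: upt_Suc)
  have inM: "AB \<in> M" "AC \<in> M" "BC \<in> M" "AP \<in> M" "BQ \<in> M" "CR \<in> M" "i \<in> {1..n} \<Longrightarrow> XY i \<in> M" for i by (auto simp: M_def)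
  show "{e \<in> seg_edges M. e \<subseteq> AB} = path_edges lAB"
    by (rule seg_path_edges[OF inM(1) lin(1) Re_inj _ sr(1)]) (simp_all add: seg_verts_M verts_on)
  show "{e \<in> seg_edges M. e \<subseteq> AC} = path_edges lAC"
    by (rule seg_path_edges[OF inM(2) lin(2) Im_inj _ sr(2)]) (simp_all add: seg_verts_M verts_on)
  show "{e \<in> seg_edges M. e \<subseteq> AP} = path_edges lAP"
    by (rule seg_path_edges[OF inM(4) lin(1) Re_inj _ sr(3)]) (simp_all add: seg_verts_M verts_on)
  show "{e \<in> seg_edges M. e \<subseteq> BC} = path_edges [vB, vP, vC]"
    by (rule seg_path_edges[OF inM(3) lin(1) Re_inj]) (use K in \<open>simp_all add: seg_verts_M verts_on\<close>)
  show "{e \<in> seg_edges M. e \<subseteq> BQ} = path_edges [vB, s 0, b 0]"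
    by (rule seg_path_edges[OF inM(5) lin(1) Re_inj]) (use K in \<open>simp_all add: seg_verts_M verts_on\<close>)
  show "{e \<in> seg_edges M. e \<subseteq> CR} = path_edges [vC, s 0, a 0]"
    by (rule seg_path_edges[OF inM(6) lin(2) Im_inj]) (use K in \<open>simp_all add: seg_verts_M verts_on\<close>)
  show "{e \<in> seg_edges M. e \<subseteq> XY i} = path_edges [a i, s i, b i]" if i: "i \<in> {1..n}"
  proof -
    have "real i < K" "i \<noteq> 0" using i by (auto simp: K_def)
    then show ?thesis by (intro seg_path_edges[OF inM(7)[OF i] lin(1) Re_inj]) (simp_all add: seg_verts_M verts_on(7)[OF i])
  qed
qed

lemma tree_edges_eq:
  "tree_edges n = path_edges lAP \<union> path_edges [vB, s 0, b 0] \<union> path_edges [vC, s 0, a 0] \<union> (\<Union>i\<in>{1..n}. path_edges [a i, s i, b i])"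
proof -
  let ?S = "(\<lambda>i. {s i, s (Suc i)}) ` {..n}" and ?L = "\<Union>i\<in>{1..n}. {{s i, a i}, {s i, b i}}"
  have P: "path_edges lAP = insert {s 0, vP} ?S"
    unfolding lAP_def path_edges_Cons path_edges_map_upt by (simp add: hd_map lessThan_Suc_atMost insert_commute del: upt_Suc)
  have path3: "path_edges [x, y, z] = {{y, x}, {y, z}}" for x y z :: complex by (simp add: insert_commute)
  have un: "(\<Union>i\<in>I. insert (f i) (X i)) = f ` I \<union> (\<Union>i\<in>I. X i)" for f and X :: "nat \<Rightarrow> complex set set" and I by blast
  have at: "{..n} = insert 0 {1..n}" by auto
  have T: "tree_edges n = ?S \<union> ({{s 0, a 0}, {s 0, b 0}} \<union> ?L) \<union> {{s 0, vB}, {s 0, vP}, {s 0, vC}}"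
    unfolding tree_edges_def un[of _ "\<lambda>i. {{s i, a i}, {s i, b i}}"] by (simp only: at UN_insert)
  have gen: "A \<union> ({p, q} \<union> B) \<union> {u, v, w} = insert v A \<union> {u, q} \<union> {w, p} \<union> B"
    for A B :: "complex set set" and p q u v w by blast
  show ?thesis unfolding T P path3 by (rule gen)
qed

lemma seg_edges_M: "seg_edges M = tree_edges n \<union> boundary_edges"
proof -
  have "seg_edges M = (\<Union>t\<in>M. {e \<in> seg_edges M. e \<subseteq> t})" by (rule edges_by_segment)
  also have "\<dots> = path_edges lAB \<union> path_edges lAC \<union> path_edges [vB, vP, vC] \<union> path_edges lAP \<union> path_edges [vB, s 0, b 0]
      \<union> path_edges [vC, s 0, a 0] \<union> (\<Union>i\<in>{1..n}. path_edges [a i, s i, b i])"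
  proof -
    have gen: "(\<Union>t\<in>M. g t) = g AB \<union> g AC \<union> g BC \<union> g AP \<union> g BQ \<union> g CR \<union> (\<Union>i\<in>{1..n}. g (XY i))"
      for g :: "complex set \<Rightarrow> complex set set" unfolding M_def by (simp add: Un_assoc)
    have "(\<Union>i\<in>{1..n}. {e \<in> seg_edges M. e \<subseteq> XY i}) = (\<Union>i\<in>{1..n}. path_edges [a i, s i, b i])"
      by (rule SUP_cong[OF refl edges_on(7)])
    then show ?thesis unfolding gen edges_on(1-6) by (rule arg_cong)
  qed
  finally show ?thesis unfolding tree_edges_eq boundary_edges_def by (simp only: Un_ac)
qed

section \<open>The boundary walk of the example\<close>

primrec dn :: "nat \<Rightarrow> (complex \<times> complex) list" where
  "dn 0 = [(s 0, s 1)]"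
| "dn (Suc k) = dn k @ [(s (Suc k), b (Suc k)), (b (Suc k), s (Suc k)), (s (Suc k), s (Suc (Suc k)))]"

primrec up :: "nat \<Rightarrow> (complex \<times> complex) list" where
  "up 0 = [(s 1, s 0)]"
| "up (Suc k) = [(s (Suc (Suc k)), s (Suc k)), (s (Suc k), a (Suc k)), (a (Suc k), s (Suc k))] @ up k"

text \<open>The walk leaves the centroid along the spine past the leaves \<open>b i\<close>
  (\<open>dn\<close>), returns past the leaves \<open>a i\<close> (\<open>up\<close>), and then
  visits the five leaves at the centroid.\<close>

definition "hub = [(s 0, a 0), (a 0, s 0), (s 0, vB), (vB, s 0), (s 0, vP), (vP, s 0), (s 0, vC), (vC, s 0), (s 0, b 0), (b 0, s 0)]"

definition tree_verts :: "nat \<Rightarrow> complex set" where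
  "tree_verts k = s ` {..Suc k} \<union> a ` {..k} \<union> b ` {..k} \<union> {vB, vC, vP}"

lemma fan_walk: "k \<le> n \<Longrightarrow> plane_walk (tree_verts k) (tree_edges k) (dn k @ up k @ hub)"
proof (induction k)
  case 0
  have w0: "plane_walk {s 0, s 1} {{s 0, s 1}} ([(s 0, s 1)] @ (s 1, s 0) # [])"
    using plane_walk.base[of "s 0" "s 1"] distinct_points by simp
  have w1: "plane_walk (insert (a 0) {s 0, s 1}) (insert {s 0, a 0} {{s 0, s 1}}) ([(s 0, s 1)] @ (s 1, s 0) # (s 0, a 0) # (a 0, s 0) # [])"
    by (rule plane_walk.step[OF w0]) (auto simp: distinct_points)
  have w2: "plane_walk (insert vB (insert (a 0) {s 0, s 1})) (insert {s 0, vB} (insert {s 0, a 0} {{s 0, s 1}}))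
     ([(s 0, s 1), (s 1, s 0), (s 0, a 0)] @ (a 0, s 0) # (s 0, vB) # (vB, s 0) # [])"
    by (rule plane_walk.step) (use w1 in \<open>auto simp: distinct_points\<close>)
  have w3: "plane_walk (insert vP (insert vB (insert (a 0) {s 0, s 1}))) (insert {s 0, vP} (insert {s 0, vB} (insert {s 0, a 0} {{s 0, s 1}})))
     ([(s 0, s 1), (s 1, s 0), (s 0, a 0), (a 0, s 0), (s 0, vB)] @ (vB, s 0) # (s 0, vP) # (vP, s 0) # [])"
    by (rule plane_walk.step) (use w2 in \<open>auto simp: distinct_points\<close>)
  have w4: "plane_walk (insert vC (insert vP (insert vB (insert (a 0) {s 0, s 1}))))
     (insert {s 0, vC} (insert {s 0, vP} (insert {s 0, vB} (insert {s 0, a 0} {{s 0, s 1}}))))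
     ([(s 0, s 1), (s 1, s 0), (s 0, a 0), (a 0, s 0), (s 0, vB), (vB, s 0), (s 0, vP)] @ (vP, s 0) # (s 0, vC) # (vC, s 0) # [])"
    by (rule plane_walk.step) (use w3 in \<open>auto simp: distinct_points\<close>)
  have w5: "plane_walk (insert (b 0) (insert vC (insert vP (insert vB (insert (a 0) {s 0, s 1})))))
     (insert {s 0, b 0} (insert {s 0, vC} (insert {s 0, vP} (insert {s 0, vB} (insert {s 0, a 0} {{s 0, s 1}})))))
     ([(s 0, s 1), (s 1, s 0), (s 0, a 0), (a 0, s 0), (s 0, vB), (vB, s 0), (s 0, vP), (vP, s 0), (s 0, vC)] @ (vC, s 0) # (s 0, b 0) # (b 0, s 0) # [])"
    by (rule plane_walk.step) (use w4 in \<open>auto simp: distinct_points\<close>)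
  have "tree_verts 0 = insert (b 0) (insert vC (insert vP (insert vB (insert (a 0) {s 0, s 1}))))"
    by (auto simp: tree_verts_def atMost_Suc)
  moreover have "tree_edges 0 = insert {s 0, b 0} (insert {s 0, vC} (insert {s 0, vP} (insert {s 0, vB} (insert {s 0, a 0} {{s 0, s 1}}))))"
    by (auto simp: tree_edges_def)
  ultimately show ?case using w5 by (simp add: hub_def)
next
  case (Suc k)
  have "\<exists>X. dn k = X @ [(s k, s (Suc k))]" by (cases k) auto
  \<comment> \<open>The three new vertices are all attached right after the dart from
    \<open>s k\<close> into \<open>s (Suc k)\<close>, hence in the reverse of the order in which the
    walk visits them.\<close>
  then obtain X where X: "dn k = X @ [(s k, s (Suc k))]" by blast
  let ?u = "s (Suc k)" and ?Y = "up k @ hub"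
  have w0: "plane_walk (tree_verts k) (tree_edges k) (X @ (s k, ?u) # ?Y)" using Suc X by simp
  have w1: "plane_walk (insert (a (Suc k)) (tree_verts k)) (insert {?u, a (Suc k)} (tree_edges k))
      (X @ (s k, ?u) # (?u, a (Suc k)) # (a (Suc k), ?u) # ?Y)"
    by (rule plane_walk.step[OF w0]) (use Suc.prems in \<open>auto simp: tree_verts_def distinct_points\<close>)
  have w2: "plane_walk (insert (s (Suc (Suc k))) (insert (a (Suc k)) (tree_verts k)))
      (insert {?u, s (Suc (Suc k))} (insert {?u, a (Suc k)} (tree_edges k)))
      (X @ (s k, ?u) # (?u, s (Suc (Suc k))) # (s (Suc (Suc k)), ?u) # (?u, a (Suc k)) # (a (Suc k), ?u) # ?Y)"
    by (rule plane_walk.step[OF w1]) (use Suc.prems in \<open>auto simp: tree_verts_def distinct_points\<close>)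
  have w3: "plane_walk (insert (b (Suc k)) (insert (s (Suc (Suc k))) (insert (a (Suc k)) (tree_verts k))))
      (insert {?u, b (Suc k)} (insert {?u, s (Suc (Suc k))} (insert {?u, a (Suc k)} (tree_edges k))))
      (X @ (s k, ?u) # (?u, b (Suc k)) # (b (Suc k), ?u) # (?u, s (Suc (Suc k))) # (s (Suc (Suc k)), ?u) # (?u, a (Suc k)) # (a (Suc k), ?u) # ?Y)"
    by (rule plane_walk.step[OF w2]) (use Suc.prems in \<open>auto simp: tree_verts_def distinct_points\<close>)
  have "tree_verts (Suc k) = insert (b (Suc k)) (insert (s (Suc (Suc k))) (insert (a (Suc k)) (tree_verts k)))"
    by (auto simp: tree_verts_def atMost_Suc)
  moreover have "tree_edges (Suc k) = insert {?u, b (Suc k)} (insert {?u, s (Suc (Suc k))} (insert {?u, a (Suc k)} (tree_edges k)))"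
    by (auto simp: tree_edges_def atMost_Suc)
  ultimately show ?case using w3 X by simp
qed

lemma tree_verts_eq: "tree_verts n = W"
proof -
  have "a (Suc n) = s (Suc n)" "b (Suc n) = s (Suc n)" by simp_all
  then show ?thesis unfolding tree_verts_def W_def atMost_Suc[of n] by auto
qed

lemma tree_edge_cases:
  assumes "e \<in> tree_edges n"
  obtains (spine) j where "j \<le> n" "e = {s j, s (Suc j)}" | (left) j where "j \<le> n" "e = {s j, a j}"
    | (right) j where "j \<le> n" "e = {s j, b j}" | (top) v where "v \<in> {vB, vC, vP}" "e = {s 0, v}"
proof -
  from assms consider j where "j \<le> n" "e \<in> {{s j, s (Suc j)}, {s j, a j}, {s j, b j}}" | "e \<in> {{s 0, vB}, {s 0, vP}, {s 0, vC}}"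
    unfolding tree_edges_def by blast
  then show ?thesis
  proof cases
    case (1 j) then show ?thesis using that(1-3)[of j] by blast
  next
    case 2 then show ?thesis using that(4) by blast
  qed
qed

lemma degree_one:
  "i \<le> n \<Longrightarrow> vdegree (tree_edges n) (a i) = 1" "i \<le> n \<Longrightarrow> vdegree (tree_edges n) (b i) = 1"
  "v \<in> {vB, vC, vP} \<Longrightarrow> vdegree (tree_edges n) v = 1" "vdegree (tree_edges n) (s (Suc n)) = 1"
proof -
  have one: "vdegree (tree_edges n) v = 1"
    if "f \<in> tree_edges n" "v \<in> f" "\<And>e. e \<in> tree_edges n \<Longrightarrow> v \<in> e \<Longrightarrow> e = f" for v f
  proof -
    have "{e \<in> tree_edges n. v \<in> e} = {f}"
    proof (intro equalityI subsetI)
      fix e assume "e \<in> {e \<in> tree_edges n. v \<in> e}" then show "e \<in> {f}" using that(3) by simp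
    next
      fix e assume "e \<in> {f}" then show "e \<in> {e \<in> tree_edges n. v \<in> e}" using that(1,2) by simp
    qed
    then show ?thesis unfolding vdegree_def by simp
  qed
  show "vdegree (tree_edges n) (a i) = 1" if i: "i \<le> n"
  proof (rule one[of "{s i, a i}"])
    fix e assume e: "e \<in> tree_edges n" "a i \<in> e"
    have "a i \<noteq> s j" "a i \<noteq> b j" for j using i by (simp_all add: shared_points)
    with e show "e = {s i, a i}" by (cases rule: tree_edge_cases) (auto simp: inj_points apex_points apex_points[symmetric])
  qed (use i in \<open>auto simp: tree_edges_def\<close>)
  show "vdegree (tree_edges n) (b i) = 1" if i: "i \<le> n"
  proof (rule one[of "{s i, b i}"])
    fix e assume e: "e \<in> tree_edges n" "b i \<in> e"
    have "b i \<noteq> s j" "b i \<noteq> a j" for j using i distinct_points by auto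
    with e show "e = {s i, b i}" by (cases rule: tree_edge_cases) (auto simp: inj_points apex_points apex_points[symmetric])
  qed (use i in \<open>auto simp: tree_edges_def\<close>)
  show "vdegree (tree_edges n) v = 1" if v: "v \<in> {vB, vC, vP}"
  proof (rule one[of "{s 0, v}"])
    fix e assume e: "e \<in> tree_edges n" "v \<in> e"
    have "v \<noteq> s j" "v \<noteq> a j" "v \<noteq> b j" for j using v apex_points by (metis empty_iff insert_iff)+
    with e show "e = {s 0, v}" by (cases rule: tree_edge_cases) auto
  qed (use v in \<open>auto simp: tree_edges_def\<close>)
  show "vdegree (tree_edges n) (s (Suc n)) = 1"
  proof (rule one[of "{s n, s (Suc n)}"])
    fix e assume e: "e \<in> tree_edges n" "s (Suc n) \<in> e"
    have ne: "a j \<noteq> s (Suc n)" "b j \<noteq> s (Suc n)" "s j \<noteq> s (Suc n)" if "j \<le> n" for j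
      unfolding shared_points inj_points using that by auto
    have ne': "s (Suc n) \<notin> {vB, vC, vP}" using apex_points(3,6,9)[of "Suc n"] by (metis empty_iff insert_iff)
    from e(1) show "e = {s n, s (Suc n)}"
    proof (cases rule: tree_edge_cases)
      case (spine j)
      then have "s (Suc n) = s (Suc j)" using e(2) ne(3)[OF spine(1)] by (metis insertE singletonD)
      then show ?thesis using spine inj_points(3)[of "Suc n" "Suc j"] by simp
    next
      case (left j) then show ?thesis using e(2) ne(1,3)[OF left(1)] by (metis insertE singletonD)
    next
      case (right j) then show ?thesis using e(2) ne(2,3)[OF right(1)] by (metis insertE singletonD)
    next
      case (top v) then show ?thesis using e(2) ne(3)[of 0] ne' by (metis insertE singletonD le0)
    qed
  next
    show "{s n, s (Suc n)} \<in> tree_edges n" unfolding tree_edges_def by blast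
  qed simp
qed

lemma degree_inner: assumes "i \<le> n" shows "3 \<le> vdegree (tree_edges n) (s i)"
proof -
  have "finite (tree_edges n)" by (simp add: tree_edges_def)
  moreover have "{{s i, s (Suc i)}, {s i, a i}, {s i, b i}} \<subseteq> {e \<in> tree_edges n. s i \<in> e}"
    using assms by (auto simp: tree_edges_def)
  ultimately have "card {{s i, s (Suc i)}, {s i, a i}, {s i, b i}} \<le> vdegree (tree_edges n) (s i)"
    unfolding vdegree_def by (intro card_mono) auto
  moreover have "card {{s i, s (Suc i)}, {s i, a i}, {s i, b i}} = 3"
    using assms by (auto simp: card_insert_if doubleton_eq_iff distinct_points simp del: corner_zero)
  ultimately show ?thesis by simp
qed

definition "fan_leaves = map b [1..<Suc n] @ [s (Suc n)] @ rev (map a [1..<Suc n]) @ [a 0, vB, vP, vC, b 0]"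

lemma fan_leaves_walk: "filter (\<lambda>v. vdegree (tree_edges n) v = 1) (map fst (dn n @ up n @ hub)) = fan_leaves"
proof -
  let ?P = "\<lambda>v. vdegree (tree_edges n) v = 1"
  have s: "vdegree (tree_edges n) (s i) \<noteq> Suc 0" if "i \<le> n" for i using degree_inner[OF that] by simp
  have D: "filter ?P (map fst (dn k)) = map b [1..<Suc k]" if "k \<le> n" for k
    using that by (induction k) (auto simp: s degree_one)
  have U: "filter ?P (map fst (up k)) = filter ?P [s (Suc k)] @ rev (map a [1..<Suc k])" if "k \<le> n" for k
    using that by (induction k) (simp_all add: s degree_one(1) del: corner_zero)
  have A: "filter ?P [s (Suc n)] = [s (Suc n)]" using degree_one(4) by (simp del: corner_zero)
  have H: "filter ?P (map fst hub) = [a 0, vB, vP, vC, b 0]" using s[of 0] by (simp add: hub_def degree_one)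
  show ?thesis unfolding map_append filter_append D[OF order_refl] U[OF order_refl] A H fan_leaves_def by simp
qed

text \<open>Rotated to start at \<open>vC\<close>, the leaves follow the side \<open>AC\<close> to
  the corner 0, then \<open>AB\<close> to \<open>vB\<close>, then \<open>BC\<close> through
  \<open>vP\<close>.\<close>

lemma cycle_fan_leaves: "cycle_edges fan_leaves = boundary_edges"
proof -
  let ?b = "map b [0..<Suc (Suc n)]" and ?a = "map a [0..<Suc n]"
  have up0: "[0..<Suc n] = 0 # [1..<Suc n]" by (simp add: upt_rec)
  have "fan_leaves = (map b [1..<Suc n] @ [s (Suc n)] @ rev (map a [1..<Suc n]) @ [a 0, vB, vP]) @ [vC, b 0]"
    by (simp add: fan_leaves_def)
  then have "cycle_edges fan_leaves = cycle_edges ([vC, b 0] @ (map b [1..<Suc n] @ [s (Suc n)] @ rev (map a [1..<Suc n]) @ [a 0, vB, vP]))"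
    using cycle_edges_swap by metis
  also have "[vC, b 0] @ (map b [1..<Suc n] @ [s (Suc n)] @ rev (map a [1..<Suc n]) @ [a 0, vB, vP]) = lAC @ rev ?a @ [vB, vP]"
  proof -
    have "[0..<Suc (Suc n)] = 0 # [1..<Suc n] @ [Suc n]" 
      using upt_Suc_append[of 0 "Suc n"] unfolding up0 by (simp del: upt_Suc)
    then show ?thesis unfolding lAC_def up0 by (simp del: upt_Suc)
  qed
  also have "cycle_edges (lAC @ rev ?a @ [vB, vP]) = insert {vP, vC} (path_edges (lAC @ rev ?a @ [vB, vP]))"
    by (subst cycle_edges_eq) (auto simp: lAC_def)
  also have "path_edges (lAC @ rev ?a @ [vB, vP]) = path_edges lAC \<union> path_edges (b (Suc n) # rev ?a @ [vB]) \<union> {{vB, vP}}"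
    by (auto simp: path_edges_append path_edges_Cons lAC_def hd_rev last_rev simp del: corner_zero)
  \<comment> \<open>\<open>b (Suc n)\<close> and \<open>a (Suc n)\<close> are both the corner
    0.\<close>
  also have "b (Suc n) # rev ?a @ [vB] = rev lAB" by (simp add: lAB_def)
  finally show ?thesis unfolding boundary_edges_def path_edges_rev by (auto simp: insert_commute)
qed

end

context segment_halin
begin

text \<open>Degree at least 3 needs two segments, so no vertex is a mere endpoint.\<close>

lemma intersection_points_eq: "intersection_points M = V"
proof
  show "intersection_points M \<subseteq> V" by (auto simp: seg_verts_def)
  show "V \<subseteq> intersection_points M"
  proof
    fix v assume v: "v \<in> V"
    have "3 \<le> 2 * seg_count M v" using vdegree_plus_end_count[OF v] degree_ge_3[OF v] by linarith
    then have "\<not> card {t \<in> M. v \<in> t} \<le> Suc 0" unfolding seg_count_def by linarith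
    then show "v \<in> intersection_points M"
      using card_le_Suc0_iff_eq[of "{t \<in> M. v \<in> t}"] finite_M by (auto simp: intersection_points_def)
  qed
qed

lemma finite_circuits: "finite (circuits M)"
proof -
  have "drawing (T \<union> C) = \<Union>M" using Union_edges E by simp
  then have "finite (components (- \<Union>M))" using card_components_drawing[OF finite_C order_refl] by metis
  then show ?thesis unfolding circuits_def by simp
qed

end

context fan
begin

lemma fan_halin: "halin_construction (seg_verts M) (seg_edges M) (tree_edges n) boundary_edges"
proof -
  have w: "plane_walk W (tree_edges n) (dn n @ up n @ hub)" using fan_walk[of n] tree_verts_eq by simp
  have tree: "is_tree W (tree_edges n)" using grown_is_tree plane_walk_grown[OF w] by blast
  obtain \<rho> where \<rho>: "rotation_system W (tree_edges n) \<rho>" "boundary_walk (tree_edges n) \<rho> (dn n @ up n @ hub)"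
    using plane_walk_rotation[OF w] by blast
  have "clockwise_leaves (tree_edges n) \<rho> fan_leaves"
    unfolding clockwise_leaves_def using \<rho>(2) fan_leaves_walk by metis
  moreover have "vdegree (tree_edges n) v \<noteq> 2" if "v \<in> W" for v
  proof -
    have "v \<in> tree_verts n" using that tree_verts_eq by simp
    then consider i where "i \<le> n" "v = s i" | "v = s (Suc n)" | i where "i \<le> n" "v = a i" | i where "i \<le> n" "v = b i" | "v \<in> {vB, vC, vP}"
      unfolding tree_verts_def by (auto simp: atMost_Suc)
    then show ?thesis
    proof cases
      case (1 i) then show ?thesis using degree_inner[of i] by simp
    qed (use degree_one in \<open>simp_all del: corner_zero\<close>)
  qed
  moreover have "3 \<le> length fan_leaves" by (simp add: fan_leaves_def)
  ultimately show ?thesis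
    unfolding halin_construction_def seg_verts_M using tree \<rho>(1) cycle_fan_leaves seg_edges_M by metis
qed

section \<open>The outer face of the example\<close>

lemma frontier_tri: "frontier tri = AB \<union> BC \<union> AC" 
  unfolding tri_hull segs using frontier_of_triangle[of 0 vB vC] by (simp add: closed_segment_commute)

lemma Union_M_subset: "\<Union>M \<subseteq> tri" by (auto simp: M_def chop_def)

lemma frontier_tri_subset: "frontier tri \<subseteq> \<Union>M" unfolding frontier_tri by (auto simp: M_def)

lemma outside_M: "outside (\<Union>M) = - tri"
proof
  have "bounded tri" "closed tri" unfolding tri_hull
    by (simp_all add: bounded_convex_hull compact_imp_closed finite_imp_compact_convex_hull)
  then show "outside (\<Union>M) \<subseteq> - tri"
    using outside_mono[OF frontier_tri_subset] outside_frontier_misses_closure[of tri] by simp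
  show "- tri \<subseteq> outside (\<Union>M)" by (rule outside_subset_convex[OF convex_tri Union_M_subset])
qed

lemma fan_outer_edges: "outer_edges M = boundary_edges"
proof -
  have fr: "frontier (outside (\<Union>M)) = AB \<union> BC \<union> AC" by (simp add: outside_M frontier_complement frontier_tri)
  have inM: "AB \<in> M" "AC \<in> M" "BC \<in> M" by (auto simp: M_def)
  show ?thesis
  proof
    show "boundary_edges \<subseteq> outer_edges M"
    proof
      fix e assume e: "e \<in> boundary_edges"
      then obtain t where t: "t \<in> {AB, AC, BC}" "e \<subseteq> t" "e \<in> seg_edges M"
        unfolding boundary_edges_def edges_on(1-3)[symmetric] by blast
      then have "convex t" using inM convex_seg by blast
      then have "convex hull e \<subseteq> t" using t(2) by (simp add: hull_minimal)
      then show "e \<in> outer_edges M" unfolding outer_edges_def fr using t by blast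
    qed
    show "outer_edges M \<subseteq> boundary_edges"
    proof
      fix e assume "e \<in> outer_edges M"
      then have e: "e \<in> seg_edges M" "convex hull e \<subseteq> AB \<union> BC \<union> AC" unfolding outer_edges_def fr by auto
      obtain u v t where uv: "e = {u, v}" "u \<noteq> v" "t \<in> M" "u \<in> t" "v \<in> t" "seg_verts M \<inter> open_segment u v = {}"
        using edgeE[OF e(1)] by metis
      \<comment> \<open>The midpoint of an edge is no vertex, hence on one segment only; this
        identifies the side that carries the edge.\<close>
      let ?m = "midpoint u v"
      have m: "?m \<in> open_segment u v" using uv(2) by simp
      then have "?m \<in> closed_segment u v" by (rule open_closed_segment)
      moreover have "closed_segment u v \<subseteq> t" using uv convex_seg[OF uv(3)] by (simp add: closed_segment_subset)
      ultimately have mt: "?m \<in> t" "?m \<in> convex hull e" using uv(1) by (auto simp: segment_convex_hull)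
      then obtain t' where t': "t' \<in> {AB, AC, BC}" "?m \<in> t'" using e(2) by blast
      have "t = t'"
      proof (rule ccontr)
        assume "t \<noteq> t'"
        then have "?m \<in> seg_verts M" using common_point_vert[of t t' ?m] uv(3) mt t' inM by blast
        then show False using m uv(6) by blast
      qed
      then show "e \<in> boundary_edges" using t' uv e(1) unfolding boundary_edges_def edges_on(1-3)[symmetric] by auto
    qed
  qed
qed

lemma fan_segment_halin_graph: "segment_halin_graph M"
  unfolding segment_halin_graph_def using segment_system_M fan_halin fan_outer_edges by blast

section \<open>Counting segments, circuits and vertices of the example\<close>

lemma card_M: "card M = n + 6"
proof -
  note d = chop_def tri_def
  have B: "vB \<in> AB" "vB \<notin> AC" "vB \<in> BC" "vB \<notin> AP" "vB \<in> BQ" "vB \<notin> CR" "vB \<notin> XY i" for i using K by (auto simp: d)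
  have C: "vC \<notin> AB" "vC \<in> AC" "vC \<in> BC" "vC \<notin> AP" "vC \<notin> BQ" "vC \<in> CR" "vC \<notin> XY i" for i using K by (auto simp: d)
  have P: "vP \<in> AP" "vP \<notin> XY i" for i using K by (auto simp: d)
  have O: "0 \<in> AB" "0 \<notin> BC" "0 \<notin> BQ" "0 \<in> AC" "0 \<notin> CR" using K by (auto simp: d)
  have "card {AB, AC, BC, AP, BQ, CR} = 6"
  proof -
    have "AB \<notin> {AC, BC, AP, BQ, CR}" "AC \<notin> {BC, AP, BQ, CR}" "BC \<notin> {AP, BQ, CR}" "AP \<notin> {BQ, CR}" "BQ \<notin> {CR}"
      using B C O by (metis insert_iff empty_iff)+
    then show ?thesis by (simp add: card_insert_if)
  qed
  moreover have "inj_on XY {1..n}"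
  proof (rule inj_onI)
    fix i j assume ij: "i \<in> {1..n}" "j \<in> {1..n}" "XY i = XY j"
    have "a i \<in> XY i" using ij(1) by (auto simp: d K_def)
    then have "a i \<in> XY j" using ij(3) by simp
    then show "i = j" by (simp add: d)
  qed
  then have "card (XY ` {1..n}) = n" by (simp add: card_image)
  moreover have "{AB, AC, BC, AP, BQ, CR} \<inter> XY ` {1..n} = {}" using B C P by (auto simp: disjoint_iff)
  ultimately show ?thesis unfolding M_def by (subst card_Un_disjoint) auto
qed

lemma component_subset_tri:
  assumes "z \<in> tri" "z \<notin> \<Union>M" shows "connected_component_set (- \<Union>M) z \<subseteq> tri"
proof (rule ccontr)
  let ?F = "connected_component_set (- \<Union>M) z"
  assume "\<not> ?F \<subseteq> tri"
  then have "?F - tri \<noteq> {}" by blast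
  moreover have "z \<in> ?F" using assms by simp
  ultimately have "?F \<inter> frontier tri \<noteq> {}" using connected_Int_frontier[of ?F tri] assms(1) connected_connected_component by blast
  then show False using frontier_tri_subset connected_component_subset[of "- \<Union>M" z] by blast
qed

text \<open>The face of a point in the triangle stays in the triangle, where crossing the line of a
  segment means crossing the segment itself.\<close>

lemma same_side:
  assumes z: "z \<in> tri" "z \<notin> \<Union>M" and c: "connected_component (- \<Union>M) z z'" and M: "chop \<alpha> \<beta> \<gamma> \<in> M"
  shows "\<alpha> * Re z + \<beta> * Im z < \<gamma> \<longleftrightarrow> \<alpha> * Re z' + \<beta> * Im z' < \<gamma>"
proof -
  let ?F = "connected_component_set (- \<Union>M) z" and ?g = "\<lambda>x. \<alpha> * Re x + \<beta> * Im x"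
  have zF: "z \<in> ?F" "z' \<in> ?F" using z c by auto
  have ne: "?g x \<noteq> \<gamma>" if "x \<in> ?F" for x
  proof -
    have "x \<in> tri" "x \<notin> \<Union>M" using that component_subset_tri[OF z] connected_component_subset[of "- \<Union>M" z] by blast+
    then show ?thesis using M by (auto simp: chop_def)
  qed
  have cont: "continuous_on UNIV ?g" by (intro continuous_intros)
  have op: "open {x. ?g x < \<gamma>}" "open {x. \<gamma> < ?g x}"
    using cont by (simp_all add: open_Collect_less continuous_on_const)
  have "\<not> (\<exists>x\<in>?F. \<exists>y\<in>?F. ?g x < \<gamma> \<and> \<gamma> < ?g y)"
  proof
    assume "\<exists>x\<in>?F. \<exists>y\<in>?F. ?g x < \<gamma> \<and> \<gamma> < ?g y"
    then have "{x. ?g x < \<gamma>} \<inter> ?F \<noteq> {}" "{x. \<gamma> < ?g x} \<inter> ?F \<noteq> {}" by blast+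
    moreover have "{x. ?g x < \<gamma>} \<inter> {x. \<gamma> < ?g x} \<inter> ?F = {}" by auto
    moreover have "?F \<subseteq> {x. ?g x < \<gamma>} \<union> {x. \<gamma> < ?g x}" using ne by fastforce
    ultimately show False using connectedD[OF connected_connected_component[of "- \<Union>M" z] op] by blast
  qed
  then show ?thesis using zF ne by (metis linorder_neqE_linordered_idom)
qed

text \<open>One point in every bounded face: two below each chord, and six around the centroid.\<close>

definition low :: "nat \<times> real \<Rightarrow> complex" where
  "low = (\<lambda>(i, \<sigma>). Complex ((K - real i - 1/2) / 2 + \<sigma> / 8) ((K - real i - 1/2) / 2 - \<sigma> / 8))"

definition high :: "real \<times> real \<Rightarrow> complex" where
  "high = (\<lambda>(u, v). Complex (2 * K / 3 + u * K / 12) (2 * K / 3 + v * K / 12))"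

definition "low_idx = {1..n} \<times> {1, - 1 :: real}"
definition "high_idx = {(1, 0), (0, 1), (- 1, 0), (0, - 1), (1, - 1), (- 1, 1) :: real \<times> real}"

lemma low_face: assumes "p \<in> low_idx" shows "low p \<in> tri" "low p \<notin> \<Union>M"
proof -
  obtain i \<sigma> where p: "p = (i, \<sigma>)" "1 \<le> i" "i \<le> n" "\<sigma> = 1 \<or> \<sigma> = - 1" using assms by (auto simp: low_idx_def)
  have Ki: "K - real i \<ge> 1" "K - real i \<le> K - 1" using p by (auto simp: K_def)
  \<comment> \<open>The chords have integral coordinate sums, the points \<open>low\<close>
    half-integral ones.\<close>
  have half: "K - real i - 1/2 \<noteq> K - real j" for j
  proof
    assume "K - real i - 1/2 = K - real j"
    then have "real (2 * j) = real (2 * i + 1)" by simp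
    then have "2 * j = 2 * i + 1" using of_nat_eq_iff by blast
    then show False by presburger
  qed
  have sum: "Re (low p) + Im (low p) = K - real i - 1/2" by (simp add: low_def p)
  have co: "Re (low p) = (K - real i - 1/2) / 2 + \<sigma> / 8" "Im (low p) = (K - real i - 1/2) / 2 - \<sigma> / 8" by (auto simp: low_def p)
  show "low p \<in> tri" unfolding tri_def mem_Collect_eq sum co using p(4) Ki by auto
  have "low p \<notin> XY j" for j unfolding chop_def using half[of j] sum by simp
  moreover have "low p \<notin> AB" "low p \<notin> AC" "low p \<notin> BC" "low p \<notin> AP" "low p \<notin> BQ" "low p \<notin> CR"
  proof -
    define t where "t = K - real i - 1/2"
    have "t \<ge> 1/2" using Ki(1) by (simp add: t_def)
    then have R: "Re (low p) > 0" "Im (low p) > 0" unfolding co t_def[symmetric] using p(4) by auto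
    have D: "Re (low p) \<noteq> Im (low p)" unfolding co using p(4) by auto
    have S: "Re (low p) + Im (low p) < K" unfolding sum by simp
    show "low p \<notin> AB" "low p \<notin> AC" "low p \<notin> BC" "low p \<notin> AP" "low p \<notin> BQ" "low p \<notin> CR"
      unfolding chop_def using R D S K by auto
  qed
  ultimately show "low p \<notin> \<Union>M" unfolding M_def by auto
qed

lemma high_face: assumes "p \<in> high_idx" shows "high p \<in> tri" "high p \<notin> \<Union>M"
proof -
  obtain u v where p: "p = (u, v)" "(u, v) \<in> high_idx" using assms by (cases p) auto
  have co: "Re (high p) = 2 * K / 3 + u * K / 12" "Im (high p) = 2 * K / 3 + v * K / 12" by (auto simp: high_def p)
  show "high p \<in> tri" unfolding tri_def mem_Collect_eq co using p(2) K by (auto simp: high_idx_def)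
  have "high p \<notin> XY j" for j unfolding chop_def mem_Collect_eq co using p(2) K by (auto simp: high_idx_def)
  moreover have "high p \<notin> AB" "high p \<notin> AC" "high p \<notin> BC" "high p \<notin> AP" "high p \<notin> BQ" "high p \<notin> CR"
    unfolding chop_def mem_Collect_eq co using p(2) K by (auto simp: high_idx_def)
  ultimately show "high p \<notin> \<Union>M" unfolding M_def by auto
qed

lemma face_in_circuits:
  assumes "z \<in> tri" "z \<notin> \<Union>M" shows "connected_component_set (- \<Union>M) z \<in> circuits M"
proof -
  have "bounded tri" unfolding tri_hull by (simp add: bounded_convex_hull)
  then have "bounded (connected_component_set (- \<Union>M) z)" using component_subset_tri[OF assms] bounded_subset by blast
  then show ?thesis unfolding circuits_def using assms by (auto simp: components_def)
qed

text \<open>Two points of one face are on the same side of every segment. The chords and the median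
  \<open>AP\<close> tell the points \<open>low\<close> apart, the signs at the three medians the
  points \<open>high\<close>, and chord \<open>i\<close> separates the two families.\<close>

lemma card_circuits_ge:
  assumes fin: "finite (circuits M)" shows "2 * n + 6 \<le> card (circuits M)"
proof -
  let ?F = "\<lambda>z. connected_component_set (- \<Union>M) z"
  have eqD: "connected_component (- \<Union>M) z z'" if "?F z = ?F z'" "z' \<notin> \<Union>M" for z z'
    using that by (metis ComplI connected_component_refl mem_Collect_eq)
  have inM: "AP \<in> M" "BQ \<in> M" "CR \<in> M" "i \<in> {1..n} \<Longrightarrow> XY i \<in> M" for i by (auto simp: M_def)
  have low_side: "1 * Re (low (i, \<sigma>)) + 1 * Im (low (i, \<sigma>)) < K - real j \<longleftrightarrow> j \<le> i" for i j \<sigma>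
    by (auto simp: low_def)
  have inj1: "inj_on (?F \<circ> low) low_idx"
  proof (rule inj_onI)
    fix p q assume pq: "p \<in> low_idx" "q \<in> low_idx" "(?F \<circ> low) p = (?F \<circ> low) q"
    obtain i \<sigma> j \<tau> where e: "p = (i, \<sigma>)" "q = (j, \<tau>)" "i \<in> {1..n}" "j \<in> {1..n}" "\<sigma> \<in> {1, -1}" "\<tau> \<in> {1, -1}"
      using pq(1,2) by (auto simp: low_idx_def)
    have cc: "connected_component (- \<Union>M) (low p) (low q)" using eqD pq low_face by simp
    note side = same_side[OF low_face[OF pq(1)] cc]
    have "i \<le> i \<longleftrightarrow> i \<le> j" "j \<le> i \<longleftrightarrow> j \<le> j"
      using side[OF inM(4)[OF e(3)]] side[OF inM(4)[OF e(4)]] unfolding e(1,2) low_side by blast+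
    then have "i = j" by simp
    moreover have "\<sigma> = \<tau>" using side[OF inM(1)] e by (auto simp: low_def)
    ultimately show "p = q" using e by simp
  qed
  have inj2: "inj_on (?F \<circ> high) high_idx"
  proof (rule inj_onI)
    fix p q assume pq: "p \<in> high_idx" "q \<in> high_idx" "(?F \<circ> high) p = (?F \<circ> high) q"
    have cc: "connected_component (- \<Union>M) (high p) (high q)" using eqD pq high_face by simp
    note side = same_side[OF high_face[OF pq(1)] cc]
    obtain u v u' v' where e: "p = (u, v)" "q = (u', v')" by fastforce
    have "1 * Re (high (x, y)) + (- 1) * Im (high (x, y)) < 0 \<longleftrightarrow> x < y"
      "1 * Re (high (x, y)) + 2 * Im (high (x, y)) < 2 * K \<longleftrightarrow> x + 2 * y < 0"
      "2 * Re (high (x, y)) + 1 * Im (high (x, y)) < 2 * K \<longleftrightarrow> 2 * x + y < 0" for x y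
    proof -
      have e: "1 * Re (high (x, y)) + (- 1) * Im (high (x, y)) = K / 12 * (x - y)"
        "1 * Re (high (x, y)) + 2 * Im (high (x, y)) - 2 * K = K / 12 * (x + 2 * y)"
        "2 * Re (high (x, y)) + 1 * Im (high (x, y)) - 2 * K = K / 12 * (2 * x + y)"
        by (simp_all add: high_def field_simps)
      have k: "K / 12 * r < 0 \<longleftrightarrow> r < 0" for r using K by (simp add: mult_less_0_iff)
      show "1 * Re (high (x, y)) + (- 1) * Im (high (x, y)) < 0 \<longleftrightarrow> x < y" unfolding e k by simp
      have "A < 2 * K \<longleftrightarrow> r < 0" if "A - 2 * K = K / 12 * r" for A r
        using k[of r] that by (metis diff_less_0_iff_less)
      from this[OF e(2)] this[OF e(3)]
      show "1 * Re (high (x, y)) + 2 * Im (high (x, y)) < 2 * K \<longleftrightarrow> x + 2 * y < 0"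
        "2 * Re (high (x, y)) + 1 * Im (high (x, y)) < 2 * K \<longleftrightarrow> 2 * x + y < 0" .
    qed
    note hs = this
    have "u < v \<longleftrightarrow> u' < v'" "u + 2 * v < 0 \<longleftrightarrow> u' + 2 * v' < 0" "2 * u + v < 0 \<longleftrightarrow> 2 * u' + v' < 0"
      using side[OF inM(1)] side[OF inM(2)] side[OF inM(3)] unfolding e hs by blast+
    then show "p = q" using pq(1,2) unfolding e high_idx_def by auto
  qed
  have disj: "(?F \<circ> low) ` low_idx \<inter> (?F \<circ> high) ` high_idx = {}"
  proof (rule ccontr)
    assume "(?F \<circ> low) ` low_idx \<inter> (?F \<circ> high) ` high_idx \<noteq> {}"
    then obtain p q where pq: "p \<in> low_idx" "q \<in> high_idx" "?F (low p) = ?F (high q)" by auto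
    obtain i \<sigma> where e: "p = (i, \<sigma>)" "i \<in> {1..n}" using pq(1) by (auto simp: low_idx_def)
    have cc: "connected_component (- \<Union>M) (low p) (high q)" using eqD pq(3) high_face[OF pq(2)] by simp
    have "1 * Re (high q) + 1 * Im (high q) < K - real i"
      using same_side[OF low_face[OF pq(1)] cc inM(4)[OF e(2)]] unfolding e(1) low_side by blast
    then show False using pq(2) K by (auto simp: high_def high_idx_def)
  qed
  have c1: "card low_idx = 2 * n" by (simp add: low_idx_def card_cartesian_product)
  have c2: "card high_idx = 6" by (simp add: high_idx_def)
  have fi: "finite low_idx" "finite high_idx" by (auto simp: low_idx_def high_idx_def)
  have "card ((?F \<circ> low) ` low_idx \<union> (?F \<circ> high) ` high_idx) = 2 * n + 6"
    using fi disj c1 c2 by (simp only: card_Un_disjoint finite_imageI card_image[OF inj1] card_image[OF inj2])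
  moreover have "(?F \<circ> low) ` low_idx \<union> (?F \<circ> high) ` high_idx \<subseteq> circuits M"
    using face_in_circuits low_face high_face by auto
  ultimately show ?thesis using card_mono[OF fin] by metis
qed

text \<open>With n chords the values are m = n + 6, p = 3n + 7 and c = 2n + 6. Only the lower bounds
  for p and c are counted; the upper ones are the general bounds.\<close>

lemma fan_extremal:
  "int (card (intersection_points M)) = 3 * int (card M) - 11" "int (card (circuits M)) = 2 * int (card M) - 6"
proof -
  obtain ls where ls: "halin (seg_verts M) (seg_edges M) (tree_edges n) boundary_edges ls"
    using halin_construction_halin[OF fan_halin] .
  then have "segment_halin M (tree_edges n) boundary_edges ls"
    using fan_outer_edges segments_axioms by (simp add: segment_halin_def segment_halin_axioms_def)
  then interpret H: segment_halin M "tree_edges n" boundary_edges ls .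
  have "2 * n + 6 \<le> card (circuits M)" using card_circuits_ge H.finite_circuits by blast
  then show "int (card (circuits M)) = 2 * int (card M) - 6"
    using segment_halin_graph_bounds(2)[OF fan_segment_halin_graph] card_M by linarith
  have "distinct ([s 0, a 0, b 0, vB, vC, vP] @ map s [1..<Suc (Suc n)] @ map a [1..<Suc n] @ map b [1..<Suc n])"
    by (auto simp: distinct_points distinct_map inj_on_def simp del: corner_zero upt_Suc)
  moreover have "set ([s 0, a 0, b 0, vB, vC, vP] @ map s [1..<Suc (Suc n)] @ map a [1..<Suc n] @ map b [1..<Suc n]) \<subseteq> W"
    using W_I by auto
  ultimately have "length ([s 0, a 0, b 0, vB, vC, vP] @ map s [1..<Suc (Suc n)] @ map a [1..<Suc n] @ map b [1..<Suc n]) \<le> card W"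
    using finite_verts seg_verts_M by (metis card_mono distinct_card)
  then have "3 * n + 7 \<le> card (intersection_points M)" unfolding H.intersection_points_eq seg_verts_M by (simp del: upt_Suc)
  then show "int (card (intersection_points M)) = 3 * int (card M) - 11"
    using segment_halin_graph_bounds(1)[OF fan_segment_halin_graph] card_M by linarith
qed

end

theorem theorem2:
  shows "(\<forall>M. segment_halin_graph M \<longrightarrow>
            int (card (intersection_points M)) \<le> 3 * int (card M) - 11 \<and>
            int (card (circuits M)) \<le> 2 * int (card M) - 6) \<and>
         infinite {card M | M. segment_halin_graph M \<and>
            int (card (intersection_points M)) = 3 * int (card M) - 11 \<and>
            int (card (circuits M)) = 2 * int (card M) - 6}"
proof
  let ?S = "{card M | M. segment_halin_graph M \<and> int (card (intersection_points M)) = 3 * int (card M) - 11 \<and>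
    int (card (circuits M)) = 2 * int (card M) - 6}"
  show "\<forall>M. segment_halin_graph M \<longrightarrow> int (card (intersection_points M)) \<le> 3 * int (card M) - 11 \<and>
      int (card (circuits M)) \<le> 2 * int (card M) - 6"
    using segment_halin_graph_bounds by blast
  have "n + 6 \<in> ?S" for n :: nat
  proof -
    have "n + 6 = card (fan.M n)" by (simp add: fan.card_M)
    then show ?thesis using fan.fan_segment_halin_graph[of n] fan.fan_extremal[of n] by blast
  qed
  then have "range (\<lambda>n. n + 6) \<subseteq> ?S" by blast
  moreover have "infinite (range (\<lambda>n :: nat. n + 6))" by (rule range_inj_infinite) (simp add: inj_on_def)
  ultimately show "infinite ?S" by (rule infinite_super)
qed


end
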